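(* Let $\mu\in\mathcal M_{i,0}^*$. (a) Assume $a(\mu)<1$. For $0<\delta<1-a(\mu)$ we have $$a\big((1+x^2)^{\delta}d\mu(x)\big)=a(\mu)+\delta.$$ (b) Assume $0<a(\mu)$. For $0<\delta<a(\mu)$ we have $$a\big((1+x^2)^{-\delta}d\mu(x)\big)=a(\mu)-\delta.$$
   Context: $\mathcal M^*$ denotes the set of positive measures on $\mathbb R$ with infinite support and moments of every order. A measure $\mu\in\mathcal M^*$ is determinate if it is the only measure in $\mathcal M^*$ with the moments $s_n=\int x^n\,d\mu(x)$, $n\ge 0$; otherwise it is indeterminate. $\mathcal M_d^*$ and $\mathcal M_i^*$ denote the sets of determinate, respectively indeterminate, measures in $\mathcal M^*$. An indeterminate measure $\mu$ is called N-extremal if (after normalization to mass 1) it is one of the solutions of its moment problem corresponding to a constant parameter $t\in\mathbb R\cup\{\infty\}$ in the Nevanlinna parametrization; by a theorem of M. Riesz, for indeterminate $\mu$ this is equivalent to $\mathbb C[x]$ being dense in $L^2(\mu)$. $\mathcal M_{i,0}^*$ denotes the set of measures in $\mathcal M^*$ that are indeterminate and N-extremal. For $0\le\alpha\le 1$ put $$A(\alpha)=\{\mu\in\mathcal M_i^*\mid (1+x^2)^{-\alpha}d\mu(x)\in\mathcal M_i^*\},\qquad B(\alpha)=\{\mu\in\mathcal M_i^*\mid (1+x^2)^{-\alpha}d\mu(x)\in\mathcal M_d^*\}.$$ For $\mu\in\mathcal M_{i,0}^*$ define $$a(\mu)=\sup\{\alpha\in[0,1]\mid \mu\in A(\alpha)\}=\inf\{\beta\in[0,1]\mid\mu\in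 B(\beta)\}$$ (the two expressions coincide). *)

theory Defs
  imports "HOL-Probability.Probability" "HOL-Computational_Algebra.Polynomial"
begin

definition measure_support :: "real measure \<Rightarrow> real set" where
  "measure_support \<mu> = {x. \<forall>e>0. emeasure \<mu> (ball x e) > 0}"

definition Mstar :: "real measure set" where
  "Mstar = {\<mu>. sets \<mu> = sets borel \<and> infinite (measure_support \<mu>) \<and>
    (\<forall>n::nat. integrable \<mu> (\<lambda>x. x ^ n))}"

definition moment :: "real measure \<Rightarrow> nat \<Rightarrow> real" where
  "moment \<mu> n = (LINT x|\<mu>. x ^ n)"

definition determinate :: "real measure \<Rightarrow> bool" where
  "determinate \<mu> \<longleftrightarrow> (\<forall>\<nu>\<in>Mstar. (\<forall>n. moment \<nu> n = moment \<mu> n) \<longrightarrow> \<nu> = \<mu>)"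

definition Mstar_d :: "real measure set" where
  "Mstar_d = {\<mu> \<in> Mstar. determinate \<mu>}"

definition Mstar_i :: "real measure set" where
  "Mstar_i = {\<mu> \<in> Mstar. \<not> determinate \<mu>}"

definition normalized :: "real measure \<Rightarrow> real measure" where
  "normalized \<mu> = density \<mu> (\<lambda>_. 1 / emeasure \<mu> (space \<mu>))"

definition orthonormal_polys :: "real measure \<Rightarrow> (nat \<Rightarrow> real poly) \<Rightarrow> bool" where
  "orthonormal_polys \<mu> P \<longleftrightarrow>
    (\<forall>n. degree (P n) = n \<and> lead_coeff (P n) > 0) \<and>
    (\<forall>m n. (LINT x|\<mu>. poly (P m) x * poly (P n) x) = (if m = n then 1 else 0))"

text \<open>Such a sequence exists and is unique for every measure in \<^const>\<open>Mstar\<close>.\<close>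

definition orth_poly :: "real measure \<Rightarrow> nat \<Rightarrow> complex poly" where
  "orth_poly \<mu> n = map_poly complex_of_real ((THE P. orthonormal_polys \<mu> P) n)"

definition Pfun :: "real measure \<Rightarrow> nat \<Rightarrow> complex \<Rightarrow> complex" where
  "Pfun \<mu> n z = poly (orth_poly \<mu> n) z"

text \<open>
  Polynomials of the second kind, $Q_n(z) = \int (P_n(z)-P_n(x))/(z-x)\,d\mu(x)$.
  As a function of $x$, the polynomial \<^term>\<open>synthetic_div p z\<close> is the difference quotient
  $(p(z)-p(x))/(z-x)$, with the value $p'(z)$ at $x = z$; this matters for $z = 0$, which may
  carry mass.
\<close>

definition Qfun :: "real measure \<Rightarrow> nat \<Rightarrow> complex \<Rightarrow> complex" where
  "Qfun \<mu> n z = (LINT x|\<mu>. poly (synthetic_div (orth_poly \<mu> n) z) (complex_of_real x))"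

text \<open>
  The four entire functions of the Nevanlinna parametrization, for an indeterminate
  measure of mass 1.
\<close>

definition nevA :: "real measure \<Rightarrow> complex \<Rightarrow> complex" where
  "nevA \<mu> z = z * (\<Sum>k. Qfun \<mu> k 0 * Qfun \<mu> k z)"

definition nevB :: "real measure \<Rightarrow> complex \<Rightarrow> complex" where
  "nevB \<mu> z = -1 + z * (\<Sum>k. Qfun \<mu> k 0 * Pfun \<mu> k z)"

definition nevC :: "real measure \<Rightarrow> complex \<Rightarrow> complex" where
  "nevC \<mu> z = 1 + z * (\<Sum>k. Pfun \<mu> k 0 * Qfun \<mu> k z)"

definition nevD :: "real measure \<Rightarrow> complex \<Rightarrow> complex" where
  "nevD \<mu> z = z * (\<Sum>k. Pfun \<mu> k 0 * Pfun \<mu> k z)"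

definition stieltjes :: "real measure \<Rightarrow> complex \<Rightarrow> complex" where
  "stieltjes \<mu> z = (LINT x|\<mu>. 1 / (complex_of_real x - z))"

text \<open>
  In the Nevanlinna parametrization the solution with parameter $\varphi$ (a Pick function
  or $\infty$) has Stieltjes transform $-(A\varphi-C)/(B\varphi-D)$ off the real axis.  Here
  the parameter is a constant, \<^term>\<open>None\<close> standing for $\infty$.
\<close>

fun nev_transform :: "real measure \<Rightarrow> real option \<Rightarrow> complex \<Rightarrow> complex" where
  "nev_transform \<mu> (Some t) z =
     - (nevA \<mu> z * complex_of_real t - nevC \<mu> z) / (nevB \<mu> z * complex_of_real t - nevD \<mu> z)"
| "nev_transform \<mu> None z = - nevA \<mu> z / nevB \<mu> z"

definition N_extremal :: "real measure \<Rightarrow> bool" where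
  "N_extremal \<mu> \<longleftrightarrow> (\<exists>t. \<forall>z. Im z \<noteq> 0 \<longrightarrow>
     stieltjes (normalized \<mu>) z = nev_transform (normalized \<mu>) t z)"

definition Mstar_i0 :: "real measure set" where
  "Mstar_i0 = {\<mu> \<in> Mstar_i. N_extremal \<mu>}"

definition weighted :: "real \<Rightarrow> real measure \<Rightarrow> real measure" where
  "weighted \<gamma> \<mu> = density \<mu> (\<lambda>x. ennreal ((1 + x\<^sup>2) powr \<gamma>))"

definition Aset :: "real \<Rightarrow> real measure set" where
  "Aset \<alpha> = {\<mu> \<in> Mstar_i. weighted (- \<alpha>) \<mu> \<in> Mstar_i}"

definition Bset :: "real \<Rightarrow> real measure set" where
  "Bset \<alpha> = {\<mu> \<in> Mstar_i. weighted (- \<alpha>) \<mu> \<in> Mstar_d}"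

text \<open>
  On \<^const>\<open>Mstar_i0\<close> this also equals the infimum of all $\beta \in [0,1]$ with
  $\mu \in B(\beta)$.  Only the values on \<^const>\<open>Mstar_i0\<close> are meaningful.
\<close>

definition a_index :: "real measure \<Rightarrow> real" where
  "a_index \<mu> = Sup {\<alpha> \<in> {0..1}. \<mu> \<in> Aset \<alpha>}"

end

theory Submission
  imports Defs "HOL-Computational_Algebra.Fundamental_Theorem_Algebra"
begin

text \<open>
  Call \<open>\<mu>\<close> of limit-circle type if \<open>\<Sum>\<bar>P\<^sub>k(z)\<bar>\<^sup>2 < \<infinity>\<close> for some non-real \<open>z\<close>, equivalently if
  evaluation at \<open>z\<close> is a bounded functional on the polynomials in \<open>L\<^sup>2(\<mu>)\<close>; by variation of constants
  the sum then converges at every point.  This is equivalent to indeterminacy: two solutions of the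
  moment problem have different Stieltjes transforms at some non-real \<open>z\<close>, which bounds evaluation at
  \<open>z\<close>; conversely, Gauss quadratures with a prescribed real node \<open>x\<^sub>0\<close> have mass at least
  \<open>1 / \<Sum>\<bar>P\<^sub>k(x\<^sub>0)\<bar>\<^sup>2\<close> at \<open>x\<^sub>0\<close>, and a weak limit of them is a solution with an atom at \<open>x\<^sub>0\<close>.
  Hence indeterminacy is inherited by larger measures.

  Density of the polynomials in \<open>L\<^sup>2(\<mu>)\<close> is replaced by the approximability of all resolvents
  \<open>1 / (x - z)\<close>, which passes to smaller measures.  For indeterminate \<open>\<mu>\<close> it is equivalent to
  N-extremality: the Fourier coefficients of \<open>1 / (x - z)\<close> are \<open>P\<^sub>k(z) S(z) + Q\<^sub>k(z)\<close>, so both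
  conditions say that the row vectors \<open>(S(z), 1) T(z, 0)\<close> are proportional to one real vector, where
  \<open>T(z, w)\<close> is the transfer matrix built from the Nevanlinna functions.  Moreover (M. Riesz)
  \<open>\<mu>\<close> is determinate iff the resolvents are approximable in \<open>L\<^sup>2((1 + x\<^sup>2) d\<mu>)\<close>.  The
  proposition follows from these monotonicity properties along the family \<open>(1 + x\<^sup>2)\<^sup>\<gamma> d\<mu>\<close>.
\<close>

section \<open>Orthonormal polynomials\<close>

text \<open>All measures in play belong to one family \<open>weighted \<gamma> \<mu>\<close>. The
  exponents that give an indeterminate measure form an up-set of the real line with lower end
  -a(\<mu>), so shifting the exponent by \<delta> shifts the index by \<delta>, provided the cut-off
  to [0,1] does no harm. It does none because the exponent -1 is determinate: there the Riesz
  criterion asks for the resolvents in L2(\<mu>), which N-extremality supplies. The delicate point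
  is that the shifted measure must again be N-extremal. Lowering the exponent preserves
  approximability at once. Raising it by \<delta> goes against the monotonicity, and \<delta> < 1 -
  a(\<mu>) rescues it: for some \<beta> > a(\<mu>) with \<delta> \<le> 1 - \<beta> the exponent
  -\<beta> is determinate, so the resolvents are approximable at 1 - \<beta>, hence at \<delta>.
  Resolvents are preferred to density for two reasons: their approximability is Parseval's equality
  for explicit coefficients, hence an identity between 2x2 matrices; and an approximant r
  corresponds to the polynomial 1 - (x - z) r, which has value 1 at z.\<close>

lemma basis_expansion_exists:
  fixes \<pi> :: "nat \<Rightarrow> 'a::field poly"
  assumes "\<And>k. k < n \<Longrightarrow> degree (\<pi> k) = k \<and> \<pi> k \<noteq> 0"
    and "\<And>i. i \<ge> n \<Longrightarrow> coeff q i = 0"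
  shows "\<exists>c. q = (\<Sum>k<n. smult (c k) (\<pi> k))"
  using assms
proof (induction n arbitrary: q)
  \<comment> \<open>Vanishing coefficients, unlike \<open>degree q < n\<close>, make sense for n = 0
    and force q = 0 there.\<close>
  case 0
  then have "q = 0" by (intro poly_eqI) simp
  then show ?case by simp
next
  case (Suc n)
  define a where "a = coeff q n / coeff (\<pi> n) n"
  have lc: "degree (\<pi> n) = n" "coeff (\<pi> n) n \<noteq> 0"
    using Suc.prems(1)[of n] leading_coeff_neq_0[of "\<pi> n"] by auto
  have "coeff (q - smult a (\<pi> n)) i = 0" if "i \<ge> n" for i
  proof (cases "i = n")
    case True
    then show ?thesis using lc by (simp add: a_def)
  next
    case False
    then show ?thesis using that lc Suc.prems(2)[of i] by (simp add: coeff_eq_0)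
  qed
  with Suc.IH[of "q - smult a (\<pi> n)"] Suc.prems(1)
  obtain c where c: "q - smult a (\<pi> n) = (\<Sum>k<n. smult (c k) (\<pi> k))"
    by (metis less_SucI)
  have "q = (\<Sum>k<Suc n. smult ((c(n := a)) k) (\<pi> k))"
    using c by (simp add: algebra_simps)
  then show ?case by blast
qed

lemma coeff_eq_0_of_degree_less: "degree q < n \<Longrightarrow> i \<ge> n \<Longrightarrow> coeff q i = 0"
  by (simp add: coeff_eq_0)

locale Mstar_measure =
  fixes \<mu> :: "real measure"
  assumes Mstar: "\<mu> \<in> Mstar"
begin

lemma sets_mu [measurable_cong, simp]: "sets \<mu> = sets borel"
  using Mstar by (simp add: Mstar_def)

lemma space_mu [simp]: "space \<mu> = UNIV"
  using sets_eq_imp_space_eq[OF sets_mu] by simp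

lemma integrable_power: "integrable \<mu> (\<lambda>x. x ^ n)"
  using Mstar by (simp add: Mstar_def)

sublocale finite_measure \<mu>
proof
  have "integrable \<mu> (\<lambda>x. 1::real)" using integrable_power[of 0] by simp
  then show "emeasure \<mu> (space \<mu>) \<noteq> \<infinity>"
    by (auto simp: integrable_iff_bounded)
qed

lemma integrable_poly_real: "integrable \<mu> (\<lambda>x. poly p x)"
  unfolding poly_altdef by (intro Bochner_Integration.integrable_sum integrable_mult_right integrable_power)

lemma integrable_poly: "integrable \<mu> (\<lambda>x. poly p (complex_of_real x))"
proof -
  have "integrable \<mu> (\<lambda>x. complex_of_real (x ^ n))" for n
    using integrable_of_real[OF integrable_power] by blast
  then show ?thesis
    unfolding poly_altdef by (intro Bochner_Integration.integrable_sum integrable_mult_right) simp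
qed

text \<open>A nonzero polynomial has finitely many zeros, so some point of the infinite support has
  a ball free of zeros, and that ball carries mass. All strict positivity below rests on
  this.\<close>

lemma poly_AE_0_imp_0:
  fixes p :: "real poly"
  assumes "AE x in \<mu>. poly p x = 0"
  shows "p = 0"
proof (rule ccontr)
  assume "p \<noteq> 0"
  then have fin: "finite {x. poly p x = 0}" by (rule poly_roots_finite)
  have "infinite (measure_support \<mu>)" using Mstar by (simp add: Mstar_def)
  then obtain x where x: "x \<in> measure_support \<mu>" "poly p x \<noteq> 0"
    using finite_subset[OF _ fin, of "measure_support \<mu>"] by auto
  have "open (- {x. poly p x = 0})"
    using fin by (intro open_Compl finite_imp_closed)
  then obtain e where e: "e > 0" "ball x e \<subseteq> - {x. poly p x = 0}"
    using x(2) by (auto elim!: openE)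
  have "AE y in \<mu>. y \<notin> ball x e"
    using assms by eventually_elim (use e in auto)
  then have "emeasure \<mu> (ball x e) = 0"
    using AE_iff_null_sets[of "ball x e" \<mu>] by (auto simp: null_sets_def)
  moreover have "emeasure \<mu> (ball x e) > 0"
    using x(1) e(1) by (auto simp: measure_support_def)
  ultimately show False by simp
qed

lemma integral_square_pos:
  assumes "p \<noteq> 0"
  shows "(LINT x|\<mu>. poly (p * p) x) > 0"
proof -
  have nn: "(LINT x|\<mu>. poly (p * p) x) \<ge> 0" by (intro integral_nonneg_AE) simp
  have "(LINT x|\<mu>. poly (p * p) x) \<noteq> 0"
  proof
    assume "(LINT x|\<mu>. poly (p * p) x) = 0"
    then have "AE x in \<mu>. poly (p * p) x = 0"
      by (subst (asm) integral_nonneg_eq_0_iff_AE[OF integrable_poly_real]) simp_all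
    then have "p * p = 0" by (rule poly_AE_0_imp_0)
    with assms show False by simp
  qed
  with nn show ?thesis by linarith
qed

section \<open>The real moment functional and Gram-Schmidt\<close>

definition Lr :: "real poly \<Rightarrow> real" where "Lr p = (LINT x|\<mu>. poly p x)"

lemma Lr_add: "Lr (p + q) = Lr p + Lr q"
  by (simp add: Lr_def Bochner_Integration.integral_add integrable_poly_real)
lemma Lr_diff: "Lr (p - q) = Lr p - Lr q"
  by (simp add: Lr_def Bochner_Integration.integral_diff integrable_poly_real)
lemma Lr_smult: "Lr (smult a p) = a * Lr p"
  by (simp add: Lr_def)
lemma Lr_0 [simp]: "Lr 0 = 0" by (simp add: Lr_def)
lemma Lr_sum: "Lr (\<Sum>i\<in>I. f i) = (\<Sum>i\<in>I. Lr (f i))"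
  by (induction I rule: infinite_finite_induct) (simp_all add: Lr_add)

text \<open>Gram-Schmidt on the monomials, by strong induction: \<open>a k\<close> is the
  coefficient of the projection of x^n, with a positive denominator by
  \<open>integral_square_pos\<close>.\<close>

lemma monic_orthogonal_exists:
  "\<exists>p. degree p = n \<and> lead_coeff p = 1 \<and> (\<forall>q. degree q < n \<longrightarrow> Lr (p * q) = 0)"
proof (induction n rule: less_induct)
  case (less n)
  then obtain \<pi> where \<pi>: "\<And>k. k < n \<Longrightarrow> degree (\<pi> k) = k" "\<And>k. k < n \<Longrightarrow> lead_coeff (\<pi> k) = 1"
    "\<And>k q. k < n \<Longrightarrow> degree q < k \<Longrightarrow> Lr (\<pi> k * q) = 0"
    by metis
  have nz: "\<pi> k \<noteq> 0" if "k < n" for k using \<pi>(2)[OF that] by auto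
  define a where "a k = Lr (monom 1 n * \<pi> k) / Lr (\<pi> k * \<pi> k)" for k
  define s where "s = (\<Sum>k<n. smult (a k) (\<pi> k))"
  define p where "p = monom 1 n - s"
  have cs: "coeff s i = 0" if "i \<ge> n" for i
    unfolding s_def coeff_sum using that \<pi>(1) by (intro sum.neutral) (auto simp: coeff_eq_0)
  have dp: "degree p = n"
  proof (rule antisym)
    show "degree p \<le> n" by (rule degree_le) (simp add: p_def cs)
    show "n \<le> degree p" by (rule le_degree) (simp add: p_def cs)
  qed
  have lp: "lead_coeff p = 1" by (simp add: dp) (simp add: p_def cs)
  have ort: "Lr (\<pi> k * \<pi> j) = 0" if "j < n" "k < n" "j \<noteq> k" for j k
    using \<pi>(3)[of j "\<pi> k"] \<pi>(3)[of k "\<pi> j"] \<pi>(1)[of j] \<pi>(1)[of k] that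
    by (cases "j < k") (auto simp: mult.commute)
  have "Lr (p * \<pi> j) = 0" if j: "j < n" for j
  proof -
    have "Lr (s * \<pi> j) = (\<Sum>k<n. a k * Lr (\<pi> k * \<pi> j))"
      by (simp add: s_def sum_distrib_right Lr_sum Lr_smult)
    also have "\<dots> = a j * Lr (\<pi> j * \<pi> j)"
      using j ort by (subst sum.remove[of _ j]) (auto intro!: sum.neutral)
    also have "\<dots> = Lr (monom 1 n * \<pi> j)"
      using integral_square_pos[OF nz[OF j]] by (simp add: a_def Lr_def)
    finally show ?thesis by (simp add: p_def left_diff_distrib Lr_diff)
  qed
  then have "Lr (p * q) = 0" if "degree q < n" for q
  proof -
    obtain c where "q = (\<Sum>k<n. smult (c k) (\<pi> k))"
      using basis_expansion_exists[of n \<pi> q] \<pi>(1) nz coeff_eq_0_of_degree_less[OF \<open>degree q < n\<close>] by blast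
    then show ?thesis
      using \<open>\<And>j. j < n \<Longrightarrow> Lr (p * \<pi> j) = 0\<close> by (simp add: sum_distrib_left Lr_sum Lr_smult)
  qed
  with dp lp show ?case by blast
qed

lemma orthonormal_polysD:
  assumes "orthonormal_polys \<mu> P"
  shows "degree (P n) = n" "coeff (P n) n > 0" "P n \<noteq> 0"
    "Lr (P m * P n) = (if m = n then 1 else 0)"
proof -
  have "degree (P n) = n \<and> lead_coeff (P n) > 0"
    using assms unfolding orthonormal_polys_def by blast
  then show *: "degree (P n) = n" "coeff (P n) n > 0" by metis+
  then show "P n \<noteq> 0" by auto
  show "Lr (P m * P n) = (if m = n then 1 else 0)"
    using assms by (simp add: orthonormal_polys_def Lr_def)
qed

lemma orthonormal_polys_orthogonal:
  assumes "orthonormal_polys \<mu> P" "degree q < n"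
  shows "Lr (P n * q) = 0"
proof -
  have P: "degree (P k) = k" "P k \<noteq> 0" for k
    using orthonormal_polysD[OF assms(1)] by auto
  obtain c where q: "q = (\<Sum>k<n. smult (c k) (P k))"
    using basis_expansion_exists[of n P q] P coeff_eq_0_of_degree_less[OF assms(2)] by blast
  have "Lr (P n * P k) = 0" if "k < n" for k
    using orthonormal_polysD(4)[OF assms(1)] that by simp
  then show ?thesis by (simp add: q sum_distrib_left Lr_sum Lr_smult)
qed

text \<open>After scaling to equal leading coefficients the difference u has degree below n, so it
  is orthogonal to both polynomials and hence to itself. For n = 0 no such degree exists and u = 0
  is read off the coefficients.\<close>

lemma orthonormal_polys_unique:
  assumes "orthonormal_polys \<mu> P" "orthonormal_polys \<mu> R"
  shows "P = R"
proof
  fix n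
  have d: "degree (P n) = n" "degree (R n) = n" "coeff (P n) n > 0" "coeff (R n) n > 0"
    and nP: "Lr (P n * P n) = 1" "Lr (R n * R n) = 1"
    using orthonormal_polysD[OF assms(1)] orthonormal_polysD[OF assms(2)] by simp_all
  define c where "c = coeff (P n) n / coeff (R n) n"
  have c: "c > 0" using d by (simp add: c_def)
  define u where "u = P n - smult c (R n)"
  have cu: "coeff u i = 0" if "i \<ge> n" for i
  proof (cases "i = n")
    case True then show ?thesis using d by (auto simp: u_def c_def)
  next
    case False then show ?thesis using d that by (simp add: u_def coeff_eq_0)
  qed
  have "u = 0"
  proof (cases n)
    case 0 then show ?thesis using cu by (intro poly_eqI) simp
  next
    case (Suc m)
    have "degree u \<le> m" using cu Suc by (intro degree_le) auto
    then have "degree u < n" using Suc by simp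
    then have "Lr (P n * u) = 0" "Lr (R n * u) = 0"
      using orthonormal_polys_orthogonal assms by auto
    then have "Lr (u * u) = 0"
      by (subst (2) u_def) (simp add: algebra_simps Lr_diff Lr_smult)
    then show ?thesis using integral_square_pos[of u] unfolding Lr_def by fastforce
  qed
  then have eq: "P n = smult c (R n)" by (simp add: u_def)
  have "c * c = 1" using nP unfolding eq by (simp add: Lr_smult)
  with c have "c = 1" by (auto simp: square_eq_1_iff)
  with eq show "P n = R n" by simp
qed

lemma orthonormal_polys_exists: "\<exists>P. orthonormal_polys \<mu> P"
proof -
  obtain \<pi> where \<pi>: "\<And>k. degree (\<pi> k) = k" "\<And>k. lead_coeff (\<pi> k) = 1"
    "\<And>k q. degree q < k \<Longrightarrow> Lr (\<pi> k * q) = 0"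
    using monic_orthogonal_exists by metis
  define N where "N k = Lr (\<pi> k * \<pi> k)" for k
  have N: "N k > 0" for k
    using integral_square_pos[of "\<pi> k"] \<pi>(2)[of k] by (cases "\<pi> k = 0") (auto simp: N_def Lr_def)
  define P where "P k = smult (1 / sqrt (N k)) (\<pi> k)" for k
  have "Lr (\<pi> m * \<pi> n) = 0" if "m \<noteq> n" for m n
    using \<pi>(3)[of "\<pi> m" n] \<pi>(3)[of "\<pi> n" m] \<pi>(1) that
    by (cases "m < n") (auto simp: mult.commute)
  then have "Lr (P m * P n) = (if m = n then 1 else 0)" for m n
    using N[of n] by (auto simp: P_def Lr_smult N_def[symmetric] field_simps)
  moreover have "degree (P n) = n \<and> lead_coeff (P n) > 0" for n
    using N[of n] \<pi>(1,2)[of n] by (simp add: P_def)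
  ultimately have "orthonormal_polys \<mu> P"
    unfolding orthonormal_polys_def Lr_def poly_mult by blast
  then show ?thesis by blast
qed

definition rP :: "nat \<Rightarrow> real poly" where "rP = (THE P. orthonormal_polys \<mu> P)"

lemma orthonormal_rP: "orthonormal_polys \<mu> rP"
  unfolding rP_def
  by (rule theI'[of "orthonormal_polys \<mu>"]) (use orthonormal_polys_exists orthonormal_polys_unique in blast)

lemma degree_rP [simp]: "degree (rP n) = n"
  using orthonormal_polysD(1)[OF orthonormal_rP] .

lemma lead_coeff_rP: "coeff (rP n) n > 0"
  using orthonormal_polysD(2)[OF orthonormal_rP] .

section \<open>Complexification and the complex moment functional\<close>

abbreviation Pc :: "nat \<Rightarrow> complex poly" where "Pc \<equiv> orth_poly \<mu>"

lemma Pc_eq: "Pc n = map_poly complex_of_real (rP n)"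
  by (simp add: orth_poly_def rP_def)

lemma degree_Pc [simp]: "degree (Pc n) = n"
  by (simp add: Pc_eq degree_map_poly)

lemma coeff_Pc: "coeff (Pc n) i = of_real (coeff (rP n) i)"
  by (simp add: Pc_eq coeff_map_poly)

lemma Pc_nonzero [simp]: "Pc n \<noteq> 0"
  using lead_coeff_rP[of n] coeff_Pc[of n n] by auto

lemma poly_Pc_of_real: "poly (Pc n) (of_real x) = of_real (poly (rP n) x)"
  by (simp add: Pc_eq poly_altdef degree_map_poly coeff_map_poly)

lemma poly_Pc_cnj: "poly (Pc n) (cnj z) = cnj (poly (Pc n) z)"
  by (simp add: poly_altdef coeff_Pc)

text \<open>Used as a bilinear pairing L (f * g) without conjugation, which keeps all identities
  analytic in z; since \<open>Pc\<close> has real coefficients, orthonormality is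
  unaffected.\<close>

definition L :: "complex poly \<Rightarrow> complex" where
  "L p = (LINT x|\<mu>. poly p (complex_of_real x))"

lemma L_add: "L (p + q) = L p + L q"
  by (simp add: L_def Bochner_Integration.integral_add integrable_poly)
lemma L_diff: "L (p - q) = L p - L q"
  by (simp add: L_def Bochner_Integration.integral_diff integrable_poly)
lemma L_smult: "L (smult a p) = a * L p"
  by (simp add: L_def)
lemma L_0 [simp]: "L 0 = 0" by (simp add: L_def)
lemma L_sum: "L (\<Sum>i\<in>I. f i) = (\<Sum>i\<in>I. L (f i))"
  by (induction I rule: infinite_finite_induct) (simp_all add: L_add)

lemma L_Pc: "L (Pc m * Pc n) = (if m = n then 1 else 0)"
proof -
  have "L (Pc m * Pc n) = of_real (LINT x|\<mu>. poly (rP m) x * poly (rP n) x)"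
    by (simp add: L_def poly_Pc_of_real flip: of_real_mult)
  then show ?thesis using orthonormal_rP by (simp add: orthonormal_polys_def)
qed

lemma Pc_expansion:
  assumes "\<And>i. i \<ge> n \<Longrightarrow> coeff q i = 0"
  shows "q = (\<Sum>k<n. smult (L (q * Pc k)) (Pc k))"
proof -
  obtain c where c: "q = (\<Sum>k<n. smult (c k) (Pc k))"
    using basis_expansion_exists[of n Pc q, OF _ assms] by auto
  have "L (q * Pc j) = c j" if "j < n" for j
    using that by (simp add: c sum_distrib_right L_sum L_smult L_Pc if_distrib cong: if_cong)
  then have "(\<Sum>k<n. smult (L (q * Pc k)) (Pc k)) = (\<Sum>k<n. smult (c k) (Pc k))"
    by (intro sum.cong) auto
  with c show ?thesis by simp
qed

lemma L_Pc_orthogonal: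
  assumes "\<And>i. i \<ge> n \<Longrightarrow> coeff q i = 0"
  shows "L (Pc n * q) = 0"
proof -
  have "L (Pc n * q) = L (Pc n * (\<Sum>k<n. smult (L (q * Pc k)) (Pc k)))"
    using Pc_expansion[of n q] assms by simp
  also have "\<dots> = 0" by (simp add: sum_distrib_left L_sum L_smult L_Pc)
  finally show ?thesis .
qed

end

section \<open>Transfer matrices\<close>

lemma synthetic_div_eqI:
  fixes p q :: "'a::comm_ring_1 poly"
  assumes "p = [:-c, 1:] * q + [:r:]"
  shows "synthetic_div p c = q"
  using synthetic_div_unique[of p c q r] assms by simp

lemma synthetic_div_decomp:
  fixes p :: "'a::comm_ring_1 poly"
  shows "p = [:-c, 1:] * synthetic_div p c + [:poly p c:]"
  using synthetic_div_correct'[of c p] by simp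

lemma poly_eq_synthetic_div:
  fixes p :: "'a::comm_ring_1 poly"
  shows "poly p x = (x - c) * poly (synthetic_div p c) x + poly p c"
  by (subst synthetic_div_decomp[of p c]) (simp add: algebra_simps)

lemma synthetic_div_add: "synthetic_div (p + q) (c::'a::comm_ring_1) = synthetic_div p c + synthetic_div q c"
  by (rule synthetic_div_eqI[of _ _ _ "poly p c + poly q c"], subst synthetic_div_decomp[of p c],
      subst synthetic_div_decomp[of q c]) (simp add: algebra_simps)

lemma synthetic_div_smult: "synthetic_div (smult a p) (c::'a::comm_ring_1) = smult a (synthetic_div p c)"
  by (rule synthetic_div_eqI[of _ _ _ "a * poly p c"], subst synthetic_div_decomp[of p c])
    (simp add: algebra_simps smult_diff_right smult_add_right)

lemma synthetic_div_sum: "synthetic_div (\<Sum>i\<in>I. f i) (c::'a::comm_ring_1) = (\<Sum>i\<in>I. synthetic_div (f i) c)"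
  by (induction I rule: infinite_finite_induct) (simp_all add: synthetic_div_add)

text \<open>Here r is the difference quotient at w of the polynomial being divided. Moving the base
  point to z costs (z - w) times a second-order quotient; this makes second-kind polynomials at two
  points comparable.\<close>

lemma synthetic_div_linear_mult:
  fixes r :: "'a::comm_ring_1 poly"
  shows "synthetic_div ([:-w, 1:] * r + [:b:]) z = r + smult (z - w) (synthetic_div r z)"
proof (rule synthetic_div_eqI)
  let ?s = "synthetic_div r z"
  have "smult (z - w) r = smult (z - w) ([:-z, 1:] * ?s + [:poly r z:])"
    using synthetic_div_decomp[of r z] by simp
  also have "\<dots> = [:-z, 1:] * smult (z - w) ?s + [:(z - w) * poly r z:]"
    by (simp only: smult_add_right mult_smult_right smult_pCons smult_0_right)
  finally have 1: "smult (z - w) r = [:-z, 1:] * smult (z - w) ?s + [:(z - w) * poly r z:]" .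
  have "[:-w, 1:] * r + [:b:] = [:-z, 1:] * r + smult (z - w) r + [:b:]"
    by (simp add: algebra_simps smult_diff_left)
  also have "\<dots> = [:-z, 1:] * (r + smult (z - w) ?s) + ([:(z - w) * poly r z:] + [:b:])"
    unfolding 1 by (simp only: distrib_left add.assoc)
  finally show "[:-w, 1:] * r + [:b:] =
      [:-z, 1:] * (r + smult (z - w) ?s) + [:(z - w) * poly r z + b:]" by simp
qed

text \<open>A row vector is fixed by its products with two independent columns (Cramer's
  rule).\<close>

lemma matrix_eq_of_two_vectors:
  fixes a b a' b' :: complex
  assumes "a * x + b * y = a' * x + b' * y" "a * u + b * v = a' * u + b' * v" "x * v - u * y \<noteq> 0"
  shows "a = a'" "b = b'"
proof -
  have "(a - a') * (x * v - u * y) = v * ((a - a') * x + (b - b') * y) - y * ((a - a') * u + (b - b') * v)"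
    by (simp add: algebra_simps)
  also have "\<dots> = 0" using assms(1,2) by (simp add: algebra_simps)
  finally show "a = a'" using assms(3) by simp
  have "(b - b') * (x * v - u * y) = x * ((a - a') * u + (b - b') * v) - u * ((a - a') * x + (b - b') * y)"
    by (simp add: algebra_simps)
  also have "\<dots> = 0" using assms(1,2) by (simp add: algebra_simps)
  finally show "b = b'" using assms(3) by simp
qed

context Mstar_measure
begin

section \<open>First and second kind polynomials, variation of constants\<close>

abbreviation p :: "nat \<Rightarrow> complex \<Rightarrow> complex" where "p \<equiv> Pfun \<mu>"
abbreviation q :: "nat \<Rightarrow> complex \<Rightarrow> complex" where "q \<equiv> Qfun \<mu>"

lemma q_eq: "q n z = L (synthetic_div (Pc n) z)"
  by (simp add: Qfun_def L_def)

text \<open>The Casorati determinant (discrete Wronskian) of the first and second kind polynomials;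
  it is the kernel in the variation of constants.\<close>

definition wr :: "nat \<Rightarrow> nat \<Rightarrow> complex \<Rightarrow> complex" where
  "wr n k w = p k w * q n w - p n w * q k w"

lemma coeff_synthetic_div_Pc: "i \<ge> n \<Longrightarrow> coeff (synthetic_div (Pc n) w) i = 0"
  using synthetic_div_eq_0_iff[of "Pc n" w]
  by (cases n) (auto simp: coeff_eq_0 degree_synthetic_div)

text \<open>Dividing \<open>Pc k\<close> by x - w as well lets the two difference quotients trade
  places. The term \<open>Pc n * ?s\<close> integrates to 0 because the quotient of
  \<open>Pc k\<close> has degree below k \<le> n.\<close>

lemma L_synthetic_div_Pc:
  assumes "k \<le> n"
  shows "L (synthetic_div (Pc n) w * Pc k) = wr n k w"
proof -
  let ?r = "synthetic_div (Pc n) w" and ?s = "synthetic_div (Pc k) w"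
  have r: "[:-w, 1:] * ?r = Pc n - [:p n w:]"
    using synthetic_div_decomp[of "Pc n" w] by (simp add: Pfun_def algebra_simps)
  have "?r * Pc k = ?r * ([:-w, 1:] * ?s + [:p k w:])"
    using synthetic_div_decomp[of "Pc k" w] by (simp add: Pfun_def)
  also have "\<dots> = ([:-w, 1:] * ?r) * ?s + smult (p k w) ?r"
    by (simp add: algebra_simps)
  also have "\<dots> = Pc n * ?s - smult (p n w) ?s + smult (p k w) ?r"
    unfolding r by (simp add: algebra_simps)
  finally have "L (?r * Pc k) = L (Pc n * ?s) - p n w * q k w + p k w * q n w"
    by (simp add: L_add L_diff L_smult q_eq)
  moreover have "L (Pc n * ?s) = 0"
    using assms coeff_synthetic_div_Pc[of k] by (intro L_Pc_orthogonal) auto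
  ultimately show ?thesis by (simp add: wr_def)
qed

text \<open>The difference quotient of \<open>Pc (Suc n)\<close> keeps its leading coefficient, so
  its coefficient along \<open>Pc n\<close> is a ratio of leading coefficients. Its independence of
  w makes the transfer matrices unimodular.\<close>

lemma wr_Suc: "wr (Suc n) n w = coeff (Pc (Suc n)) (Suc n) / coeff (Pc n) n"
proof -
  let ?s = "synthetic_div (Pc (Suc n)) w"
  define \<rho> where "\<rho> = coeff (Pc (Suc n)) (Suc n) / coeff (Pc n) n"
  have lc: "coeff (Pc n) n \<noteq> 0" using leading_coeff_neq_0[OF Pc_nonzero[of n]] by simp
  have "coeff (Pc (Suc n) + smult w ?s) (Suc n) = coeff (pCons (poly (Pc (Suc n)) w) ?s) (Suc n)"
    by (simp only: synthetic_div_correct)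
  then have s: "coeff ?s n = coeff (Pc (Suc n)) (Suc n)"
    using coeff_synthetic_div_Pc[of "Suc n" "Suc n" w] by simp
  have "coeff (?s - smult \<rho> (Pc n)) i = 0" if "i \<ge> n" for i
  proof (cases "i = n")
    case True then show ?thesis using s lc by (simp add: \<rho>_def)
  next
    case False then show ?thesis using that coeff_synthetic_div_Pc[of "Suc n" i w] by (simp add: coeff_eq_0)
  qed
  from L_Pc_orthogonal[OF this] have "L (?s * Pc n) = \<rho>"
    by (simp add: algebra_simps L_diff L_smult L_Pc)
  then show ?thesis using L_synthetic_div_Pc[of n "Suc n" w] by (simp add: \<rho>_def)
qed

lemma wr_Suc_nonzero: "wr (Suc n) n w \<noteq> 0"
  using leading_coeff_neq_0[OF Pc_nonzero[of n]] leading_coeff_neq_0[OF Pc_nonzero[of "Suc n"]]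
  by (simp add: wr_Suc)

text \<open>Expand the difference quotient of \<open>P\<^sub>n\<close> at \<open>w\<close> in the basis \<open>P\<^sub>k\<close>.\<close>

lemma p_variation: "p n z = p n w + (z - w) * (\<Sum>k<n. wr n k w * p k z)"
  and q_variation: "q n z = q n w + (z - w) * (\<Sum>k<n. wr n k w * q k z)"
proof -
  let ?r = "synthetic_div (Pc n) w"
  have "?r = (\<Sum>k<n. smult (L (?r * Pc k)) (Pc k))"
    using coeff_synthetic_div_Pc by (intro Pc_expansion) auto
  also have "\<dots> = (\<Sum>k<n. smult (wr n k w) (Pc k))"
    by (intro sum.cong refl) (simp add: L_synthetic_div_Pc)
  finally have r: "?r = (\<Sum>k<n. smult (wr n k w) (Pc k))" .
  show "p n z = p n w + (z - w) * (\<Sum>k<n. wr n k w * p k z)"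
    using poly_eq_synthetic_div[of "Pc n" z w] by (subst (asm) r) (simp add: Pfun_def poly_sum)
  \<comment> \<open>Under \<open>L\<close> the first summand gives q n w, and the quotient of each
    \<open>Pc k\<close> in the expansion of \<open>?r\<close> gives q k z.\<close>
  have "synthetic_div (Pc n) z = ?r + smult (z - w) (synthetic_div ?r z)"
    using synthetic_div_linear_mult[of w ?r "p n w" z] synthetic_div_decomp[of "Pc n" w]
    by (simp add: Pfun_def)
  then have "q n z = q n w + (z - w) * L (synthetic_div ?r z)"
    by (simp add: q_eq L_add L_smult)
  also have "L (synthetic_div ?r z) = (\<Sum>k<n. wr n k w * q k z)"
    by (subst r) (simp add: synthetic_div_sum synthetic_div_smult L_sum L_smult q_eq)
  finally show "q n z = q n w + (z - w) * (\<Sum>k<n. wr n k w * q k z)" .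
qed

section \<open>Christoffel-Darboux type kernels and finite transfer matrices\<close>

definition PP where "PP N z w = (\<Sum>k<N. p k z * p k w)"
definition PQ where "PQ N z w = (\<Sum>k<N. p k z * q k w)"
definition QQ where "QQ N z w = (\<Sum>k<N. q k z * q k w)"

definition m11 where "m11 N z w = 1 - (z - w) * PQ N z w"
definition m12 where "m12 N z w = (z - w) * PP N z w"
definition m21 where "m21 N z w = - ((z - w) * QQ N z w)"
definition m22 where "m22 N z w = 1 + (z - w) * PQ N w z"

text \<open>Variation of constants in matrix form. The term k = n of the kernel vanishes,
  \<open>wr n n w\<close> being 0, so N may be n or n + 1. Thus the matrix of order
  \<open>Suc n\<close> serves two consecutive indices, n and \<open>Suc n\<close>, and these
  determine it.\<close>

lemma transfer_finite:
  assumes "N = n \<or> N = Suc n"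
  shows "p n z = m11 N z w * p n w + m12 N z w * q n w"
    and "q n z = m21 N z w * p n w + m22 N z w * q n w"
proof -
  have "(\<Sum>k<N. wr n k w * f k) = (\<Sum>k<n. wr n k w * f k)" for f
    using assms by (auto simp: wr_def)
  with p_variation[of n z w] q_variation[of n z w]
  have *: "p n z = p n w + (z - w) * (\<Sum>k<N. wr n k w * p k z)"
    "q n z = q n w + (z - w) * (\<Sum>k<N. wr n k w * q k z)" by simp_all
  have **: "(\<Sum>k<N. wr n k w * p k z) = PP N z w * q n w - PQ N z w * p n w"
    "(\<Sum>k<N. wr n k w * q k z) = PQ N w z * q n w - QQ N z w * p n w"
    by (simp_all add: wr_def PQ_def PP_def QQ_def sum_distrib_left sum_subtractf algebra_simps)
  show "p n z = m11 N z w * p n w + m12 N z w * q n w"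
    "q n z = m21 N z w * p n w + m22 N z w * q n w"
    unfolding m11_def m12_def m21_def m22_def using *(1)[unfolded **] *(2)[unfolded **]
    by (simp_all add: algebra_simps)
qed

text \<open>The matrix carries the columns (p, q) of indices n and \<open>Suc n\<close> from w to z.
  The determinant of these two columns is \<open>wr (Suc n) n\<close>, nonzero and the same at z and
  w.\<close>

lemma transfer_det_finite:
  "m11 (Suc n) z w * m22 (Suc n) z w - m12 (Suc n) z w * m21 (Suc n) z w = 1"
proof -
  have "wr (Suc n) n z = (m11 (Suc n) z w * m22 (Suc n) z w - m12 (Suc n) z w * m21 (Suc n) z w) * wr (Suc n) n w"
    unfolding wr_def transfer_finite[of "Suc n" n z w, OF disjI2[OF refl]]
      transfer_finite[of "Suc n" "Suc n" z w, OF disjI1[OF refl]]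
    by (simp add: algebra_simps)
  moreover have "wr (Suc n) n z = wr (Suc n) n w" by (simp add: wr_Suc)
  ultimately show ?thesis using wr_Suc_nonzero[of n w] by simp
qed

text \<open>Cocycle rule: both sides act alike on the columns of indices n and \<open>Suc n\<close>
  at v, which are independent.\<close>

lemma transfer_comp_finite:
  fixes z w v n
  defines "a \<equiv> m11 (Suc n)" and "b \<equiv> m12 (Suc n)" and "c \<equiv> m21 (Suc n)" and "d \<equiv> m22 (Suc n)"
  shows "a z w * a w v + b z w * c w v = a z v" "a z w * b w v + b z w * d w v = b z v"
    "c z w * a w v + d z w * c w v = c z v" "c z w * b w v + d z w * d w v = d z v"
proof -
  have P: "p m s = a s t * p m t + b s t * q m t" "q m s = c s t * p m t + d s t * q m t"
    if "m = n \<or> m = Suc n" for m s t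
    using transfer_finite[of "Suc n" m s t] that unfolding a_def b_def c_def d_def by auto
  have e: "(a z w * a w v + b z w * c w v) * p m v + (a z w * b w v + b z w * d w v) * q m v
      = a z v * p m v + b z v * q m v"
    "(c z w * a w v + d z w * c w v) * p m v + (c z w * b w v + d z w * d w v) * q m v
      = c z v * p m v + d z v * q m v" if "m = n \<or> m = Suc n" for m
  proof -
    have "a z v * p m v + b z v * q m v = a z w * p m w + b z w * q m w"
      using P[OF that, of z v] P[OF that, of z w] by simp
    also have "\<dots> = a z w * (a w v * p m v + b w v * q m v) + b z w * (c w v * p m v + d w v * q m v)"
      using P[OF that, of w v] by simp
    finally show "(a z w * a w v + b z w * c w v) * p m v + (a z w * b w v + b z w * d w v) * q m v
      = a z v * p m v + b z v * q m v" by (simp add: algebra_simps)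
    have "c z v * p m v + d z v * q m v = c z w * p m w + d z w * q m w"
      using P[OF that, of z v] P[OF that, of z w] by simp
    also have "\<dots> = c z w * (a w v * p m v + b w v * q m v) + d z w * (c w v * p m v + d w v * q m v)"
      using P[OF that, of w v] by simp
    finally show "(c z w * a w v + d z w * c w v) * p m v + (c z w * b w v + d z w * d w v) * q m v
      = c z v * p m v + d z v * q m v" by (simp add: algebra_simps)
  qed
  have nz: "p n v * q (Suc n) v - p (Suc n) v * q n v \<noteq> 0"
    using wr_Suc_nonzero[of n v] by (simp add: wr_def)
  show "a z w * a w v + b z w * c w v = a z v" "a z w * b w v + b z w * d w v = b z v"
    using matrix_eq_of_two_vectors[OF e(1)[of n] e(1)[of "Suc n"] nz] by auto
  show "c z w * a w v + d z w * c w v = c z v" "c z w * b w v + d z w * d w v = d z v"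
    using matrix_eq_of_two_vectors[OF e(2)[of n] e(2)[of "Suc n"] nz] by auto
qed

end

section \<open>Square summability and resolvents\<close>

text \<open>Induction with partial sums in place of the series, each factor 1 + c n being absorbed
  into exp (c n).\<close>

lemma discrete_gronwall:
  fixes T c d :: "nat \<Rightarrow> real"
  assumes "T 0 = 0" and step: "\<And>n. T (Suc n) \<le> (1 + c n) * T n + d n"
    and nn: "\<And>n. T n \<ge> 0" "\<And>n. c n \<ge> 0" "\<And>n. d n \<ge> 0" and "summable c" "summable d"
  shows "T n \<le> exp (suminf c) * suminf d"
proof -
  have "T n \<le> exp (sum c {..<n}) * sum d {..<n}" for n
  proof (induction n)
    case 0 then show ?case using assms(1) by simp
  next
    case (Suc n)
    have "T (Suc n) \<le> (1 + c n) * T n + d n" by (rule step)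
    also have "\<dots> \<le> exp (c n) * (exp (sum c {..<n}) * sum d {..<n}) + exp (sum c {..<Suc n}) * d n"
    proof (rule add_mono)
      show "(1 + c n) * T n \<le> exp (c n) * (exp (sum c {..<n}) * sum d {..<n})"
        using Suc.IH nn by (intro mult_mono exp_ge_add_one_self) auto
      have "1 * d n \<le> exp (sum c {..<Suc n}) * d n"
        using nn by (intro mult_right_mono) (auto intro!: sum_nonneg add_nonneg_nonneg)
      then show "d n \<le> exp (sum c {..<Suc n}) * d n" by simp
    qed
    also have "\<dots> = exp (sum c {..<Suc n}) * sum d {..<Suc n}"
      by (simp add: algebra_simps exp_add)
    finally show ?case .
  qed
  also have "exp (sum c {..<n}) * sum d {..<n} \<le> exp (suminf c) * suminf d"
    using assms by (intro mult_mono sum_le_suminf) (auto intro!: sum_nonneg sum_le_suminf)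
  finally show ?thesis .
qed

lemma norm_sum_mult_square_le:
  fixes x y :: "'i \<Rightarrow> complex"
  shows "(cmod (\<Sum>k\<in>I. x k * y k))\<^sup>2 \<le> (\<Sum>k\<in>I. (cmod (x k))\<^sup>2) * (\<Sum>k\<in>I. (cmod (y k))\<^sup>2)"
proof -
  have "cmod (\<Sum>k\<in>I. x k * y k) \<le> (\<Sum>k\<in>I. cmod (x k) * cmod (y k))"
    using norm_sum[of "\<lambda>k. x k * y k" I] by (simp add: norm_mult)
  then have "(cmod (\<Sum>k\<in>I. x k * y k))\<^sup>2 \<le> (\<Sum>k\<in>I. cmod (x k) * cmod (y k))\<^sup>2"
    by (intro power_mono) auto
  also have "\<dots> \<le> (\<Sum>k\<in>I. (cmod (x k))\<^sup>2) * (\<Sum>k\<in>I. (cmod (y k))\<^sup>2)"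
    by (rule Cauchy_Schwarz_ineq_sum)
  finally show ?thesis .
qed

lemma cmod_add_square_le: "(cmod (x + y))\<^sup>2 \<le> 2 * (cmod x)\<^sup>2 + 2 * (cmod y)\<^sup>2"
proof -
  have "(cmod (x + y))\<^sup>2 \<le> (cmod x + cmod y)\<^sup>2"
    by (intro power_mono norm_triangle_ineq) auto
  also have "\<dots> \<le> 2 * (cmod x)\<^sup>2 + 2 * (cmod y)\<^sup>2"
    using sum_squares_bound[of "cmod x" "cmod y"] by (simp add: power2_eq_square algebra_simps)
  finally show ?thesis .
qed

lemma cmod_diff_square_le: "(cmod (x - y))\<^sup>2 \<le> 2 * (cmod x)\<^sup>2 + 2 * (cmod y)\<^sup>2"
  using cmod_add_square_le[of x "- y"] by simp

text \<open>Cauchy-Schwarz bounds the inner sum by the partial sum \<open>T n\<close> times a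
  combination of |a n|^2 and |b n|^2. These factors are summable, so Gronwall bounds
  \<open>T\<close>.\<close>

lemma variation_square_summable:
  fixes f g a b :: "nat \<Rightarrow> complex"
  assumes f: "\<And>n. f n = g n + \<zeta> * (\<Sum>k<n. (a k * b n - a n * b k) * f k)"
    and "summable (\<lambda>n. (cmod (a n))\<^sup>2)" "summable (\<lambda>n. (cmod (b n))\<^sup>2)" "summable (\<lambda>n. (cmod (g n))\<^sup>2)"
  shows "summable (\<lambda>n. (cmod (f n))\<^sup>2)"
proof -
  define \<alpha> where "\<alpha> = (\<Sum>n. (cmod (a n))\<^sup>2)"
  define \<beta> where "\<beta> = (\<Sum>n. (cmod (b n))\<^sup>2)"
  define T where "T n = (\<Sum>k<n. (cmod (f k))\<^sup>2)" for n
  \<comment> \<open>The 4 collects a factor 2 from splitting f n and another from splitting the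
    kernel.\<close>
  define c where "c n = 4 * (cmod \<zeta>)\<^sup>2 * (\<alpha> * (cmod (b n))\<^sup>2 + \<beta> * (cmod (a n))\<^sup>2)" for n
  define d where "d n = 2 * (cmod (g n))\<^sup>2" for n
  have ab: "\<alpha> \<ge> 0" "\<beta> \<ge> 0" "(\<Sum>k<n. (cmod (a k))\<^sup>2) \<le> \<alpha>" "(\<Sum>k<n. (cmod (b k))\<^sup>2) \<le> \<beta>" for n
    using assms by (auto simp: \<alpha>_def \<beta>_def intro!: suminf_nonneg sum_le_suminf)
  have sc: "summable c" "summable d"
    unfolding c_def d_def using assms(2-4) by (auto intro!: summable_mult summable_add)
  have step: "T (Suc n) \<le> (1 + c n) * T n + d n" for n
  proof -
    have "(\<Sum>k<n. (cmod (a k * b n - a n * b k))\<^sup>2)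
        \<le> (\<Sum>k<n. 2 * (cmod (b n))\<^sup>2 * (cmod (a k))\<^sup>2 + 2 * (cmod (a n))\<^sup>2 * (cmod (b k))\<^sup>2)"
      by (intro sum_mono order_trans[OF cmod_diff_square_le]) (simp add: norm_mult power_mult_distrib)
    also have "\<dots> = 2 * (cmod (b n))\<^sup>2 * (\<Sum>k<n. (cmod (a k))\<^sup>2) + 2 * (cmod (a n))\<^sup>2 * (\<Sum>k<n. (cmod (b k))\<^sup>2)"
      by (simp add: sum.distrib sum_distrib_left)
    also have "\<dots> \<le> 2 * (cmod (b n))\<^sup>2 * \<alpha> + 2 * (cmod (a n))\<^sup>2 * \<beta>"
      using ab by (intro add_mono mult_left_mono) auto
    finally have 1: "(\<Sum>k<n. (cmod (a k * b n - a n * b k))\<^sup>2) \<le> 2 * (cmod (b n))\<^sup>2 * \<alpha> + 2 * (cmod (a n))\<^sup>2 * \<beta>" .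
    have 2: "(cmod (\<Sum>k<n. (a k * b n - a n * b k) * f k))\<^sup>2
        \<le> (2 * (cmod (b n))\<^sup>2 * \<alpha> + 2 * (cmod (a n))\<^sup>2 * \<beta>) * T n"
      unfolding T_def
      by (rule order_trans[OF norm_sum_mult_square_le]) (intro mult_right_mono 1 sum_nonneg, auto)
    have "(cmod (f n))\<^sup>2 \<le> 2 * (cmod (g n))\<^sup>2 + 2 * (cmod (\<zeta> * (\<Sum>k<n. (a k * b n - a n * b k) * f k)))\<^sup>2"
      by (subst f) (rule cmod_add_square_le)
    also have "\<dots> \<le> d n + 2 * ((cmod \<zeta>)\<^sup>2 * ((2 * (cmod (b n))\<^sup>2 * \<alpha> + 2 * (cmod (a n))\<^sup>2 * \<beta>) * T n))"
      unfolding d_def norm_mult power_mult_distrib using 2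
      by (intro add_left_mono mult_left_mono) auto
    also have "\<dots> = d n + c n * T n" by (simp add: c_def algebra_simps)
    finally show ?thesis by (simp add: T_def algebra_simps)
  qed
  have "T n \<le> exp (suminf c) * suminf d" for n
  proof (rule discrete_gronwall[OF _ step _ _ _ sc])
    show "T 0 = 0" by (simp add: T_def)
    show "T n \<ge> 0" for n unfolding T_def by (intro sum_nonneg) simp
    show "c n \<ge> 0" for n unfolding c_def using ab(1,2) by (intro mult_nonneg_nonneg add_nonneg_nonneg) auto
    show "d n \<ge> 0" for n unfolding d_def by simp
  qed
  then show ?thesis
    unfolding T_def by (intro summableI_nonneg_bounded) auto
qed

lemma summable_mult_of_squares:
  fixes a b :: "nat \<Rightarrow> complex"
  assumes "summable (\<lambda>n. (cmod (a n))\<^sup>2)" "summable (\<lambda>n. (cmod (b n))\<^sup>2)"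
  shows "summable (\<lambda>n. a n * b n)"
proof (rule summable_comparison_test')
  show "summable (\<lambda>n. (cmod (a n))\<^sup>2 + (cmod (b n))\<^sup>2)" using assms by (rule summable_add)
  show "norm (a n * b n) \<le> (cmod (a n))\<^sup>2 + (cmod (b n))\<^sup>2" for n
  proof -
    have "2 * (cmod (a n) * cmod (b n)) \<le> (cmod (a n))\<^sup>2 + (cmod (b n))\<^sup>2"
      using sum_squares_bound[of "cmod (a n)" "cmod (b n)"] by simp
    moreover have "0 \<le> cmod (a n) * cmod (b n)" by simp
    ultimately show ?thesis unfolding norm_mult by linarith
  qed
qed

section \<open>Resolvents and their Fourier coefficients\<close>

lemma cmod_resolvent_le:
  assumes "Im z \<noteq> 0"
  shows "cmod (1 / (of_real x - z)) \<le> 1 / \<bar>Im z\<bar>"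
  using abs_Im_le_cmod[of "of_real x - z"] assms by (simp add: norm_divide divide_simps)

lemma of_real_minus_nonzero: "Im z \<noteq> 0 \<Longrightarrow> of_real x - z \<noteq> 0"
  by (auto simp: complex_eq_iff)

text \<open>Cauchy-Schwarz against the constant 1, from the nonnegativity of the variance; mass zero
  is treated apart because the mean is then undefined.\<close>

lemma (in finite_measure) square_integral_le:
  fixes g :: "'a \<Rightarrow> real"
  assumes g: "integrable M g" "integrable M (\<lambda>x. (g x)\<^sup>2)"
  shows "(LINT x|M. g x)\<^sup>2 \<le> measure M (space M) * (LINT x|M. (g x)\<^sup>2)"
proof (cases "measure M (space M) = 0")
  case True
  then have "emeasure M (space M) = 0" by (simp add: emeasure_eq_measure)
  then have "(LINT x|M. g x) = (LINT x|M. 0)"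
    by (intro integral_cong_AE) (use g in \<open>auto intro!: AE_I[where N="space M"]\<close>)
  then show ?thesis using True by simp
next
  case False
  define m where "m = measure M (space M)"
  have m: "m > 0" using False by (simp add: m_def zero_less_measure_iff)
  define I where "I = (LINT x|M. g x)"
  have "0 \<le> (LINT x|M. (g x - I / m)\<^sup>2)" by simp
  also have "(LINT x|M. (g x - I / m)\<^sup>2) = (LINT x|M. (g x)\<^sup>2 - 2 * (I / m) * g x + (I / m)\<^sup>2)"
    by (intro Bochner_Integration.integral_cong refl) (simp add: power2_eq_square algebra_simps)
  also have "\<dots> = (LINT x|M. (g x)\<^sup>2) - 2 * (I / m) * I + (I / m)\<^sup>2 * m"
    using g by (simp add: I_def m_def)
  also have "\<dots> = (LINT x|M. (g x)\<^sup>2) - I\<^sup>2 / m"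
    using m by (simp add: power2_eq_square field_simps)
  finally have "I\<^sup>2 / m \<le> (LINT x|M. (g x)\<^sup>2)" by simp
  then show ?thesis using m by (simp add: I_def m_def[symmetric] field_simps)
qed

lemma borel_measurable_complex_of_real [measurable]: "complex_of_real \<in> borel_measurable borel"
  by (intro borel_measurable_continuous_onI continuous_intros)

lemma borel_measurable_poly_complex [measurable]:
  "(\<lambda>x. poly r (complex_of_real x)) \<in> borel_measurable borel"
  by (intro borel_measurable_continuous_onI continuous_intros)

context Mstar_measure
begin

lemma integrable_resolvent_mult_poly:
  assumes "Im z \<noteq> 0"
  shows "integrable \<mu> (\<lambda>x. poly r (of_real x) / (of_real x - z))"
proof (rule Bochner_Integration.integrable_bound)
  show "integrable \<mu> (\<lambda>x. poly r (of_real x) * (1 / of_real \<bar>Im z\<bar>) :: complex)"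
    using integrable_poly by (intro integrable_mult_left) auto
  show "AE x in \<mu>. norm (poly r (of_real x) / (of_real x - z)) \<le> norm (poly r (of_real x) * (1 / of_real \<bar>Im z\<bar>))"
    using mult_left_mono[OF cmod_resolvent_le[OF assms], of "cmod (poly r _)"]
    by (intro AE_I2) (simp add: norm_mult norm_divide)
qed measurable

lemma integrable_resolvent: "Im z \<noteq> 0 \<Longrightarrow> integrable \<mu> (\<lambda>x. 1 / (complex_of_real x - z))"
  using integrable_resolvent_mult_poly[of z 1] by simp

text \<open>Divide r by x - z: the remainder produces the Stieltjes transform, the quotient a
  polynomial integral that depends on the moments only.\<close>

lemma integral_resolvent_mult_poly:
  assumes "Im z \<noteq> 0"
  shows "(LINT x|\<mu>. poly r (of_real x) / (of_real x - z)) = poly r z * stieltjes \<mu> z + L (synthetic_div r z)"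
proof -
  have "poly r (of_real x) / (of_real x - z) = poly r z * (1 / (of_real x - z)) + poly (synthetic_div r z) (of_real x)" for x
    using of_real_minus_nonzero[OF assms, of x]
    by (subst poly_eq_synthetic_div[of r "of_real x" z]) (simp add: field_simps)
  then have "(LINT x|\<mu>. poly r (of_real x) / (of_real x - z))
      = (LINT x|\<mu>. poly r z * (1 / (of_real x - z)) + poly (synthetic_div r z) (of_real x))" by simp
  also have "\<dots> = poly r z * stieltjes \<mu> z + L (synthetic_div r z)"
    unfolding L_def stieltjes_def
    using integrable_resolvent[OF assms] integrable_poly[of "synthetic_div r z"]
    by (simp del: times_divide_eq_right)
  finally show ?thesis .
qed

text \<open>The Fourier coefficients of \<open>1 / (x - z)\<close>, see \<open>fc_eq\<close>.\<close>

definition fc :: "nat \<Rightarrow> complex \<Rightarrow> complex" where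
  "fc k z = p k z * stieltjes \<mu> z + q k z"

lemma fc_eq: "Im z \<noteq> 0 \<Longrightarrow> (LINT x|\<mu>. poly (Pc k) (of_real x) / (of_real x - z)) = fc k z"
  by (simp add: integral_resolvent_mult_poly fc_def Pfun_def q_eq)

text \<open>Expresses the squared norm through \<open>L\<close>, that is, through moments alone; two
  solutions of one moment problem therefore give every polynomial the same norm.\<close>

lemma of_real_integral_poly_sq:
  "complex_of_real (LINT x|\<mu>. (cmod (poly r (of_real x)))\<^sup>2) = L (r * map_poly cnj r)"
proof -
  have "complex_of_real (LINT x|\<mu>. (cmod (poly r (of_real x)))\<^sup>2)
      = (LINT x|\<mu>. complex_of_real ((cmod (poly r (of_real x)))\<^sup>2))"
    by (simp only: integral_complex_of_real)
  also have "\<dots> = L (r * map_poly cnj r)"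
    unfolding L_def complex_norm_square by simp
  finally show ?thesis .
qed

lemma integrable_poly_sq: "integrable \<mu> (\<lambda>x. (cmod (poly r (of_real x)))\<^sup>2)"
proof -
  have "integrable \<mu> (\<lambda>x. poly (r * map_poly cnj r) (complex_of_real x))" by (rule integrable_poly)
  then have "integrable \<mu> (\<lambda>x. complex_of_real ((cmod (poly r (of_real x)))\<^sup>2))"
    unfolding complex_norm_square by simp
  then show ?thesis by (simp only: complex_of_real_integrable_eq)
qed

definition lincomb :: "nat \<Rightarrow> (nat \<Rightarrow> complex) \<Rightarrow> complex poly" where
  "lincomb n a = (\<Sum>k<n. smult (a k) (Pc k))"

lemma poly_lincomb: "poly (lincomb n a) x = (\<Sum>k<n. a k * poly (Pc k) x)"
  by (simp add: lincomb_def poly_sum)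

lemma lincomb_exists: "\<exists>n a. r = lincomb n a"
  using Pc_expansion[of "Suc (degree r)" r] unfolding lincomb_def by (metis coeff_eq_0 less_eq_Suc_le)

lemma map_poly_cnj_Pc [simp]: "map_poly cnj (Pc k) = Pc k"
  by (intro poly_eqI) (simp add: coeff_map_poly coeff_Pc)

lemma map_poly_cnj_lincomb: "map_poly cnj (lincomb n a) = lincomb n (\<lambda>k. cnj (a k))"
  by (intro poly_eqI) (simp add: coeff_map_poly coeff_Pc lincomb_def coeff_sum)

lemma L_lincomb_mult: "L (lincomb n a * lincomb n b) = (\<Sum>k<n. a k * b k)"
proof -
  have "L (lincomb n a * lincomb n b) = (\<Sum>k<n. \<Sum>j<n. a k * (b j * L (Pc k * Pc j)))"
    by (simp add: lincomb_def sum_distrib_left sum_distrib_right L_sum L_smult mult.left_commute)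
      (subst sum.swap, simp)
  also have "\<dots> = (\<Sum>k<n. a k * b k)"
    by (intro sum.cong refl) (simp add: L_Pc if_distrib cong: if_cong)
  finally show ?thesis .
qed

lemma integral_lincomb_sq:
  "(LINT x|\<mu>. (cmod (poly (lincomb n a) (of_real x)))\<^sup>2) = (\<Sum>k<n. (cmod (a k))\<^sup>2)"
proof -
  have "complex_of_real (LINT x|\<mu>. (cmod (poly (lincomb n a) (of_real x)))\<^sup>2)
      = complex_of_real (\<Sum>k<n. (cmod (a k))\<^sup>2)"
    unfolding of_real_integral_poly_sq map_poly_cnj_lincomb L_lincomb_mult of_real_sum complex_norm_square ..
  then show ?thesis by (simp only: of_real_eq_iff)
qed

text \<open>Test the bound on the extremal polynomial, a partial sum of the reproducing kernel at z:
  with s the partial sum in question, its value at z and its squared norm both equal s, so s^2 \<le>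
  B s. The absolute value of B covers s = 0.\<close>

lemma eval_bound_imp_summable:
  assumes "\<And>r. (cmod (poly r z))\<^sup>2 \<le> B * (LINT x|\<mu>. (cmod (poly r (of_real x)))\<^sup>2)"
  shows "summable (\<lambda>k. (cmod (p k z))\<^sup>2)"
proof (rule summableI_nonneg_bounded)
  fix n
  define s where "s = (\<Sum>k<n. (cmod (p k z))\<^sup>2)"
  have s: "s \<ge> 0" unfolding s_def by (intro sum_nonneg) simp
  define r where "r = lincomb n (\<lambda>k. cnj (p k z))"
  have "poly r z = (\<Sum>k<n. complex_of_real ((cmod (p k z))\<^sup>2))"
    unfolding r_def poly_lincomb Pfun_def complex_norm_square by (simp add: mult.commute)
  then have "poly r z = complex_of_real s" by (simp only: s_def of_real_sum)
  moreover have "(LINT x|\<mu>. (cmod (poly r (of_real x)))\<^sup>2) = s"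
    unfolding r_def integral_lincomb_sq by (simp add: s_def)
  ultimately have "s\<^sup>2 \<le> B * s" using assms[of r] s by simp
  then have "s \<le> \<bar>B\<bar>"
    using s by (cases "s = 0") (auto simp: power2_eq_square)
  then show "(\<Sum>k<n. (cmod (p k z))\<^sup>2) \<le> \<bar>B\<bar>" by (simp add: s_def)
qed simp

lemma eval_bound_of_summable:
  assumes "summable (\<lambda>k. (cmod (p k z))\<^sup>2)"
  shows "(cmod (poly r z))\<^sup>2 \<le> (\<Sum>k. (cmod (p k z))\<^sup>2) * (LINT x|\<mu>. (cmod (poly r (of_real x)))\<^sup>2)"
proof -
  obtain n a where r: "r = lincomb n a" using lincomb_exists by blast
  have "(cmod (poly r z))\<^sup>2 \<le> (\<Sum>k<n. (cmod (a k))\<^sup>2) * (\<Sum>k<n. (cmod (p k z))\<^sup>2)"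
    unfolding r poly_lincomb Pfun_def by (rule norm_sum_mult_square_le)
  also have "\<dots> \<le> (\<Sum>k<n. (cmod (a k))\<^sup>2) * (\<Sum>k. (cmod (p k z))\<^sup>2)"
    using assms by (intro mult_left_mono sum_le_suminf sum_nonneg) auto
  finally show ?thesis by (simp add: r integral_lincomb_sq mult.commute)
qed

lemma integrable_resolvent_sq:
  assumes "Im z \<noteq> 0"
  shows "integrable \<mu> (\<lambda>x. (cmod (1 / (of_real x - z)))\<^sup>2)"
proof (rule integrable_const_bound[where B = "(1 / \<bar>Im z\<bar>)\<^sup>2"])
  show "AE x in \<mu>. norm ((cmod (1 / (of_real x - z)))\<^sup>2) \<le> (1 / \<bar>Im z\<bar>)\<^sup>2"
    using power_mono[OF cmod_resolvent_le[OF assms]] by (intro AE_I2) simp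
qed measurable

lemma integrable_resolvent_diff_sq:
  assumes "Im z \<noteq> 0"
  shows "integrable \<mu> (\<lambda>x. (cmod (1 / (of_real x - z) - poly r (of_real x)))\<^sup>2)"
proof (rule Bochner_Integration.integrable_bound)
  show "integrable \<mu> (\<lambda>x. 2 * (cmod (1 / (of_real x - z)))\<^sup>2 + 2 * (cmod (poly r (of_real x)))\<^sup>2)"
    using integrable_resolvent_sq[OF assms] integrable_poly_sq by (intro Bochner_Integration.integrable_add integrable_mult_right)
  show "AE x in \<mu>. norm ((cmod (1 / (of_real x - z) - poly r (of_real x)))\<^sup>2)
      \<le> norm (2 * (cmod (1 / (of_real x - z)))\<^sup>2 + 2 * (cmod (poly r (of_real x)))\<^sup>2)"
    using cmod_diff_square_le by (intro AE_I2) simp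
qed measurable

text \<open>Completing the square in the coefficients. The choice a = \<open>fc\<close> is optimal;
  the identity yields Bessel's inequality and reduces approximability to Parseval's
  equality.\<close>

lemma resolvent_lincomb_distance:
  assumes "Im z \<noteq> 0"
  shows "(LINT x|\<mu>. (cmod (1 / (of_real x - z) - poly (lincomb n a) (of_real x)))\<^sup>2)
    = (LINT x|\<mu>. (cmod (1 / (of_real x - z)))\<^sup>2) - (\<Sum>k<n. (cmod (fc k z))\<^sup>2) + (\<Sum>k<n. (cmod (fc k z - a k))\<^sup>2)"
proof -
  let ?R = "\<lambda>x. 1 / (complex_of_real x - z)" and ?r = "lincomb n a" and ?rc = "lincomb n (\<lambda>k. cnj (a k))"
  have rc: "cnj (poly ?r (of_real x)) = poly ?rc (of_real x)" for x
    by (simp add: map_poly_cnj_lincomb[symmetric])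
  have I: "integrable \<mu> (\<lambda>x. poly ?rc (of_real x) / (of_real x - z))"
    by (rule integrable_resolvent_mult_poly[OF assms])
  have id: "(cmod (u - v))\<^sup>2 = (cmod u)\<^sup>2 - 2 * Re (cnj v * u) + (cmod v)\<^sup>2" for u v
    by (simp only: cmod_power2) (simp add: power2_eq_square algebra_simps)
  have "(LINT x|\<mu>. (cmod (?R x - poly ?r (of_real x)))\<^sup>2)
      = (LINT x|\<mu>. (cmod (?R x))\<^sup>2 - 2 * Re (poly ?rc (of_real x) / (of_real x - z)) + (cmod (poly ?r (of_real x)))\<^sup>2)"
    unfolding id rc by simp
  also have "\<dots> = (LINT x|\<mu>. (cmod (?R x))\<^sup>2) - 2 * Re (LINT x|\<mu>. poly ?rc (of_real x) / (of_real x - z))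
      + (LINT x|\<mu>. (cmod (poly ?r (of_real x)))\<^sup>2)"
    using integrable_resolvent_sq[OF assms] integrable_poly_sq[of ?r] I integrable_Re[OF I]
    by (simp add: integral_Re)
  also have "(LINT x|\<mu>. poly ?rc (of_real x) / (of_real x - z)) = (\<Sum>k<n. cnj (a k) * fc k z)"
  proof -
    have "(LINT x|\<mu>. poly ?rc (of_real x) / (of_real x - z))
        = (LINT x|\<mu>. (\<Sum>k<n. cnj (a k) * (poly (Pc k) (of_real x) / (of_real x - z))))"
      by (simp add: poly_lincomb sum_divide_distrib)
    also have "\<dots> = (\<Sum>k<n. cnj (a k) * fc k z)"
      by (subst Bochner_Integration.integral_sum)
        (auto simp: fc_eq[OF assms] simp del: times_divide_eq_right intro!: integrable_mult_right integrable_resolvent_mult_poly assms)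
    finally show ?thesis .
  qed
  also have "(LINT x|\<mu>. (cmod (poly ?r (of_real x)))\<^sup>2) = (\<Sum>k<n. (cmod (a k))\<^sup>2)"
    by (rule integral_lincomb_sq)
  finally show ?thesis
    by (simp add: id sum.distrib sum_subtractf sum_distrib_left)
qed

lemma bessel:
  assumes "Im z \<noteq> 0"
  shows "(\<Sum>k<n. (cmod (fc k z))\<^sup>2) \<le> (LINT x|\<mu>. (cmod (1 / (of_real x - z)))\<^sup>2)"
proof -
  have "0 \<le> (LINT x|\<mu>. (cmod (1 / (of_real x - z) - poly (lincomb n (\<lambda>k. fc k z)) (of_real x)))\<^sup>2)"
    by simp
  then show ?thesis unfolding resolvent_lincomb_distance[OF assms] by simp
qed

lemma summable_fc: "Im z \<noteq> 0 \<Longrightarrow> summable (\<lambda>k. (cmod (fc k z))\<^sup>2)"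
  using bessel by (intro summableI_nonneg_bounded) auto

definition limit_circle :: bool where
  "limit_circle \<longleftrightarrow> (\<exists>z. Im z \<noteq> 0 \<and> summable (\<lambda>k. (cmod (p k z))\<^sup>2))"

lemma limit_circle_summable:
  assumes limit_circle
  shows "summable (\<lambda>k. (cmod (p k z))\<^sup>2)" "summable (\<lambda>k. (cmod (q k z))\<^sup>2)"
proof -
  obtain w where w: "Im w \<noteq> 0" and sp: "summable (\<lambda>k. (cmod (p k w))\<^sup>2)"
    using assms by (auto simp: limit_circle_def)
  \<comment> \<open>Bessel makes \<open>fc\<close> square summable at the non-real w, and q is
    \<open>fc\<close> minus p times the transform. Variation of constants then reaches every z, real
    points included.\<close>
  have sq: "summable (\<lambda>k. (cmod (q k w))\<^sup>2)"
  proof (rule summable_comparison_test')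
    show "summable (\<lambda>k. 2 * (cmod (fc k w))\<^sup>2 + 2 * ((cmod (p k w))\<^sup>2 * (cmod (stieltjes \<mu> w))\<^sup>2))"
      using summable_fc[OF w] sp by (intro summable_add summable_mult summable_mult2)
    show "norm ((cmod (q k w))\<^sup>2) \<le> 2 * (cmod (fc k w))\<^sup>2 + 2 * ((cmod (p k w))\<^sup>2 * (cmod (stieltjes \<mu> w))\<^sup>2)" for k
      using cmod_diff_square_le[of "fc k w" "p k w * stieltjes \<mu> w"]
      by (simp add: fc_def norm_mult power_mult_distrib)
  qed
  show "summable (\<lambda>k. (cmod (p k z))\<^sup>2)"
    by (rule variation_square_summable[OF p_variation[of _ z w, unfolded wr_def] sp sq sp])
  show "summable (\<lambda>k. (cmod (q k z))\<^sup>2)"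
    by (rule variation_square_summable[OF q_variation[of _ z w, unfolded wr_def] sp sq sq])
qed

end

section \<open>Uniqueness of the Stieltjes transform\<close>

lemma poisson_kernel:
  "Im (1 / (complex_of_real x - Complex u y)) = y / ((x - u)\<^sup>2 + y\<^sup>2)"
  by (simp add: Im_divide power2_eq_square)

lemma nn_integral_poisson_kernel:
  assumes "y > 0" "a \<le> b"
  shows "(\<integral>\<^sup>+u. ennreal (y / ((x - u)\<^sup>2 + y\<^sup>2)) * indicator {a..b} u \<partial>lborel)
    = ennreal (arctan ((b - x) / y) - arctan ((a - x) / y))"
proof (rule nn_integral_FTC_Icc)
  show "((\<lambda>u. arctan ((u - x) / y)) has_real_derivative y / ((x - u)\<^sup>2 + y\<^sup>2)) (at u)" for u
  proof -
    have "y\<^sup>2 + (u - x)\<^sup>2 > 0" using assms(1) by (intro add_pos_nonneg) auto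
    then show ?thesis
      using assms(1)
      by (auto intro!: derivative_eq_intros simp: field_simps power2_eq_square)
  qed
qed (use assms in auto)

text \<open>The arctan difference is the integral of the Poisson kernel over [a,b]. Tonelli
  exchanges the integrals and leaves the imaginary part of the transform at height y.\<close>

lemma stieltjes_interval:
  assumes "finite_measure M" "sets M = sets borel" "y > 0" "a \<le> b"
  shows "(\<integral>\<^sup>+x. ennreal (arctan ((b - x) / y) - arctan ((a - x) / y)) \<partial>M)
    = (\<integral>\<^sup>+u. ennreal (Im (stieltjes M (Complex u y))) * indicator {a..b} u \<partial>lborel)"
proof -
  interpret finite_measure M by fact
  note assms(2)[measurable_cong]
  interpret pair_sigma_finite M lborel ..
  have kernel: "(\<integral>\<^sup>+x. ennreal (y / ((x - u)\<^sup>2 + y\<^sup>2)) \<partial>M) = ennreal (Im (stieltjes M (Complex u y)))" for u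
  proof -
    have I: "integrable M (\<lambda>x. 1 / (complex_of_real x - Complex u y))"
      using assms(3) cmod_resolvent_le[of "Complex u y"]
      by (intro integrable_const_bound[where B = "1 / y"]) auto
    have "(\<integral>\<^sup>+x. ennreal (y / ((x - u)\<^sup>2 + y\<^sup>2)) \<partial>M) = ennreal (LINT x|M. y / ((x - u)\<^sup>2 + y\<^sup>2))"
      using integrable_Im[OF I] assms(3) unfolding poisson_kernel by (intro nn_integral_eq_integral) auto
    also have "(LINT x|M. y / ((x - u)\<^sup>2 + y\<^sup>2)) = Im (stieltjes M (Complex u y))"
      using integral_Im[OF I] by (simp add: stieltjes_def poisson_kernel)
    finally show ?thesis .
  qed
  have "(\<integral>\<^sup>+x. ennreal (arctan ((b - x) / y) - arctan ((a - x) / y)) \<partial>M)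
      = (\<integral>\<^sup>+x. (\<integral>\<^sup>+u. ennreal (y / ((x - u)\<^sup>2 + y\<^sup>2)) * indicator {a..b} u \<partial>lborel) \<partial>M)"
    by (simp add: nn_integral_poisson_kernel[OF assms(3,4)])
  also have "\<dots> = (\<integral>\<^sup>+u. (\<integral>\<^sup>+x. ennreal (y / ((x - u)\<^sup>2 + y\<^sup>2)) * indicator {a..b} u \<partial>M) \<partial>lborel)"
    by (rule Fubini'[symmetric]) measurable
  also have "\<dots> = (\<integral>\<^sup>+u. (\<integral>\<^sup>+x. ennreal (y / ((x - u)\<^sup>2 + y\<^sup>2)) \<partial>M) * indicator {a..b} u \<partial>lborel)"
    by (intro nn_integral_cong nn_integral_multc) measurable
  also have "\<dots> = (\<integral>\<^sup>+u. ennreal (Im (stieltjes M (Complex u y))) * indicator {a..b} u \<partial>lborel)"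
    by (simp only: kernel)
  finally show ?thesis .
qed

lemma tendsto_arctan_scaled:
  "(\<lambda>n. arctan (c / (1 / real (Suc n)))) \<longlonglongrightarrow> pi / 2 * sgn c"
proof (cases "c = 0")
  case False
  have lim: "(\<lambda>n. arctan (d * real (Suc n))) \<longlonglongrightarrow> pi / 2" if "d > 0" for d
    by (rule filterlim_compose[OF tendsto_arctan_at_top])
      (intro filterlim_tendsto_pos_mult_at_top[OF tendsto_const that]
        filterlim_compose[OF filterlim_real_sequentially filterlim_Suc])
  show ?thesis
  proof (cases "c > 0")
    case True
    then show ?thesis using lim[OF True] by simp
  next
    case neg: False
    with False have "- c > 0" by simp
    from tendsto_minus[OF lim[OF this]] show ?thesis using neg False
      by (simp add: arctan_minus[symmetric] del: arctan_minus of_nat_Suc)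
  qed
qed simp

lemma abs_arctan_diff_le: "\<bar>arctan u - arctan v\<bar> \<le> pi"
  using arctan_bounded[of u] arctan_bounded[of v] by auto

text \<open>Stieltjes-Perron inversion, with limits in the order y to 0, b to infinity, a from the
  right. It ends with equal masses of all open half-lines.\<close>

theorem stieltjes_unique:
  assumes M: "finite_measure M" "sets M = sets borel" and N: "finite_measure N" "sets N = sets borel"
    and eq: "\<And>z. Im z \<noteq> 0 \<Longrightarrow> stieltjes M z = stieltjes N z"
  shows "M = N"
proof -
  have sgn_lim: "(\<lambda>n. LINT x|K. arctan ((b - x) / (1 / real (Suc n))) - arctan ((a - x) / (1 / real (Suc n))))
      \<longlonglongrightarrow> (LINT x|K. pi / 2 * sgn (b - x) - pi / 2 * sgn (a - x))"
    if "finite_measure K" "sets K = sets borel" for K :: "real measure" and a b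
  proof -
    interpret finite_measure K by fact
    note that(2)[measurable_cong]
    show ?thesis
    proof (rule integral_dominated_convergence[where w = "\<lambda>_. pi"])
      show "AE x in K. (\<lambda>n. arctan ((b - x) / (1 / real (Suc n))) - arctan ((a - x) / (1 / real (Suc n))))
          \<longlonglongrightarrow> pi / 2 * sgn (b - x) - pi / 2 * sgn (a - x)"
        by (intro AE_I2 tendsto_diff tendsto_arctan_scaled)
    qed (auto simp: abs_arctan_diff_le)
  qed
  have arc: "(LINT x|M. arctan ((b - x) / y) - arctan ((a - x) / y)) = (LINT x|N. arctan ((b - x) / y) - arctan ((a - x) / y))"
    if "y > 0" "a \<le> b" for a b y
  proof -
    have nn: "arctan ((b - x) / y) - arctan ((a - x) / y) \<ge> 0" for x
      using that by (simp add: arctan_le_iff divide_right_mono)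
    have "(LINT x|K. arctan ((b - x) / y) - arctan ((a - x) / y))
        = enn2real (\<integral>\<^sup>+u. ennreal (Im (stieltjes K (Complex u y))) * indicator {a..b} u \<partial>lborel)"
      if K: "finite_measure K" "sets K = sets borel" for K
      unfolding stieltjes_interval[OF K \<open>y > 0\<close> \<open>a \<le> b\<close>, symmetric]
      using K(2) nn by (intro integral_eq_nn_integral) (auto simp: measurable_cong_sets[OF K(2) refl])
    moreover have "stieltjes M (Complex u y) = stieltjes N (Complex u y)" for u
      using that by (intro eq) simp
    ultimately show ?thesis using M N by simp
  qed
  have s: "(LINT x|M. pi / 2 * sgn (b - x) - pi / 2 * sgn (a - x)) = (LINT x|N. pi / 2 * sgn (b - x) - pi / 2 * sgn (a - x))"
    if "a \<le> b" for a b
  proof (rule LIMSEQ_unique[OF sgn_lim[OF M, of b a]])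
    have "(LINT x|M. arctan ((b - x) / (1 / real (Suc n))) - arctan ((a - x) / (1 / real (Suc n))))
        = (LINT x|N. arctan ((b - x) / (1 / real (Suc n))) - arctan ((a - x) / (1 / real (Suc n))))" for n
      by (rule arc[OF _ that]) simp
    then show "(\<lambda>n. LINT x|M. arctan ((b - x) / (1 / real (Suc n))) - arctan ((a - x) / (1 / real (Suc n))))
        \<longlonglongrightarrow> (LINT x|N. pi / 2 * sgn (b - x) - pi / 2 * sgn (a - x))"
      using sgn_lim[OF N, of b a] by (simp only:)
  qed
  have G_lim: "(\<lambda>n. LINT x|K. pi / 2 * sgn (real n - x) - pi / 2 * sgn (a - x)) \<longlonglongrightarrow> (LINT x|K. pi / 2 * 1 - pi / 2 * sgn (a - x))"
    if "finite_measure K" "sets K = sets borel" for K :: "real measure" and a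
  proof -
    interpret finite_measure K by fact
    note that(2)[measurable_cong]
    have "(\<lambda>n. sgn (real n - x)) \<longlonglongrightarrow> 1" for x
    proof (rule tendsto_eventually)
      obtain m where "x < real m" using reals_Archimedean2 by blast
      then show "\<forall>\<^sub>F n in sequentially. sgn (real n - x) = 1"
        by (intro eventually_sequentiallyI[of m]) (auto simp: sgn_if)
    qed
    then show ?thesis
      by (intro integral_dominated_convergence[where w = "\<lambda>_. pi"] AE_I2 tendsto_diff tendsto_mult tendsto_const)
        (auto simp: sgn_if)
  qed
  have G: "(LINT x|M. pi / 2 * 1 - pi / 2 * sgn (a - x)) = (LINT x|N. pi / 2 * 1 - pi / 2 * sgn (a - x))" for a
  proof (rule LIMSEQ_unique[OF G_lim[OF M]])
    show "(\<lambda>n. LINT x|M. pi / 2 * sgn (real n - x) - pi / 2 * sgn (a - x)) \<longlonglongrightarrow> (LINT x|N. pi / 2 * 1 - pi / 2 * sgn (a - x))"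
    proof (rule Lim_transform_eventually[OF G_lim[OF N, of a]])
      obtain m where "a < real m" using reals_Archimedean2 by blast
      then show "\<forall>\<^sub>F n in sequentially. (LINT x|N. pi / 2 * sgn (real n - x) - pi / 2 * sgn (a - x))
          = (LINT x|M. pi / 2 * sgn (real n - x) - pi / 2 * sgn (a - x))"
        by (intro eventually_sequentiallyI[of m] s[symmetric]) auto
    qed
  qed
  \<comment> \<open>The sign function gives the point a half weight; approaching a from the right
    removes it.\<close>
  have I_lim: "(\<lambda>n. LINT x|K. pi / 2 * 1 - pi / 2 * sgn (a + 1 / real (Suc n) - x)) \<longlonglongrightarrow> pi * measure K {a<..}"
    if "finite_measure K" "sets K = sets borel" for K :: "real measure" and a
  proof -
    interpret finite_measure K by fact
    note that(2)[measurable_cong]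
    have sp: "space K = UNIV" using sets_eq_imp_space_eq[OF that(2)] by simp
    have "(\<lambda>n. pi / 2 * 1 - pi / 2 * sgn (a + 1 / real (Suc n) - x)) \<longlonglongrightarrow> pi * indicator {a<..} x" for x
    proof (rule tendsto_eventually)
      show "\<forall>\<^sub>F n in sequentially. pi / 2 * 1 - pi / 2 * sgn (a + 1 / real (Suc n) - x) = pi * indicator {a<..} x"
      proof (cases "x > a")
        case True
        then obtain m where m: "inverse (real (Suc m)) < x - a" using reals_Archimedean[of "x - a"] by auto
        show ?thesis
        proof (intro eventually_sequentiallyI[of m])
          fix n assume "m \<le> n"
          then have "1 / real (Suc n) \<le> inverse (real (Suc m))" by (simp add: field_simps)
          with m True show "pi / 2 * 1 - pi / 2 * sgn (a + 1 / real (Suc n) - x) = pi * indicator {a<..} x"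
            by (simp add: sgn_if del: of_nat_Suc)
        qed
      next
        case False
        have "a + 1 / real (Suc n) - x > 0" for n
          using False by (smt (verit) divide_pos_pos of_nat_0_less_iff zero_less_Suc)
        then have "sgn (a + 1 / real (Suc n) - x) = 1" for n by (rule sgn_pos)
        then show ?thesis using False by simp
      qed
    qed
    then have "(\<lambda>n. LINT x|K. pi / 2 * 1 - pi / 2 * sgn (a + 1 / real (Suc n) - x)) \<longlonglongrightarrow> (LINT x|K. pi * indicator {a<..} x)"
      by (intro integral_dominated_convergence[where w = "\<lambda>_. pi"] AE_I2)
        (auto simp: sgn_if)
    then show ?thesis by (simp add: sp)
  qed
  have "measure M {a<..} = measure N {a<..}" for a
  proof -
    have "pi * measure M {a<..} = pi * measure N {a<..}"
      by (rule LIMSEQ_unique[OF I_lim[OF M, of a]]) (use I_lim[OF N, of a] in \<open>simp only: G\<close>)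
    then show ?thesis by simp
  qed
  then have *: "emeasure M {a<..} = emeasure N {a<..}" for a
    using M(1) N(1) by (simp add: finite_measure.emeasure_eq_measure)
  show ?thesis
    using M N * by (intro measure_eqI_lessThan) (auto simp: finite_measure.emeasure_eq_measure)
qed

section \<open>Weak limits and quadrature\<close>

text \<open>Method of moments. The range k \<le> n + 2 makes the second moment exact for every n, so
  Chebyshev's inequality gives tightness of the whole sequence. Powers are unbounded, hence the
  truncations; a uniform point mass survives because the limit cannot lose mass of a closed
  set.\<close>

lemma moment_limit:
  fixes \<nu> :: "nat \<Rightarrow> real measure" and s :: "nat \<Rightarrow> real"
  assumes dist: "\<And>n. real_distribution (\<nu> n)"
    and int: "\<And>n k. integrable (\<nu> n) (\<lambda>x. x ^ k)"
    and mom: "\<And>n k. k \<le> n + 2 \<Longrightarrow> (LINT x|\<nu> n. x ^ k) = s k"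
  obtains M where "real_distribution M" "\<And>k. integrable M (\<lambda>x. x ^ k)" "\<And>k. (LINT x|M. x ^ k) = s k"
    "\<And>x0 c. (\<And>n. measure (\<nu> n) {x0} \<ge> c) \<Longrightarrow> measure M {x0} \<ge> c"
proof -
  interpret \<nu>: real_distribution "\<nu> n" for n by (rule dist)
  have even: "even k \<Longrightarrow> x ^ k \<ge> 0" for x :: real and k by (simp add: zero_le_power_eq)
  have "tight \<nu>"
    unfolding tight_def
  proof (intro conjI allI impI)
    fix \<epsilon> :: real assume \<epsilon>: "\<epsilon> > 0"
    \<comment> \<open>Chosen so that s 2 / b^2 < \<epsilon>; the outer + 1 makes b positive and the
      inequality strict.\<close>
    define b where "b = sqrt ((\<bar>s 2\<bar> + 1) / \<epsilon>) + 1"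
    have b: "b > 0" "b\<^sup>2 > (\<bar>s 2\<bar> + 1) / \<epsilon>"
    proof -
      have "sqrt ((\<bar>s 2\<bar> + 1) / \<epsilon>) \<ge> 0" using \<epsilon> by simp
      then show "b > 0" unfolding b_def by linarith
      have "(sqrt ((\<bar>s 2\<bar> + 1) / \<epsilon>))\<^sup>2 < b\<^sup>2"
        using \<open>sqrt ((\<bar>s 2\<bar> + 1) / \<epsilon>) \<ge> 0\<close> unfolding b_def by (intro power_strict_mono) auto
      then show "b\<^sup>2 > (\<bar>s 2\<bar> + 1) / \<epsilon>" using \<epsilon> by simp
    qed
    have "measure (\<nu> n) {- b<..b} > 1 - \<epsilon>" for n
    proof -
      have "measure (\<nu> n) (- {- b<..b}) = (LINT x|\<nu> n. indicator (- {- b<..b}) x)" by simp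
      also have "\<dots> \<le> (LINT x|\<nu> n. x ^ 2 / b\<^sup>2)"
      proof (rule integral_mono)
        show "integrable (\<nu> n) (indicat_real (- {- b<..b}))"
          by (intro \<nu>.integrable_const_bound[where B = 1]) (auto simp: indicator_def)
        show "integrable (\<nu> n) (\<lambda>x. x ^ 2 / b\<^sup>2)" using int[of n 2] by simp
        show "indicator (- {- b<..b}) x \<le> x ^ 2 / b\<^sup>2" for x
        proof (cases "x \<in> {- b<..b}")
          case False
          then have "\<bar>b\<bar> \<le> \<bar>x\<bar>" using b by auto
          then have "b\<^sup>2 \<le> x\<^sup>2" by (simp add: abs_le_square_iff)
          then show ?thesis using False b by simp
        qed simp
      qed
      also have "\<dots> = s 2 / b\<^sup>2" using mom[of 2 n] by simp
      also have "\<dots> < \<epsilon>" using b \<epsilon> by (simp add: field_simps)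
      finally have "measure (\<nu> n) (- {- b<..b}) < \<epsilon>" .
      then show ?thesis using \<nu>.prob_compl[of "{- b<..b}" n] by (simp add: Compl_eq_Diff_UNIV)
    qed
    then show "\<exists>a b. a < b \<and> (\<forall>n. measure (\<nu> n) {a<..b} > 1 - \<epsilon>)" using b(1)
      by (intro exI[of _ "- b"] exI[of _ b]) auto
  qed (rule dist)
  then obtain r M where r: "strict_mono r" and M: "real_distribution M" and wc0: "weak_conv_m (\<nu> \<circ> id \<circ> r) M"
    using tight_imp_convergent_subsubsequence[of \<nu> id] by (auto simp: strict_mono_def)
  interpret M: real_distribution M by fact
  have conv: "(\<lambda>n. integral\<^sup>L (\<nu> (r n)) f) \<longlonglongrightarrow> integral\<^sup>L M f"
    if "\<And>x. isCont f x" "\<And>x. norm (f x) \<le> B" for f :: "real \<Rightarrow> real" and B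
    using weak_conv_imp_integral_bdd_continuous_conv[of "\<nu> \<circ> id \<circ> r" M f B] dist M wc0 that
    by (simp add: comp_def)
  have ev: "\<forall>\<^sub>F n in sequentially. k \<le> r n + 2" for k
    using seq_suble[OF r] by (intro eventually_sequentiallyI[of k]) (meson le_trans le_add1)

  have sq_bound: "(\<integral>\<^sup>+x. ennreal ((x ^ k)\<^sup>2) \<partial>M) \<le> ennreal (s (2 * k))" for k
  proof -
    \<comment> \<open>Bounded continuous minorants of x^(2k) that converge to it pointwise: weak
      convergence applies to each, and Fatou carries the bound to the even power.\<close>
    define h where "h m x = (x ^ k)\<^sup>2 / (1 + (1 / real (Suc m))\<^sup>2 * (x ^ k)\<^sup>2)" for m x
    have den: "1 + (1 / real (Suc m))\<^sup>2 * (x ^ k)\<^sup>2 > 0" for m x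
      by (intro add_pos_nonneg) auto
    have h0: "h m x \<ge> 0" "h m x \<le> (x ^ k)\<^sup>2" for m x
      using den[of m x] by (auto simp: h_def divide_simps intro!: mult_right_mono) (simp add: algebra_simps)
    have hb: "h m x \<le> (real (Suc m))\<^sup>2" for m x
      using den[of m x] by (simp add: h_def divide_simps)
    have hc: "isCont (h m) x" for m x
      unfolding h_def using den[of m x] by (intro continuous_intros) auto
    have hm: "h m \<in> borel_measurable K" if "sets K = sets borel" for m K
      unfolding measurable_cong_sets[OF that refl]
      using hc by (intro borel_measurable_continuous_onI continuous_at_imp_continuous_on) auto
    have hi: "integrable M (h m)" for m
      using h0 hb hm[OF M.events_eq_borel] by (intro M.integrable_const_bound[where B = "(real (Suc m))\<^sup>2"]) auto
    have le: "integral\<^sup>L M (h m) \<le> s (2 * k)" for m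
    proof (rule tendsto_upperbound[OF conv[of "h m" "(real (Suc m))\<^sup>2"]])
      show "\<forall>\<^sub>F n in sequentially. integral\<^sup>L (\<nu> (r n)) (h m) \<le> s (2 * k)"
        using ev[of "2 * k"]
      proof eventually_elim
        case (elim n)
        have i2: "integrable (\<nu> (r n)) (\<lambda>x. (x ^ k)\<^sup>2)" using int[of "r n" "2 * k"] by (simp add: power_mult power_commutes mult.commute)
        have "integral\<^sup>L (\<nu> (r n)) (h m) \<le> (LINT x|\<nu> (r n). (x ^ k)\<^sup>2)"
          by (rule integral_mono[OF Bochner_Integration.integrable_bound[OF i2] i2])
            (use h0 hm[OF \<nu>.events_eq_borel] in auto)
        also have "\<dots> = s (2 * k)" using mom[OF elim] by (simp add: power_mult power_commutes mult.commute)
        finally show ?case .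
      qed
    qed (use h0 hb hc in auto)
    have lim: "(\<lambda>m. h m x) \<longlonglongrightarrow> (x ^ k)\<^sup>2" for x
    proof -
      have "(\<lambda>m. (x ^ k)\<^sup>2 / (1 + (1 / real (Suc m))\<^sup>2 * (x ^ k)\<^sup>2)) \<longlonglongrightarrow> (x ^ k)\<^sup>2 / (1 + 0\<^sup>2 * (x ^ k)\<^sup>2)"
        by (intro tendsto_intros LIMSEQ_Suc[OF lim_1_over_n]) auto
      then show ?thesis by (simp add: h_def)
    qed
    have "(\<integral>\<^sup>+x. ennreal ((x ^ k)\<^sup>2) \<partial>M) = (\<integral>\<^sup>+x. liminf (\<lambda>m. ennreal (h m x)) \<partial>M)"
      using lim_imp_Liminf[OF sequentially_bot tendsto_ennrealI[OF lim]] by simp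
    also have "\<dots> \<le> liminf (\<lambda>m. \<integral>\<^sup>+x. ennreal (h m x) \<partial>M)"
      by (rule nn_integral_liminf) (use hi in auto)
    also have "\<dots> \<le> liminf (\<lambda>m::nat. ennreal (s (2 * k)))"
      using le by (intro Liminf_mono always_eventually allI)
        (simp add: nn_integral_eq_integral[OF hi] h0 ennreal_leI)
    also have "\<dots> = ennreal (s (2 * k))" by (simp add: Liminf_const)
    finally show ?thesis .
  qed
  have sqi: "integrable M (\<lambda>x. (x ^ k)\<^sup>2)" for k
    using sq_bound[of k] by (intro integrableI_bounded) (auto simp: less_top[symmetric] top_unique)
  have Mi: "integrable M (\<lambda>x. x ^ k)" for k
  proof (rule Bochner_Integration.integrable_bound)
    show "integrable M (\<lambda>x. 1 + (x ^ k)\<^sup>2)" using sqi by simp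
    have "\<bar>t\<bar> \<le> 1 + t\<^sup>2" for t :: real
      using sum_squares_bound[of 1 "\<bar>t\<bar>"] abs_ge_zero[of t] by (simp only: power2_abs power_one)
    then show "AE x in M. norm (x ^ k) \<le> norm (1 + (x ^ k)\<^sup>2)" by (intro AE_I2) simp
  qed auto
  have Ms: "(LINT x|M. x ^ k) = s k" for k
  proof -
    define C where "C = s (2 * k) + (LINT x|M. (x ^ k)\<^sup>2)"
    have C0: "C \<ge> 0"
    proof -
      have "s (2 * k) = (LINT x|\<nu> (2 * k). x ^ (2 * k))" using mom[of "2 * k" "2 * k"] by simp
      also have "\<dots> \<ge> 0" by (intro integral_nonneg_AE) (simp add: even)
      finally show ?thesis unfolding C_def by (intro add_nonneg_nonneg) auto
    qed
    have "\<bar>(LINT x|M. x ^ k) - s k\<bar> \<le> e * C" if e: "e > 0" for e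
    proof -
      \<comment> \<open>A bounded continuous truncation with |x^k - g x| \<le> e x^(2k), so the
        error is at most e times an even moment, uniformly along the sequence.\<close>
      define g where "g x = x ^ k / (1 + (e * x ^ k)\<^sup>2)" for x :: real
      have den: "1 + (e * x ^ k)\<^sup>2 > 0" for x by (intro add_pos_nonneg) auto
      have et: "\<bar>e * t\<bar> \<le> 1 + (e * t)\<^sup>2" for t
        using sum_squares_bound[of 1 "\<bar>e * t\<bar>"] abs_ge_zero[of "e * t"] by (simp only: power2_abs power_one)
      have gb: "\<bar>g x\<bar> \<le> 1 / e" for x
        using et[of "x ^ k"] den[of x] e by (simp add: g_def abs_mult divide_simps mult.commute)
      have gd: "\<bar>x ^ k - g x\<bar> \<le> e * (x ^ k)\<^sup>2" for x
      proof -
        define t where "t = x ^ k"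
        have d: "1 + (e * t)\<^sup>2 > 0" using den[of x] by (simp add: t_def)
        have "t - g x = e * t\<^sup>2 * (e * t / (1 + (e * t)\<^sup>2))"
          using d unfolding g_def t_def[symmetric] by (simp add: divide_simps) (simp add: algebra_simps power2_eq_square)
        moreover have "\<bar>e * t / (1 + (e * t)\<^sup>2)\<bar> \<le> 1"
          using d et[of t] by (simp add: abs_divide)
        ultimately have "\<bar>t - g x\<bar> \<le> e * t\<^sup>2 * 1"
          using e by (simp only: abs_mult) (intro mult_mono, auto)
        then show ?thesis by (simp add: t_def)
      qed
      have gc: "isCont g x" for x unfolding g_def using den[of x] by (intro continuous_intros) auto
      have gm: "g \<in> borel_measurable K" if "sets K = sets borel" for K
        unfolding measurable_cong_sets[OF that refl]
        using gc by (intro borel_measurable_continuous_onI continuous_at_imp_continuous_on) auto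
      have diff: "\<bar>(LINT x|K. x ^ k) - integral\<^sup>L K g\<bar> \<le> e * (LINT x|K. (x ^ k)\<^sup>2)"
        if K: "real_distribution K" "integrable K (\<lambda>x. x ^ k)" "integrable K (\<lambda>x. (x ^ k)\<^sup>2)" for K
      proof -
        interpret K: real_distribution K by (rule K)
        have gi: "integrable K g"
          using gb gm[OF K.events_eq_borel] by (intro K.integrable_const_bound[where B = "1 / e"]) auto
        have "\<bar>(LINT x|K. x ^ k) - integral\<^sup>L K g\<bar> = \<bar>LINT x|K. x ^ k - g x\<bar>"
          using K(2) gi by simp
        also have "\<dots> \<le> (LINT x|K. \<bar>x ^ k - g x\<bar>)" by (rule integral_abs_bound)
        also have "\<dots> \<le> (LINT x|K. e * (x ^ k)\<^sup>2)"
          using K gi gd by (intro integral_mono) auto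
        finally show ?thesis by simp
      qed
      have "\<bar>s k - integral\<^sup>L M g\<bar> \<le> e * s (2 * k)"
      proof (rule tendsto_upperbound)
        show "(\<lambda>n. \<bar>s k - integral\<^sup>L (\<nu> (r n)) g\<bar>) \<longlonglongrightarrow> \<bar>s k - integral\<^sup>L M g\<bar>"
          using conv[of g "1 / e"] gc gb by (intro tendsto_intros) auto
        show "\<forall>\<^sub>F n in sequentially. \<bar>s k - integral\<^sup>L (\<nu> (r n)) g\<bar> \<le> e * s (2 * k)"
          using ev[of "2 * k"]
        proof eventually_elim
          case (elim n)
          have "integrable (\<nu> (r n)) (\<lambda>x. (x ^ k)\<^sup>2)" "(LINT x|\<nu> (r n). (x ^ k)\<^sup>2) = s (2 * k)"
            using int[of "r n" "2 * k"] mom[OF elim] by (simp_all add: power_mult power_commutes mult.commute)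
          then show ?case
            using diff[OF dist int, of "r n"] mom[of k "r n"] elim by simp
        qed
      qed simp
      with diff[OF M Mi sqi] show ?thesis unfolding C_def by (simp add: algebra_simps abs_if split: if_splits)
    qed
    then have "\<bar>(LINT x|M. x ^ k) - s k\<bar> \<le> 0"
    proof -
      assume *: "\<And>e. e > 0 \<Longrightarrow> \<bar>(LINT x|M. x ^ k) - s k\<bar> \<le> e * C"
      show ?thesis
      proof (rule field_le_epsilon)
        fix \<eta> :: real assume \<eta>: "\<eta> > 0"
        have "\<bar>(LINT x|M. x ^ k) - s k\<bar> \<le> \<eta> / (C + 1) * C" using \<eta> C0 by (intro *) auto
        also have "\<dots> \<le> \<eta>" using \<eta> C0 by (simp add: field_simps)
        finally show "\<bar>(LINT x|M. x ^ k) - s k\<bar> \<le> 0 + \<eta>" by simp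
      qed
    qed
    then show ?thesis by simp
  qed
  have Mp: "measure M {x0} \<ge> c" if c: "\<And>n. measure (\<nu> n) {x0} \<ge> c" for x0 c
  proof (rule tendsto_lowerbound)
    \<comment> \<open>Continuous majorants of the indicator of x0 that converge to it pointwise; the
      lower bound c passes first to the weak limit, then to m at infinity.\<close>
    define f where "f m x = 1 / (1 + (real m * (x - x0))\<^sup>2)" for m x
    have aux: "0 \<le> 1 / (1 + u\<^sup>2)" "1 / (1 + u\<^sup>2) \<le> 1" "1 + u\<^sup>2 \<noteq> 0" for u :: real
    proof -
      have "1 + u\<^sup>2 > 0" by (intro add_pos_nonneg) auto
      then show "0 \<le> 1 / (1 + u\<^sup>2)" "1 / (1 + u\<^sup>2) \<le> 1" "1 + u\<^sup>2 \<noteq> 0" by (auto simp: divide_le_eq_1)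
    qed
    have fb: "0 \<le> f m x" "f m x \<le> 1" for m x unfolding f_def by (rule aux)+
    have fc: "isCont (f m) x" for m x
      unfolding f_def by (intro continuous_intros aux)
    have fm: "f m \<in> borel_measurable K" if "sets K = sets borel" for m K
      unfolding measurable_cong_sets[OF that refl]
      using fc by (intro borel_measurable_continuous_onI continuous_at_imp_continuous_on) auto
    have "(\<lambda>m. f m x) \<longlonglongrightarrow> indicator {x0} x" for x
    proof (cases "x = x0")
      case False
      have "filterlim (\<lambda>m. 1 + (real m)\<^sup>2 * (x - x0)\<^sup>2) at_top sequentially"
        using False
        by (intro filterlim_tendsto_add_at_top[OF tendsto_const] filterlim_at_top_mult_tendsto_pos[OF tendsto_const]
            filterlim_pow_at_top filterlim_real_sequentially) auto
      then have "(\<lambda>m. 1 / (1 + (real m)\<^sup>2 * (x - x0)\<^sup>2)) \<longlonglongrightarrow> 0"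
        by (intro tendsto_divide_0[OF tendsto_const] filterlim_at_top_imp_at_infinity)
      then show ?thesis using False by (simp add: f_def power_mult_distrib)
    qed (simp add: f_def)
    then have "(\<lambda>m. integral\<^sup>L M (f m)) \<longlonglongrightarrow> (LINT x|M. indicator {x0} x)"
      using fb fm[OF M.events_eq_borel] by (intro integral_dominated_convergence[where w = "\<lambda>_. 1"]) auto
    then show "(\<lambda>m. integral\<^sup>L M (f m)) \<longlonglongrightarrow> measure M {x0}" by simp
    have "c \<le> integral\<^sup>L M (f m)" for m
    proof (rule tendsto_lowerbound[OF conv[of "f m" 1]])
      have "c \<le> integral\<^sup>L (\<nu> n) (f m)" for n
      proof -
        have "c \<le> (LINT x|\<nu> n. indicator {x0} x)" using c[of n] by simp
        also have "\<dots> \<le> integral\<^sup>L (\<nu> n) (f m)"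
        proof (rule integral_mono)
          show "integrable (\<nu> n) (f m)"
            using fb fm[OF \<nu>.events_eq_borel] by (intro \<nu>.integrable_const_bound[where B = 1]) auto
          show "indicator {x0} x \<le> f m x" for x
            using fb[of m x] by (cases "x = x0") (auto simp: f_def)
          show "integrable (\<nu> n) (indicat_real {x0})"
            by (intro \<nu>.integrable_const_bound[where B = 1]) (auto simp: indicator_def)
        qed
        finally show ?thesis .
      qed
      then show "\<forall>\<^sub>F n in sequentially. c \<le> integral\<^sup>L (\<nu> (r n)) (f m)" by simp
    qed (use fb fc in auto)
    then show "\<forall>\<^sub>F m in sequentially. c \<le> integral\<^sup>L M (f m)" by simp
  qed simp
  show ?thesis using that[OF M Mi Ms Mp] .
qed

section \<open>Quasi-orthogonal polynomials and Gauss quadrature\<close>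

lemma map_poly_of_real_eval: "poly (map_poly complex_of_real r) (of_real x) = of_real (poly r x)"
  by (simp add: poly_altdef degree_map_poly coeff_map_poly)

lemma pderiv_map_poly_of_real:
  "pderiv (map_poly complex_of_real r) = map_poly complex_of_real (pderiv r)"
  by (intro poly_eqI) (simp add: coeff_map_poly coeff_pderiv)

text \<open>The remainder modulo this quadratic is real of degree at most 1 and vanishes at a
  non-real point, so it is 0.\<close>

lemma real_poly_nonreal_root_dvd:
  fixes r :: "real poly"
  assumes "poly (map_poly complex_of_real r) z = 0" "Im z \<noteq> 0"
  shows "[:(Re z)\<^sup>2 + (Im z)\<^sup>2, - 2 * Re z, 1:] dvd r"
proof -
  let ?q = "[:(Re z)\<^sup>2 + (Im z)\<^sup>2, - 2 * Re z, 1:]"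
  define s where "s = r mod ?q"
  have "degree s < 2 \<or> s = 0"
    using degree_mod_less[of ?q r] by (auto simp: s_def)
  then have "degree s \<le> 1" by auto
  then have "s = [:coeff s 0, coeff s 1:]"
    by (intro poly_eqI) (auto simp: coeff_pCons coeff_eq_0 split: nat.splits)
  then obtain a b where s: "s = [:a, b:]" by blast
  have r: "r = ?q * (r div ?q) + s" by (simp only: s_def mult_div_mod_eq)
  have hom: "map_poly complex_of_real (u * v + w) = map_poly of_real u * map_poly of_real v + map_poly of_real w" for u v w
    by (intro poly_eqI) (simp add: coeff_map_poly coeff_mult)
  have "poly (map_poly complex_of_real ?q) z = 0"
    by (simp add: map_poly_pCons complex_eq_iff power2_eq_square algebra_simps)
  then have "poly (map_poly complex_of_real s) z = 0"
    using assms(1) by (subst (asm) r) (simp only: hom poly_add poly_mult, simp)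
  then have "b * Im z = 0" "a + b * Re z = 0"
    by (auto simp: s map_poly_pCons complex_eq_iff algebra_simps)
  then have "s = 0" using assms(2) by (simp add: s)
  then show ?thesis by (simp add: s_def mod_eq_0_iff_dvd)
qed

context Mstar_measure
begin

lemma Lr_square_pos: "r \<noteq> 0 \<Longrightarrow> Lr (r * r) > 0"
  using integral_square_pos by (simp add: Lr_def)

text \<open>Orthogonality to degrees up to m - 2 is enough because the factor split off is
  quadratic, leaving a cofactor of degree exactly m - 2.\<close>

lemma quasi_orthogonal_roots:
  assumes m: "degree \<pi> = m" "\<pi> \<noteq> 0" and ort: "\<And>g. degree g + 2 \<le> m \<Longrightarrow> Lr (\<pi> * g) = 0"
  shows "card {x. poly \<pi> x = 0} = m"
proof -
  let ?c = "map_poly complex_of_real \<pi>"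
  \<comment> \<open>Testing \<open>\<pi>\<close> against such a \<open>g\<close> would give a positive value; this excludes both non-real roots
    and, with \<open>b = 0\<close>, multiple roots.\<close>
  have no_factor: False if "\<pi> = ([:-a, 1:] * [:-a, 1:] + [:b\<^sup>2:]) * g" for a b g
  proof -
    have g: "g \<noteq> 0" using that m by auto
    have q: "[:-a, 1:] * [:-a, 1:] + [:b\<^sup>2:] = [:a\<^sup>2 + b\<^sup>2, - 2 * a, 1:]"
      by (simp add: power2_eq_square)
    have "degree \<pi> = 2 + degree g"
      unfolding that q using g by (subst degree_mult_eq) auto
    then have "Lr (\<pi> * g) = 0" using m by (intro ort) auto
    moreover have "\<pi> * g = ([:-a, 1:] * g) * ([:-a, 1:] * g) + smult (b\<^sup>2) (g * g)"
    proof -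
      have "(u * u + [:b\<^sup>2:]) * g * g = (u * g) * (u * g) + [:b\<^sup>2:] * (g * g)" for u
        by (simp only: distrib_right distrib_left mult_ac)
      then have "(u * u + [:b\<^sup>2:]) * g * g = (u * g) * (u * g) + smult (b\<^sup>2) (g * g)" for u by simp
      then show ?thesis unfolding that .
    qed
    moreover have "Lr (([:-a, 1:] * g) * ([:-a, 1:] * g)) > 0"
      using g by (intro Lr_square_pos no_zero_divisors) auto
    moreover have "b\<^sup>2 * Lr (g * g) \<ge> 0" using Lr_square_pos[OF g] by simp
    ultimately show False by (simp only: Lr_add Lr_smult)
  qed
  have real_root: "Im z = 0" if "poly ?c z = 0" for z
  proof (rule ccontr)
    assume "Im z \<noteq> 0"
    from real_poly_nonreal_root_dvd[OF that this] obtain g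
      where "\<pi> = [:(Re z)\<^sup>2 + (Im z)\<^sup>2, - 2 * Re z, 1:] * g" by (elim dvdE)
    also have "[:(Re z)\<^sup>2 + (Im z)\<^sup>2, - 2 * Re z, 1:] = [:- Re z, 1:] * [:- Re z, 1:] + [:(Im z)\<^sup>2:]"
      by (simp add: power2_eq_square)
    finally show False by (rule no_factor)
  qed
  have sqf: "rsquarefree ?c"
    unfolding rsquarefree_roots
  proof (intro allI notI, elim conjE)
    fix z assume z: "poly ?c z = 0" "poly (pderiv ?c) z = 0"
    define a where "a = Re z"
    have za: "z = of_real a" using real_root[OF z(1)] by (simp add: a_def complex_eq_iff)
    have "poly \<pi> a = 0" "poly (pderiv \<pi>) a = 0"
      using z unfolding za pderiv_map_poly_of_real map_poly_of_real_eval by simp_all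
    then obtain h where h: "\<pi> = [:-a, 1:] * h" by (auto simp: poly_eq_0_iff_dvd elim!: dvdE)
    have "poly h a = 0" using \<open>poly (pderiv \<pi>) a = 0\<close>
      unfolding h pderiv_mult by (simp add: pderiv_pCons)
    then obtain g where g: "h = [:-a, 1:] * g" by (auto simp: poly_eq_0_iff_dvd elim!: dvdE)
    have "\<pi> = ([:-a, 1:] * [:-a, 1:] + [:0\<^sup>2:]) * g" unfolding h g by (simp only: mult.assoc zero_power2 pCons_0_0 add_0_right)
    then show False by (rule no_factor)
  qed
  have c0: "?c \<noteq> 0" using m by (simp add: map_poly_eq_0_iff)
  have lc: "lead_coeff ?c \<noteq> 0" using c0 by simp
  have "m = degree ?c" using m by (simp add: degree_map_poly)
  also have "\<dots> = degree (\<Prod>z | poly ?c z = 0. [:- z, 1:])"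
    by (subst complex_poly_decompose_rsquarefree[OF sqf, symmetric]) (use lc in simp)
  also have "\<dots> = card {z. poly ?c z = 0}"
    by (subst degree_prod_eq_sum_degree) auto
  also have "{z. poly ?c z = 0} = of_real ` {x. poly \<pi> x = 0}"
  proof (intro set_eqI iffI)
    fix z assume "z \<in> {z. poly ?c z = 0}"
    moreover from this have "z = of_real (Re z)" using real_root[of z] by (simp add: complex_eq_iff)
    ultimately show "z \<in> of_real ` {x. poly \<pi> x = 0}"
      by (metis (mono_tags, lifting) image_eqI map_poly_of_real_eval mem_Collect_eq of_real_eq_0_iff)
  qed (auto simp: map_poly_of_real_eval)
  also have "card \<dots> = card {x. poly \<pi> x = 0}"
    by (intro card_image) (auto simp: inj_on_def)
  finally show ?thesis by simp
qed

text \<open>Divide f by \<pi> and interpolate the remainder at the roots. Exactness stops at degree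
  2m - 2 because the quotient must have degree at most m - 2 for \<pi> to annihilate it.\<close>

lemma gauss_quadrature:
  assumes m: "degree \<pi> = m" "\<pi> \<noteq> 0" "m > 0" and ort: "\<And>g. degree g + 2 \<le> m \<Longrightarrow> Lr (\<pi> * g) = 0"
  defines "R \<equiv> {x. poly \<pi> x = 0}"
  obtains lag where "\<And>a. a \<in> R \<Longrightarrow> poly (lag a) a = 1"
    "\<And>f. degree f + 2 \<le> 2 * m \<Longrightarrow> Lr f = (\<Sum>a\<in>R. Lr (lag a * lag a) * poly f a)"
proof -
  have R: "finite R" "card R = m"
    using poly_roots_finite[OF m(2)] quasi_orthogonal_roots[OF m(1,2) ort] by (auto simp: R_def)
  define lag where "lag a = (\<Prod>b\<in>R - {a}. smult (1 / (a - b)) [:- b, 1:])" for a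
  have l1: "poly (lag a) a = 1" for a
  proof -
    have "poly (smult (1 / (a - b)) [:- b, 1:]) a = 1" if "b \<noteq> a" for b
      using that by (simp add: diff_divide_distrib[symmetric] add_divide_distrib[symmetric])
    then show ?thesis unfolding lag_def poly_prod by (intro prod.neutral) blast
  qed
  have l0: "poly (lag a) b = 0" if "b \<in> R" "b \<noteq> a" for a b
    unfolding lag_def poly_prod using that R by (intro prod_zero) auto
  have ld: "degree (lag a) \<le> m - 1" if "a \<in> R" for a
  proof -
    have "degree (lag a) \<le> (\<Sum>b\<in>R - {a}. degree (smult (1 / (a - b)) [:- b, 1:]))"
      unfolding lag_def using R degree_prod_sum_le[of "R - {a}" "\<lambda>b. smult (1 / (a - b)) [:- b, 1:]"]
      by (simp add: comp_def)
    also have "\<dots> \<le> (\<Sum>b\<in>R - {a}. 1)" by (intro sum_mono) auto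
    also have "\<dots> = m - 1" using R that by simp
    finally show ?thesis .
  qed
  have quad: "Lr f = (\<Sum>a\<in>R. Lr (lag a) * poly f a)" if f: "degree f + 2 \<le> 2 * m" for f
  proof -
    define g where "g = f div \<pi>"
    define r where "r = f mod \<pi>"
    have fgr: "f = \<pi> * g + r" by (simp add: g_def r_def)
    have r: "degree r < m" using degree_mod_less[OF m(2), of f] m by (auto simp: r_def)
    have "Lr (\<pi> * g) = 0"
    proof (cases "g = 0")
      case False
      have "degree (\<pi> * g) = m + degree g" using False m by (simp add: degree_mult_eq)
      then have "degree f = m + degree g" unfolding fgr using r by (subst degree_add_eq_left) auto
      then show ?thesis using f by (intro ort) auto
    qed simp
    moreover have "r = (\<Sum>a\<in>R. smult (poly f a) (lag a))"
    proof (rule poly_eqI_degree[of R])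
      fix x assume x: "x \<in> R"
      have "poly (\<Sum>a\<in>R. smult (poly f a) (lag a)) x = (\<Sum>a\<in>R. poly f a * poly (lag a) x)"
        by (simp add: poly_sum)
      also have "\<dots> = poly f x"
        using R x l0 l1 by (subst sum.remove[of _ x]) (auto intro!: sum.neutral)
      also have "\<dots> = poly r x" unfolding fgr using x by (simp add: R_def)
      finally show "poly r x = poly (\<Sum>a\<in>R. smult (poly f a) (lag a)) x" by simp
    next
      show "degree r < card R" using r R by simp
      have "degree (\<Sum>a\<in>R. smult (poly f a) (lag a)) \<le> m - 1"
        using ld by (intro degree_sum_le R) (meson degree_smult_le le_trans)
      then show "degree (\<Sum>a\<in>R. smult (poly f a) (lag a)) < card R" using R m(3) by simp
    qed
    moreover have "Lr f = Lr (\<pi> * g) + Lr r" by (subst fgr) (rule Lr_add)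
    ultimately have "Lr f = Lr (\<Sum>a\<in>R. smult (poly f a) (lag a))" by simp
    then show ?thesis by (simp add: Lr_sum Lr_smult mult.commute)
  qed
  \<comment> \<open>The square of \<open>lag a\<close> has degree at most 2m - 2, still in the exact
    range, and agrees with \<open>lag a\<close> at the nodes. Written as integrals of squares, the
    weights are visibly nonnegative.\<close>
  have "Lr (lag a) = Lr (lag a * lag a)" if "a \<in> R" for a
  proof -
    have "degree (lag a * lag a) + 2 \<le> 2 * m"
      using degree_mult_le[of "lag a" "lag a"] ld[OF that] m(3) by simp
    then have "Lr (lag a * lag a) = (\<Sum>b\<in>R. Lr (lag b) * poly (lag a * lag a) b)" by (rule quad)
    also have "\<dots> = Lr (lag a)"
      using R that l0 l1 by (subst sum.remove[of _ a]) (auto intro!: sum.neutral)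
    finally show ?thesis by simp
  qed
  with l1 quad show ?thesis by (intro that) auto
qed

lemma real_p: "p n (of_real x) = of_real (poly (rP n) x)"
  by (simp add: Pfun_def poly_Pc_of_real)

lemma quadrature_with_node:
  assumes "summable (\<lambda>k. (cmod (p k (of_real x0)))\<^sup>2)"
  defines "B \<equiv> (\<Sum>k. (cmod (p k (of_real x0)))\<^sup>2)"
  obtains R :: "real set" and wt where "finite R" "\<And>a. a \<in> R \<Longrightarrow> wt a \<ge> (0::real)" "x0 \<in> R" "B * wt x0 \<ge> 1"
    "\<And>f. degree f \<le> N \<Longrightarrow> Lr f = (\<Sum>a\<in>R. wt a * poly f a)"
proof -
  \<comment> \<open>Consecutive orthogonal polynomials have no common zero, since their Casorati
    determinant is nonzero.\<close>
  have "\<exists>n\<ge>N. poly (rP n) x0 \<noteq> 0"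
  proof (rule ccontr)
    assume "\<not> ?thesis"
    then have "poly (rP N) x0 = 0" "poly (rP (Suc N)) x0 = 0" by auto
    then have "p N (of_real x0) = 0" "p (Suc N) (of_real x0) = 0" unfolding real_p by simp_all
    then have "wr (Suc N) N (of_real x0) = 0" by (simp add: wr_def)
    then show False using wr_Suc_nonzero by blast
  qed
  then obtain n where n: "n \<ge> N" "poly (rP n) x0 \<noteq> 0" by blast
  \<comment> \<open>The combination of two neighbours that vanishes at x0. By the choice of n its
    leading coefficient is nonzero, so its degree is \<open>Suc n\<close>.\<close>
  define \<pi> where "\<pi> = smult (poly (rP n) x0) (rP (Suc n)) - smult (poly (rP (Suc n)) x0) (rP n)"
  have d: "degree \<pi> = Suc n"
    unfolding \<pi>_def diff_conv_add_uminus using n(2) by (subst degree_add_eq_left) auto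
  have nz: "\<pi> \<noteq> 0" using d by auto
  have root: "poly \<pi> x0 = 0" by (simp add: \<pi>_def)
  have ort: "Lr (\<pi> * g) = 0" if "degree g + 2 \<le> Suc n" for g
    using orthonormal_polys_orthogonal[OF orthonormal_rP, of g "Suc n"]
      orthonormal_polys_orthogonal[OF orthonormal_rP, of g n] that
    by (simp add: \<pi>_def left_diff_distrib Lr_diff Lr_smult)
  obtain lag where l: "\<And>a. a \<in> {x. poly \<pi> x = 0} \<Longrightarrow> poly (lag a) a = 1"
    "\<And>f. degree f + 2 \<le> 2 * Suc n \<Longrightarrow> Lr f = (\<Sum>a\<in>{x. poly \<pi> x = 0}. Lr (lag a * lag a) * poly f a)"
    using gauss_quadrature[OF d nz zero_less_Suc ort] by blast
  show ?thesis
  proof (rule that[of "{x. poly \<pi> x = 0}" "\<lambda>a. Lr (lag a * lag a)"])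
    show "finite {x. poly \<pi> x = 0}" by (rule poly_roots_finite[OF nz])
    show "Lr (lag a * lag a) \<ge> 0" for a unfolding Lr_def by (intro integral_nonneg_AE) simp
    show "x0 \<in> {x. poly \<pi> x = 0}" using root by simp
    show "Lr f = (\<Sum>a\<in>{x. poly \<pi> x = 0}. Lr (lag a * lag a) * poly f a)" if "degree f \<le> N" for f
      using that n(1) by (intro l(2)) auto
    \<comment> \<open>The weight at x0 is the squared norm of a polynomial with value 1 there, and
      evaluation at x0 has squared norm at most \<open>B\<close>.\<close>
    let ?l = "map_poly complex_of_real (lag x0)"
    have "(cmod (poly ?l (of_real x0)))\<^sup>2 \<le> B * (LINT x|\<mu>. (cmod (poly ?l (of_real x)))\<^sup>2)"
      unfolding B_def by (rule eval_bound_of_summable[OF assms(1)])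
    also have "(LINT x|\<mu>. (cmod (poly ?l (of_real x)))\<^sup>2) = Lr (lag x0 * lag x0)"
      by (simp add: map_poly_of_real_eval Lr_def power2_eq_square)
    finally show "B * Lr (lag x0 * lag x0) \<ge> 1"
      using l(1)[of x0] root by (simp add: map_poly_of_real_eval)
  qed
qed

end

section \<open>Indeterminacy and the limit-circle condition\<close>

text \<open>Every point outside the support lies in a null ball; by Lindelof countably many such
  balls suffice.\<close>

lemma emeasure_Compl_measure_support:
  assumes "sets M = sets borel"
  shows "emeasure M (- measure_support M) = 0"
proof -
  define F where "F = {ball x e | x e. e > 0 \<and> emeasure M (ball x e) = 0}"
  have "\<And>S. S \<in> F \<Longrightarrow> open S" by (auto simp: F_def)
  then obtain F' where F': "F' \<subseteq> F" "countable F'" "\<Union>F' = \<Union>F" by (rule Lindelof)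
  have "- measure_support M \<subseteq> \<Union>F"
    by (force simp: F_def measure_support_def not_gr_zero)
  then have sub: "- measure_support M \<subseteq> (\<Union>S\<in>F'. S)" using F'(3) by simp
  have "(\<Union>S\<in>F'. S) \<in> null_sets M"
    using F' assms by (intro null_sets_UN') (auto simp: F_def null_sets_def)
  then show ?thesis using sub
    by (metis emeasure_mono le_zero_eq null_setsD1 null_setsD2)
qed

lemma norm_integral_le_integral:
  fixes f :: "'b \<Rightarrow> 'a::{banach, second_countable_topology}"
  assumes "integrable M f" "integrable M g" "\<And>x. norm (f x) \<le> g x"
  shows "norm (LINT x|M. f x) \<le> (LINT x|M. g x)"
proof -
  have "norm (LINT x|M. f x) \<le> (LINT x|M. norm (f x))" by (rule integral_norm_bound)
  also have "\<dots> \<le> (LINT x|M. g x)" using assms by (intro integral_mono) auto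
  finally show ?thesis .
qed

lemma integral_scaled:
  fixes f :: "real \<Rightarrow> 'a::{banach, second_countable_topology}"
  assumes "c \<ge> 0" "f \<in> borel_measurable M"
  shows "(LINT x|density M (\<lambda>_. ennreal c). f x) = c *\<^sub>R (LINT x|M. f x)"
  using assms by (subst integral_density) auto

lemma integrable_scaled:
  fixes f :: "real \<Rightarrow> 'a::{banach, second_countable_topology}"
  assumes "c \<ge> 0" "integrable M f"
  shows "integrable (density M (\<lambda>_. ennreal c)) f"
  using assms by (subst integrable_density) auto

context Mstar_measure
begin

lemma Lr_eq_moments: "Lr r = (\<Sum>k\<le>degree r. coeff r k * moment \<mu> k)"
  unfolding Lr_def poly_altdef moment_def
  by (subst Bochner_Integration.integral_sum) (auto intro!: integrable_mult_right integrable_power)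

lemma L_eq_moments: "L r = (\<Sum>k\<le>degree r. coeff r k * of_real (moment \<mu> k))"
proof -
  have "integrable \<mu> (\<lambda>x. complex_of_real x ^ k)" for k
    using integrable_poly[of "monom 1 k"] by (simp add: poly_monom)
  moreover have "(LINT x|\<mu>. complex_of_real x ^ k) = of_real (moment \<mu> k)" for k
    unfolding moment_def by (subst integral_complex_of_real[symmetric]) simp
  ultimately show ?thesis
    unfolding L_def poly_altdef
    by (subst Bochner_Integration.integral_sum) (auto intro!: integrable_mult_right)
qed

text \<open>If the support were finite, the polynomial vanishing on it would have a square of
  integral 0, whereas that integral is a combination of moments, positive for
  \<open>\<mu>\<close>.\<close>

lemma Mstar_of_same_moments:
  assumes s: "sets \<sigma> = sets borel" and i: "\<And>k. integrable \<sigma> (\<lambda>x. x ^ k)"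
    and m: "\<And>k. moment \<sigma> k = moment \<mu> k"
  shows "\<sigma> \<in> Mstar"
proof -
  have "infinite (measure_support \<sigma>)"
  proof
    assume fin: "finite (measure_support \<sigma>)"
    define r where "r = (\<Prod>a\<in>measure_support \<sigma>. [:- a, 1::real:])"
    have r0: "r \<noteq> 0" using fin by (simp add: r_def prod_zero_iff)
    have "(LINT x|\<sigma>. poly (r * r) x) = (\<Sum>k\<le>degree (r * r). coeff (r * r) k * moment \<sigma> k)"
      unfolding poly_altdef moment_def
      by (subst Bochner_Integration.integral_sum) (auto intro!: integrable_mult_right i)
    also have "\<dots> = Lr (r * r)" by (simp add: m Lr_eq_moments)
    also have "\<dots> > 0" by (rule Lr_square_pos[OF r0])
    finally have pos: "(LINT x|\<sigma>. poly (r * r) x) > 0" .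
    have "- measure_support \<sigma> \<in> sets \<sigma>"
      unfolding s using fin by (intro borel_open open_Compl finite_imp_closed)
    then have "AE x in \<sigma>. x \<in> measure_support \<sigma>"
      by (intro AE_I[OF _ emeasure_Compl_measure_support[OF s]]) auto
    then have "AE x in \<sigma>. poly (r * r) x = 0"
      by eventually_elim (auto simp: r_def poly_prod fin prod_zero_iff)
    then have "(LINT x|\<sigma>. poly (r * r) x) = 0" by (rule integral_eq_zero_AE)
    with pos show False by simp
  qed
  with s i show ?thesis by (simp add: Mstar_def)
qed

lemma mass_pos: "measure \<mu> UNIV > 0"
proof -
  have "Lr (1 * 1) > 0" by (rule Lr_square_pos) simp
  then show ?thesis by (simp add: Lr_def)
qed

text \<open>Dividing by the mass m turns the quadrature into a probability distribution, as weak
  compactness requires. The lower bound at x0 does not depend on N.\<close>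

lemma quadrature_distribution:
  assumes sm: "summable (\<lambda>k. (cmod (p k (of_real x0)))\<^sup>2)"
  defines "B \<equiv> (\<Sum>k. (cmod (p k (of_real x0)))\<^sup>2)" and "m \<equiv> measure \<mu> UNIV"
  shows "\<exists>\<nu>. real_distribution \<nu> \<and> (\<forall>k. integrable \<nu> (\<lambda>x. x ^ k)) \<and>
    (\<forall>k\<le>N. (LINT x|\<nu>. x ^ k) = moment \<mu> k / m) \<and> B > 0 \<and> measure \<nu> {x0} \<ge> 1 / (B * m)"
proof -
  obtain R wt where R: "finite R" "\<And>a. a \<in> R \<Longrightarrow> wt a \<ge> (0::real)" "x0 \<in> R" "B * wt x0 \<ge> 1"
    and quad: "\<And>f. degree f \<le> N \<Longrightarrow> Lr f = (\<Sum>a\<in>R. wt a * poly f a)"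
    using quadrature_with_node[OF sm, where N = N] unfolding B_def by blast
  have m: "m > 0" using mass_pos by (simp add: m_def)
  have B: "B > 0"
  proof (rule ccontr)
    assume "\<not> B > 0"
    then have "B * wt x0 \<le> 0" using R(2)[OF R(3)] by (intro mult_nonpos_nonneg) auto
    with R(4) show False by linarith
  qed
  define f where "f a = (if a \<in> R then wt a / m else 0)" for a
  have f0: "f a \<ge> 0" for a using R(2) m by (simp add: f_def)
  have "Lr 1 = m" by (simp add: Lr_def m_def)
  then have "(\<Sum>a\<in>R. wt a) = m" using quad[of 1] by simp
  then have fs: "(\<Sum>a\<in>R. f a) = 1" using m by (simp add: f_def sum_divide_distrib[symmetric])
  have f1: "(\<integral>\<^sup>+a. ennreal (f a) \<partial>count_space UNIV) = 1"
  proof -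
    have "(\<integral>\<^sup>+a. ennreal (f a) \<partial>count_space UNIV) = (\<Sum>a\<in>R. ennreal (f a))"
      using R(1) by (intro nn_integral_count_space') (auto simp: f_def)
    also have "\<dots> = ennreal (\<Sum>a\<in>R. f a)" using f0 by (intro sum_ennreal) auto
    finally show ?thesis by (simp add: fs)
  qed
  define P where "P = embed_pmf f"
  have P: "pmf P a = f a" for a unfolding P_def by (rule pmf_embed_pmf[OF f0 f1])
  have sP: "set_pmf P \<subseteq> R" unfolding P_def set_embed_pmf[OF f0 f1] by (auto simp: f_def)
  have fin: "finite (set_pmf P)" using sP R(1) by (rule finite_subset)
  define \<nu> where "\<nu> = distr (measure_pmf P) borel (\<lambda>x. x)"
  have "real_distribution \<nu>"
    unfolding \<nu>_def by (rule prob_space.real_distribution_distr[OF prob_space_measure_pmf]) simp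
  moreover have "integrable \<nu> (\<lambda>x. x ^ k)" for k
    unfolding \<nu>_def by (subst integrable_distr_eq) (auto intro: integrable_measure_pmf_finite[OF fin])
  moreover have "(LINT x|\<nu>. x ^ k) = moment \<mu> k / m" if k: "k \<le> N" for k
  proof -
    have "(LINT x|\<nu>. x ^ k) = (LINT x|measure_pmf P. x ^ k)"
      unfolding \<nu>_def by (subst integral_distr) auto
    also have "\<dots> = (\<Sum>a\<in>R. a ^ k * pmf P a)"
      using R(1) sP by (intro integral_measure_pmf_real) auto
    also have "\<dots> = (\<Sum>a\<in>R. wt a * poly (monom 1 k) a) / m"
      by (simp add: P f_def poly_monom sum_divide_distrib mult.commute)
    also have "(\<Sum>a\<in>R. wt a * poly (monom 1 k) a) = Lr (monom 1 k)"
      using k by (intro quad[symmetric]) (simp add: degree_monom_eq)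
    also have "Lr (monom 1 k) = moment \<mu> k" by (simp add: Lr_def moment_def poly_monom)
    finally show ?thesis .
  qed
  moreover have "measure \<nu> {x0} \<ge> 1 / (B * m)"
  proof -
    have "measure \<nu> {x0} = pmf P x0"
      unfolding \<nu>_def by (subst measure_distr) (auto simp: measure_pmf_single)
    also have "\<dots> = wt x0 / m" using R(3) by (simp add: P f_def)
    also have "\<dots> \<ge> 1 / (B * m)" using R(4) B m by (simp add: field_simps)
    finally show ?thesis .
  qed
  ultimately show ?thesis using B by blast
qed

lemma limit_circle_imp_indeterminate:
  assumes limit_circle
  shows "\<not> determinate \<mu>"
proof -
  \<comment> \<open>A finite measure has countably many atoms, so a non-atom x0 exists; the solution
    built below has an atom there and thus differs from \<open>\<mu>\<close>.\<close>
  have "countable {x. measure \<mu> {x} \<noteq> 0}" by (rule countable_support)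
  then obtain x0 where x0: "measure \<mu> {x0} = 0"
    using uncountable_UNIV_real by (metis (mono_tags, lifting) UNIV_eq_I mem_Collect_eq)
  define B where "B = (\<Sum>k. (cmod (p k (of_real x0)))\<^sup>2)"
  define m where "m = measure \<mu> UNIV"
  have m: "m > 0" using mass_pos by (simp add: m_def)
  have "\<exists>\<nu>. real_distribution \<nu> \<and> (\<forall>k. integrable \<nu> (\<lambda>x. x ^ k)) \<and>
    (\<forall>k\<le>N. (LINT x|\<nu>. x ^ k) = moment \<mu> k / m) \<and> B > 0 \<and> measure \<nu> {x0} \<ge> 1 / (B * m)" for N
    using quadrature_distribution[OF limit_circle_summable(1)[OF assms], of N x0]
    unfolding B_def m_def .
  then obtain \<nu> where \<nu>: "\<And>n. real_distribution (\<nu> n)" "\<And>n k. integrable (\<nu> n) (\<lambda>x. x ^ k)"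
    "\<And>n k. k \<le> n + 2 \<Longrightarrow> (LINT x|\<nu> n. x ^ k) = moment \<mu> k / m"
    "\<And>n. measure (\<nu> n) {x0} \<ge> 1 / (B * m)" and B: "B > 0"
    using choice[of "\<lambda>n \<nu>. real_distribution \<nu> \<and> (\<forall>k. integrable \<nu> (\<lambda>x. x ^ k)) \<and>
    (\<forall>k\<le>n + 2. (LINT x|\<nu>. x ^ k) = moment \<mu> k / m) \<and> B > 0 \<and> measure \<nu> {x0} \<ge> 1 / (B * m)"]
    by blast
  obtain M where M: "real_distribution M" "\<And>k. integrable M (\<lambda>x. x ^ k)"
    "\<And>k. (LINT x|M. x ^ k) = moment \<mu> k / m" "measure M {x0} \<ge> 1 / (B * m)"
    using moment_limit[of \<nu> "\<lambda>k. moment \<mu> k / m", OF \<nu>(1-3)] \<nu>(4) by metis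
  interpret M: real_distribution M by (rule M(1))
  define \<sigma> where "\<sigma> = density M (\<lambda>_. ennreal m)"
  have s: "sets \<sigma> = sets borel" by (simp add: \<sigma>_def)
  have mom: "moment \<sigma> k = moment \<mu> k" for k
    unfolding moment_def \<sigma>_def using m M(3)[of k] by (subst integral_scaled) (auto simp: moment_def)
  have "\<sigma> \<in> Mstar"
    using s mom M(2) m by (intro Mstar_of_same_moments) (auto simp: \<sigma>_def intro!: integrable_scaled)
  moreover have "\<sigma> \<noteq> \<mu>"
  proof
    assume eq: "\<sigma> = \<mu>"
    have "emeasure \<mu> {x0} = 0" using x0 by (simp add: emeasure_eq_measure)
    moreover have "emeasure \<sigma> {x0} = ennreal m * emeasure M {x0}"
      unfolding \<sigma>_def by (subst emeasure_density) (auto simp: nn_integral_cmult_indicator)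
    moreover have "measure M {x0} > 0"
    proof -
      have "1 / (B * m) > 0" using B m by simp
      with M(4) show ?thesis by linarith
    qed
    ultimately show False using eq m by (simp add: M.emeasure_eq_measure)
  qed
  ultimately show ?thesis using mom unfolding determinate_def by blast
qed

text \<open>Bound the resolvent by 1 / |Im z| and apply Cauchy-Schwarz against the constant
  1.\<close>

lemma cmod_integral_resolvent_square_le:
  assumes "Im z \<noteq> 0"
  shows "(cmod (LINT x|\<mu>. poly r (of_real x) / (of_real x - z)))\<^sup>2
    \<le> measure \<mu> UNIV * (LINT x|\<mu>. (cmod (poly r (of_real x)))\<^sup>2) / (Im z)\<^sup>2"
proof -
  let ?f = "\<lambda>x. cmod (poly r (of_real x))"
  have i: "integrable \<mu> ?f" using integrable_poly by (rule integrable_norm)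
  have "cmod (LINT x|\<mu>. poly r (of_real x) / (of_real x - z)) \<le> (LINT x|\<mu>. ?f x / \<bar>Im z\<bar>)"
  proof (rule norm_integral_le_integral)
    show "integrable \<mu> (\<lambda>x. ?f x / \<bar>Im z\<bar>)" using i by simp
    show "cmod (poly r (of_real x) / (of_real x - z)) \<le> ?f x / \<bar>Im z\<bar>" for x
      using mult_left_mono[OF cmod_resolvent_le[OF assms, of x], of "?f x"]
      by (simp add: norm_divide)
  qed (rule integrable_resolvent_mult_poly[OF assms])
  then have "(cmod (LINT x|\<mu>. poly r (of_real x) / (of_real x - z)))\<^sup>2 \<le> ((LINT x|\<mu>. ?f x) / \<bar>Im z\<bar>)\<^sup>2"
    by (intro power_mono) auto
  also have "\<dots> = (LINT x|\<mu>. ?f x)\<^sup>2 / (Im z)\<^sup>2" by (simp add: power_divide)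
  also have "\<dots> \<le> measure \<mu> UNIV * (LINT x|\<mu>. (?f x)\<^sup>2) / (Im z)\<^sup>2"
    using square_integral_le[OF i integrable_poly_sq] by (intro divide_right_mono) auto
  finally show ?thesis .
qed

lemma indeterminate_imp_eval_bound:
  assumes "\<not> determinate \<mu>"
  obtains z B where "Im z \<noteq> 0" "\<And>r. (cmod (poly r z))\<^sup>2 \<le> B * (LINT x|\<mu>. (cmod (poly r (of_real x)))\<^sup>2)"
proof -
  obtain \<sigma> where \<sigma>: "\<sigma> \<in> Mstar" "\<And>n. moment \<sigma> n = moment \<mu> n" "\<sigma> \<noteq> \<mu>"
    using assms by (auto simp: determinate_def)
  interpret s: Mstar_measure \<sigma> by unfold_locales (rule \<sigma>(1))
  have "\<exists>z. Im z \<noteq> 0 \<and> stieltjes \<sigma> z \<noteq> stieltjes \<mu> z"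
    using stieltjes_unique[of \<sigma> \<mu>] \<sigma>(3) s.finite_measure_axioms finite_measure_axioms s.sets_mu sets_mu by blast
  then obtain z where z: "Im z \<noteq> 0" "stieltjes \<sigma> z \<noteq> stieltjes \<mu> z" by blast
  have L: "s.L r = L r" for r by (simp add: s.L_eq_moments L_eq_moments \<sigma>(2))
  define D where "D = (cmod (stieltjes \<mu> z - stieltjes \<sigma> z))\<^sup>2"
  have D: "D > 0" using z by (simp add: D_def)
  \<comment> \<open>Each of the two solutions contributes twice the bound of
    \<open>cmod_integral_resolvent_square_le\<close>, whence the 4.\<close>
  define B where "B = 4 * measure \<mu> UNIV / (Im z)\<^sup>2 / D"
  have "(cmod (poly r z))\<^sup>2 \<le> B * (LINT x|\<mu>. (cmod (poly r (of_real x)))\<^sup>2)" for r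
  proof -
    let ?I = "LINT x|\<mu>. (cmod (poly r (of_real x)))\<^sup>2"
    have sI: "(LINT x|\<sigma>. (cmod (poly r (of_real x)))\<^sup>2) = ?I"
      using s.of_real_integral_poly_sq[of r] of_real_integral_poly_sq[of r] L by (metis of_real_eq_iff)
    have sm: "measure \<sigma> UNIV = measure \<mu> UNIV"
      using \<sigma>(2)[of 0] by (simp add: moment_def)
    \<comment> \<open>The polynomial parts of the two resolvent integrals depend on the moments only
      and cancel.\<close>
    have "poly r z * (stieltjes \<mu> z - stieltjes \<sigma> z)
        = (LINT x|\<mu>. poly r (of_real x) / (of_real x - z)) - (LINT x|\<sigma>. poly r (of_real x) / (of_real x - z))"
      unfolding integral_resolvent_mult_poly[OF z(1)] s.integral_resolvent_mult_poly[OF z(1)] L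
      by (simp add: algebra_simps)
    then have "(cmod (poly r z))\<^sup>2 * D = (cmod ((LINT x|\<mu>. poly r (of_real x) / (of_real x - z))
        - (LINT x|\<sigma>. poly r (of_real x) / (of_real x - z))))\<^sup>2"
      unfolding D_def by (metis norm_mult power_mult_distrib)
    also have "\<dots> \<le> 2 * (measure \<mu> UNIV * ?I / (Im z)\<^sup>2) + 2 * (measure \<mu> UNIV * ?I / (Im z)\<^sup>2)"
      using cmod_integral_resolvent_square_le[OF z(1), of r] s.cmod_integral_resolvent_square_le[OF z(1), of r]
      unfolding sI sm by (intro order_trans[OF cmod_diff_square_le] add_mono mult_left_mono) auto
    also have "\<dots> = B * D * ?I" using D by (simp add: B_def)
    finally have "(cmod (poly r z))\<^sup>2 * D \<le> (B * ?I) * D" by (simp add: mult_ac)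
    then show ?thesis using D by simp
  qed
  with z(1) show ?thesis by (rule that)
qed

lemma limit_circle_of_eval_bound:
  assumes "Im z \<noteq> 0" "\<And>r. (cmod (poly r z))\<^sup>2 \<le> B * (LINT x|\<mu>. (cmod (poly r (of_real x)))\<^sup>2)"
  shows limit_circle
  using assms(1) eval_bound_imp_summable[OF assms(2)] unfolding limit_circle_def by blast

lemma indeterminate_iff_limit_circle: "\<not> determinate \<mu> \<longleftrightarrow> limit_circle"
  using limit_circle_imp_indeterminate indeterminate_imp_eval_bound limit_circle_of_eval_bound by metis

end

section \<open>N-extremality and approximation of resolvents\<close>

lemma suminf_cnj: "(\<Sum>k. cnj (f k)) = cnj (\<Sum>k. f k)" if "summable f"
  using sums_cnj[of f "\<Sum>k. f k"] summable_sums[OF that] by (simp add: sums_iff)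

definition resolvent_approx :: "real measure \<Rightarrow> bool" where
  "resolvent_approx \<mu> \<longleftrightarrow> (\<forall>z. Im z \<noteq> 0 \<longrightarrow> (\<forall>e>0. \<exists>r.
    (LINT x|\<mu>. (cmod (1 / (of_real x - z) - poly r (of_real x)))\<^sup>2) < e))"

context Mstar_measure
begin

abbreviation S :: "complex \<Rightarrow> complex" where "S \<equiv> stieltjes \<mu>"

section \<open>Conjugation symmetry and Parseval's equality\<close>

lemma p_cnj: "p k (cnj z) = cnj (p k z)"
  by (simp add: Pfun_def poly_Pc_cnj)

lemma q_cnj: "q k (cnj z) = cnj (q k z)"
proof -
  let ?s = "synthetic_div (Pc k) z"
  have "synthetic_div (Pc k) (cnj z) = map_poly cnj ?s"
  proof (rule synthetic_div_eqI)
    show "Pc k = [:- cnj z, 1:] * map_poly cnj ?s + [:cnj (p k z):]"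
    proof (rule poly_ext)
      fix x
      have "poly (Pc k) x = cnj (poly (Pc k) (cnj x))" by (simp add: poly_Pc_cnj)
      also have "poly (Pc k) (cnj x) = (cnj x - z) * poly ?s (cnj x) + p k z"
        unfolding Pfun_def by (rule poly_eq_synthetic_div)
      finally show "poly (Pc k) x = poly ([:- cnj z, 1:] * map_poly cnj ?s + [:cnj (p k z):]) x"
        by (simp add: algebra_simps)
    qed
  qed
  moreover have "L (map_poly cnj r) = cnj (L r)" for r
    unfolding L_def by simp
  ultimately show ?thesis by (simp add: q_eq)
qed

lemma stieltjes_cnj: "S (cnj z) = cnj (S z)"
proof -
  have "1 / (complex_of_real x - cnj z) = cnj (1 / (of_real x - z))" for x by simp
  then show ?thesis unfolding stieltjes_def by (simp only: Bochner_Integration.integral_cnj)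
qed

lemma fc_cnj: "fc k (cnj z) = cnj (fc k z)"
  by (simp add: fc_def p_cnj q_cnj stieltjes_cnj)

lemma stieltjes_diff:
  assumes "Im z \<noteq> 0" "Im w \<noteq> 0"
  shows "S z - S w = (z - w) * (LINT x|\<mu>. 1 / (of_real x - z) * (1 / (of_real x - w)))"
proof -
  have "S z - S w = (LINT x|\<mu>. 1 / (of_real x - z) - 1 / (of_real x - w))"
    unfolding stieltjes_def using integrable_resolvent assms by simp
  also have "\<dots> = (LINT x|\<mu>. (z - w) * (1 / (of_real x - z) * (1 / (of_real x - w))))"
    using of_real_minus_nonzero[OF assms(1)] of_real_minus_nonzero[OF assms(2)]
    by (intro Bochner_Integration.integral_cong refl) (simp add: divide_simps)
  also have "\<dots> = (z - w) * (LINT x|\<mu>. 1 / (of_real x - z) * (1 / (of_real x - w)))"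
    by (rule integral_mult_right_zero)
  finally show ?thesis .
qed

definition rnorm :: "complex \<Rightarrow> real" where
  "rnorm z = (LINT x|\<mu>. (cmod (1 / (of_real x - z)))\<^sup>2)"

lemma stieltjes_diff_cnj:
  assumes "Im z \<noteq> 0"
  shows "S z - S (cnj z) = (z - cnj z) * of_real (rnorm z)"
proof -
  have "1 / (of_real x - z) * (1 / (of_real x - cnj z)) = complex_of_real ((cmod (1 / (of_real x - z)))\<^sup>2)" for x
    unfolding complex_norm_square by simp
  then have "(LINT x|\<mu>. 1 / (of_real x - z) * (1 / (of_real x - cnj z))) = of_real (rnorm z)"
    unfolding rnorm_def by (simp only: integral_complex_of_real)
  then show ?thesis using stieltjes_diff[of z "cnj z"] assms by simp
qed

lemma rnorm_pos:
  assumes "Im z \<noteq> 0"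
  shows "rnorm z > 0"
proof -
  have "rnorm z \<noteq> 0"
  proof
    assume "rnorm z = 0"
    then have "AE x in \<mu>. (cmod (1 / (of_real x - z)))\<^sup>2 = 0"
      unfolding rnorm_def by (subst (asm) integral_nonneg_eq_0_iff_AE[OF integrable_resolvent_sq[OF assms]]) auto
    then have "AE x in \<mu>. poly (1::real poly) x = 0"
      by eventually_elim (use of_real_minus_nonzero[OF assms] in auto)
    then show False using poly_AE_0_imp_0 one_neq_zero by blast
  qed
  moreover have "rnorm z \<ge> 0" unfolding rnorm_def by simp
  ultimately show ?thesis by simp
qed

text \<open>By \<open>stieltjes_diff_cnj\<close>, Im (S z) is Im z times a positive number. This is
  needed because x / 0 = 0 could otherwise make \<open>nev_transform\<close> agree with S at a zero
  denominator.\<close>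

lemma stieltjes_nonzero:
  assumes "Im z \<noteq> 0"
  shows "S z \<noteq> 0"
proof
  assume "S z = 0"
  then have "(z - cnj z) * of_real (rnorm z) = 0"
    using stieltjes_diff_cnj[OF assms] by (simp add: stieltjes_cnj)
  then show False using rnorm_pos[OF assms] assms by (auto simp: complex_eq_iff)
qed

text \<open>One inequality is Bessel; for the other, replacing the coefficients of an approximant by
  \<open>fc\<close> can only lower its distance.\<close>

lemma fc_square_sums:
  assumes "resolvent_approx \<mu>" "Im z \<noteq> 0"
  shows "(\<lambda>k. (cmod (fc k z))\<^sup>2) sums rnorm z"
proof -
  note sm = summable_fc[OF assms(2)]
  have "(\<Sum>k. (cmod (fc k z))\<^sup>2) = rnorm z"
  proof (rule antisym)
    show "(\<Sum>k. (cmod (fc k z))\<^sup>2) \<le> rnorm z"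
      unfolding rnorm_def using bessel[OF assms(2)] by (intro suminf_le_const sm)
    show "rnorm z \<le> (\<Sum>k. (cmod (fc k z))\<^sup>2)"
    proof (rule field_le_epsilon)
      fix e :: real assume "e > 0"
      then obtain r where r: "(LINT x|\<mu>. (cmod (1 / (of_real x - z) - poly r (of_real x)))\<^sup>2) < e"
        using assms unfolding resolvent_approx_def by blast
      obtain n a where ra: "r = lincomb n a" using lincomb_exists by blast
      have "0 \<le> (\<Sum>k<n. (cmod (fc k z - a k))\<^sup>2)" by (intro sum_nonneg) simp
      then have "rnorm z - (\<Sum>k<n. (cmod (fc k z))\<^sup>2) < e"
        using r unfolding ra resolvent_lincomb_distance[OF assms(2)] rnorm_def by linarith
      moreover have "(\<Sum>k<n. (cmod (fc k z))\<^sup>2) \<le> (\<Sum>k. (cmod (fc k z))\<^sup>2)"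
        by (intro sum_le_suminf sm) auto
      ultimately show "rnorm z \<le> (\<Sum>k. (cmod (fc k z))\<^sup>2) + e" by simp
    qed
  qed
  then show ?thesis using summable_sums[OF sm] by simp
qed

lemma resolvent_approxI:
  assumes "\<And>z. Im z \<noteq> 0 \<Longrightarrow> (\<Sum>k. (cmod (fc k z))\<^sup>2) = rnorm z"
  shows "resolvent_approx \<mu>"
  unfolding resolvent_approx_def
proof (intro allI impI)
  fix z :: complex and e :: real assume z: "Im z \<noteq> 0" and e: "e > 0"
  have "(\<lambda>n. \<Sum>k<n. (cmod (fc k z))\<^sup>2) \<longlonglongrightarrow> rnorm z"
    using summable_LIMSEQ[OF summable_fc[OF z]] assms[OF z] by simp
  then have "\<forall>\<^sub>F n in sequentially. (\<Sum>k<n. (cmod (fc k z))\<^sup>2) > rnorm z - e"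
    using e by (intro order_tendstoD(1)) auto
  then obtain n where "(\<Sum>k<n. (cmod (fc k z))\<^sup>2) > rnorm z - e"
    by (metis eventually_happens trivial_limit_sequentially)
  then have "(LINT x|\<mu>. (cmod (1 / (of_real x - z) - poly (lincomb n (\<lambda>k. fc k z)) (of_real x)))\<^sup>2) < e"
    unfolding resolvent_lincomb_distance[OF z] rnorm_def by simp
  then show "\<exists>r. (LINT x|\<mu>. (cmod (1 / (of_real x - z) - poly r (of_real x)))\<^sup>2) < e" by blast
qed

text \<open>Replace 1 / (x - z) by its partial Fourier sum and integrate against the bounded
  function 1 / (x - w). The error is controlled by the distance e n, which tends to 0.\<close>

lemma parseval:
  assumes ra: "resolvent_approx \<mu>" and z: "Im z \<noteq> 0" and w: "Im w \<noteq> 0"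
  shows "(\<lambda>k. fc k z * fc k w) sums (LINT x|\<mu>. 1 / (of_real x - z) * (1 / (of_real x - w)))"
proof -
  let ?I = "LINT x|\<mu>. 1 / (of_real x - z) * (1 / (of_real x - w))"
  let ?d = "\<lambda>n x. 1 / (complex_of_real x - z) - poly (lincomb n (\<lambda>k. fc k z)) (of_real x)"
  define e where "e n = rnorm z - (\<Sum>k<n. (cmod (fc k z))\<^sup>2)" for n
  have e: "e n = (LINT x|\<mu>. (cmod (?d n x))\<^sup>2)" for n
    unfolding e_def resolvent_lincomb_distance[OF z] rnorm_def by simp
  have "e \<longlonglongrightarrow> rnorm z - rnorm z"
    unfolding e_def using fc_square_sums[OF ra z] by (intro tendsto_intros) (simp add: sums_def)
  then have e0: "(\<lambda>n. measure \<mu> UNIV * e n / (Im w)\<^sup>2) \<longlonglongrightarrow> measure \<mu> UNIV * 0 / (Im w)\<^sup>2"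
    using w by (intro tendsto_intros) auto
  have bound: "(cmod ((\<Sum>k<n. fc k z * fc k w) - ?I))\<^sup>2 \<le> measure \<mu> UNIV * e n / (Im w)\<^sup>2" for n
  proof -
    let ?r = "lincomb n (\<lambda>k. fc k z)"
    have i1: "integrable \<mu> (\<lambda>x. 1 / (of_real x - z) * (1 / (of_real x - w)))"
    proof (rule Bochner_Integration.integrable_bound)
      show "integrable \<mu> (\<lambda>x. (1 / (of_real x - z)) * complex_of_real (1 / \<bar>Im w\<bar>))"
        using integrable_resolvent[OF z] by (intro integrable_mult_left) auto
      show "AE x in \<mu>. norm (1 / (of_real x - z) * (1 / (of_real x - w)))
          \<le> norm (1 / (of_real x - z) * complex_of_real (1 / \<bar>Im w\<bar>))"
        unfolding norm_mult using cmod_resolvent_le[OF w] by (intro AE_I2 mult_left_mono) (auto simp: norm_divide)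
    qed measurable
    have i2: "integrable \<mu> (\<lambda>x. poly ?r (of_real x) / (of_real x - w))"
      by (rule integrable_resolvent_mult_poly[OF w])
    have "(LINT x|\<mu>. poly ?r (of_real x) / (of_real x - w))
        = (LINT x|\<mu>. (\<Sum>k<n. fc k z * (poly (Pc k) (of_real x) / (of_real x - w))))"
      by (simp add: poly_lincomb sum_divide_distrib)
    also have "\<dots> = (\<Sum>k<n. fc k z * fc k w)"
      by (subst Bochner_Integration.integral_sum)
        (auto simp: fc_eq[OF w] simp del: times_divide_eq_right intro!: integrable_mult_right integrable_resolvent_mult_poly w)
    finally have c: "(LINT x|\<mu>. poly ?r (of_real x) / (of_real x - w)) = (\<Sum>k<n. fc k z * fc k w)" .
    have pw: "?d n x * (1 / (of_real x - w)) = 1 / (of_real x - z) * (1 / (of_real x - w)) - poly ?r (of_real x) / (of_real x - w)" for x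
      unfolding left_diff_distrib by simp
    have "?I - (\<Sum>k<n. fc k z * fc k w) = (LINT x|\<mu>. ?d n x * (1 / (of_real x - w)))"
      unfolding pw Bochner_Integration.integral_diff[OF i1 i2] c ..
    also have "cmod \<dots> \<le> (LINT x|\<mu>. cmod (?d n x) / \<bar>Im w\<bar>)"
    proof (rule norm_integral_le_integral)
      have id: "integrable \<mu> (\<lambda>x. cmod (?d n x))"
        using integrable_resolvent[OF z] integrable_poly by (intro integrable_norm Bochner_Integration.integrable_diff)
      then show "integrable \<mu> (\<lambda>x. cmod (?d n x) / \<bar>Im w\<bar>)" by simp
      show "integrable \<mu> (\<lambda>x. ?d n x * (1 / (of_real x - w)))"
        unfolding pw by (rule Bochner_Integration.integrable_diff[OF i1 i2])
      show "cmod (?d n x * (1 / (of_real x - w))) \<le> cmod (?d n x) / \<bar>Im w\<bar>" for x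
        using mult_left_mono[OF cmod_resolvent_le[OF w, of x], of "cmod (?d n x)"] unfolding norm_mult by simp
    qed
    finally have "cmod (?I - (\<Sum>k<n. fc k z * fc k w)) \<le> (LINT x|\<mu>. cmod (?d n x)) / \<bar>Im w\<bar>" by simp
    then have "(cmod ((\<Sum>k<n. fc k z * fc k w) - ?I))\<^sup>2 \<le> ((LINT x|\<mu>. cmod (?d n x)) / \<bar>Im w\<bar>)\<^sup>2"
      by (intro power_mono) (simp_all add: norm_minus_commute)
    also have "\<dots> = (LINT x|\<mu>. cmod (?d n x))\<^sup>2 / (Im w)\<^sup>2" by (simp add: power_divide)
    also have "\<dots> \<le> measure \<mu> UNIV * e n / (Im w)\<^sup>2"
      unfolding e using integrable_resolvent[OF z] integrable_poly integrable_resolvent_diff_sq[OF z] square_integral_le[of "\<lambda>x. cmod (?d n x)"]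
      by (intro divide_right_mono) auto
    finally show ?thesis .
  qed
  have "(\<lambda>n. (cmod ((\<Sum>k<n. fc k z * fc k w) - ?I))\<^sup>2) \<longlonglongrightarrow> 0"
    by (rule tendsto_sandwich[OF _ _ tendsto_const]) (use e0 bound in auto)
  then have "(\<lambda>n. sqrt ((cmod ((\<Sum>k<n. fc k z * fc k w) - ?I))\<^sup>2)) \<longlonglongrightarrow> sqrt 0"
    by (rule tendsto_real_sqrt)
  then have "(\<lambda>n. cmod ((\<Sum>k<n. fc k z * fc k w) - ?I)) \<longlonglongrightarrow> 0" by simp
  then show ?thesis
    unfolding sums_def by (rule LIM_zero_cancel[OF tendsto_norm_zero_cancel])
qed

section \<open>The limiting transfer matrix and the Nevanlinna functions\<close>

definition T11 where "T11 z w = 1 - (z - w) * (\<Sum>k. p k z * q k w)"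
definition T12 where "T12 z w = (z - w) * (\<Sum>k. p k z * p k w)"
definition T21 where "T21 z w = - ((z - w) * (\<Sum>k. q k z * q k w))"
definition T22 where "T22 z w = 1 + (z - w) * (\<Sum>k. p k w * q k z)"

lemma transfer_tendsto:
  assumes limit_circle
  shows "(\<lambda>n. m11 (Suc n) z w) \<longlonglongrightarrow> T11 z w" "(\<lambda>n. m12 (Suc n) z w) \<longlonglongrightarrow> T12 z w"
    "(\<lambda>n. m21 (Suc n) z w) \<longlonglongrightarrow> T21 z w" "(\<lambda>n. m22 (Suc n) z w) \<longlonglongrightarrow> T22 z w"
proof -
  have lim: "(\<lambda>n. \<Sum>k<Suc n. f k * g k) \<longlonglongrightarrow> (\<Sum>k. f k * g k)"
    if "summable (\<lambda>k. (cmod (f k))\<^sup>2)" "summable (\<lambda>k. (cmod (g k))\<^sup>2)" for f g :: "nat \<Rightarrow> complex"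
    by (rule LIMSEQ_Suc[OF summable_LIMSEQ[OF summable_mult_of_squares[OF that]]])
  note l = lim[OF limit_circle_summable(1)[OF assms] limit_circle_summable(1)[OF assms]]
    lim[OF limit_circle_summable(1)[OF assms] limit_circle_summable(2)[OF assms]]
    lim[OF limit_circle_summable(2)[OF assms] limit_circle_summable(2)[OF assms]]
  show "(\<lambda>n. m11 (Suc n) z w) \<longlonglongrightarrow> T11 z w" "(\<lambda>n. m12 (Suc n) z w) \<longlonglongrightarrow> T12 z w"
    "(\<lambda>n. m21 (Suc n) z w) \<longlonglongrightarrow> T21 z w" "(\<lambda>n. m22 (Suc n) z w) \<longlonglongrightarrow> T22 z w"
    unfolding m11_def m12_def m21_def m22_def T11_def T12_def T21_def T22_def PP_def PQ_def QQ_def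
    by (intro tendsto_add tendsto_diff tendsto_minus tendsto_mult tendsto_const l)+
qed

lemma transfer_det:
  assumes limit_circle
  shows "T11 z w * T22 z w - T12 z w * T21 z w = 1"
proof (rule LIMSEQ_unique)
  show "(\<lambda>n. m11 (Suc n) z w * m22 (Suc n) z w - m12 (Suc n) z w * m21 (Suc n) z w)
      \<longlonglongrightarrow> T11 z w * T22 z w - T12 z w * T21 z w"
    by (intro tendsto_intros transfer_tendsto assms)
  show "(\<lambda>n. m11 (Suc n) z w * m22 (Suc n) z w - m12 (Suc n) z w * m21 (Suc n) z w) \<longlonglongrightarrow> 1"
    by (simp add: transfer_det_finite)
qed

lemma transfer_comp:
  assumes limit_circle
  shows "T11 z v = T11 z w * T11 w v + T12 z w * T21 w v" "T12 z v = T11 z w * T12 w v + T12 z w * T22 w v"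
    "T21 z v = T21 z w * T11 w v + T22 z w * T21 w v" "T22 z v = T21 z w * T12 w v + T22 z w * T22 w v"
proof -
  note t = transfer_tendsto[OF assms]
  show "T11 z v = T11 z w * T11 w v + T12 z w * T21 w v"
    by (rule LIMSEQ_unique[OF t(1)[of z v]])
      (subst transfer_comp_finite[of _ z w v, symmetric], intro tendsto_intros t)
  show "T12 z v = T11 z w * T12 w v + T12 z w * T22 w v"
    by (rule LIMSEQ_unique[OF t(2)[of z v]])
      (subst transfer_comp_finite[of _ z w v, symmetric], intro tendsto_intros t)
  show "T21 z v = T21 z w * T11 w v + T22 z w * T21 w v"
    by (rule LIMSEQ_unique[OF t(3)[of z v]])
      (subst transfer_comp_finite[of _ z w v, symmetric], intro tendsto_intros t)
  show "T22 z v = T21 z w * T12 w v + T22 z w * T22 w v"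
    by (rule LIMSEQ_unique[OF t(4)[of z v]])
      (subst transfer_comp_finite[of _ z w v, symmetric], intro tendsto_intros t)
qed

text \<open>\<open>(X z, Y z) = (S z, 1) T(z, 0)\<close>, a row vector.\<close>

definition X where "X z = S z * T11 z 0 + T21 z 0"
definition Y where "Y z = S z * T12 z 0 + T22 z 0"

text \<open>The row (S z, 1) is nonzero and T(z, 0) is invertible.\<close>

lemma XY_nonzero:
  assumes limit_circle
  shows "X z \<noteq> 0 \<or> Y z \<noteq> 0"
proof (rule ccontr)
  assume "\<not> ?thesis"
  then have "T21 z 0 = - S z * T11 z 0" "T22 z 0 = - S z * T12 z 0"
    by (auto simp: X_def Y_def add_eq_0_iff2)
  then show False using transfer_det[OF assms, of z 0] by simp
qed

lemma XY_cnj: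
  assumes limit_circle
  shows "X (cnj z) = cnj (X z)" "Y (cnj z) = cnj (Y z)"
proof -
  have real0: "p k 0 = cnj (p k 0)" "q k 0 = cnj (q k 0)" for k
    using p_cnj[of k 0] q_cnj[of k 0] by simp_all
  have sm: "summable (\<lambda>k. p k z * q k 0)" "summable (\<lambda>k. p k z * p k 0)"
    "summable (\<lambda>k. q k z * q k 0)" "summable (\<lambda>k. p k 0 * q k z)"
    by (intro summable_mult_of_squares limit_circle_summable assms)+
  have "(\<Sum>k. p k (cnj z) * q k 0) = cnj (\<Sum>k. p k z * q k 0)"
    "(\<Sum>k. p k (cnj z) * p k 0) = cnj (\<Sum>k. p k z * p k 0)"
    "(\<Sum>k. q k (cnj z) * q k 0) = cnj (\<Sum>k. q k z * q k 0)"
    "(\<Sum>k. p k 0 * q k (cnj z)) = cnj (\<Sum>k. p k 0 * q k z)"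
    using real0 by (simp_all flip: suminf_cnj[OF sm(1)] suminf_cnj[OF sm(2)] suminf_cnj[OF sm(3)] suminf_cnj[OF sm(4)]
        add: p_cnj q_cnj)
  then show "X (cnj z) = cnj (X z)" "Y (cnj z) = cnj (Y z)"
    by (simp_all add: X_def Y_def T11_def T12_def T21_def T22_def stieltjes_cnj)
qed

text \<open>The bridge between the two notions: the right side is (z - w) times the defect in
  Parseval's equality for the resolvents at z and w, the left side tests proportionality of two
  rows.\<close>

lemma XY_wronskian:
  assumes limit_circle
  shows "X z * Y w - Y z * X w = S z - S w - (z - w) * (\<Sum>k. fc k z * fc k w)"
proof -
  \<comment> \<open>(u, v) is the row (S z, 1) T(z, w). Both rows then continue by the same matrix
    T(w, 0) of determinant 1, so the base point 0 drops out.\<close>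
  define u where "u = S z * T11 z w + T21 z w"
  define v where "v = S z * T12 z w + T22 z w"
  have z: "X z = u * T11 w 0 + v * T21 w 0" "Y z = u * T12 w 0 + v * T22 w 0"
    unfolding X_def Y_def u_def v_def transfer_comp[OF assms, of z 0 w] by (simp_all add: algebra_simps)
  have "X z * Y w - Y z * X w = (u - v * S w) * (T11 w 0 * T22 w 0 - T12 w 0 * T21 w 0)"
    unfolding z X_def[of w] Y_def[of w] by (simp add: algebra_simps)
  also have "\<dots> = u - v * S w" by (simp add: transfer_det[OF assms])
  also have "(\<lambda>k. fc k z * fc k w) sums
      (S z * S w * (\<Sum>k. p k z * p k w) + S z * (\<Sum>k. p k z * q k w) + S w * (\<Sum>k. p k w * q k z) + (\<Sum>k. q k z * q k w))"
  proof -
    have "(\<lambda>k. S z * S w * (p k z * p k w) + S z * (p k z * q k w) + S w * (p k w * q k z) + q k z * q k w) sums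
      (S z * S w * (\<Sum>k. p k z * p k w) + S z * (\<Sum>k. p k z * q k w) + S w * (\<Sum>k. p k w * q k z) + (\<Sum>k. q k z * q k w))"
      by (intro sums_add sums_mult summable_sums summable_mult_of_squares limit_circle_summable assms)
    then show ?thesis by (simp add: fc_def algebra_simps)
  qed
  then have "u - v * S w = S z - S w - (z - w) * (\<Sum>k. fc k z * fc k w)"
    by (simp add: sums_iff u_def v_def T11_def T12_def T21_def T22_def algebra_simps)
  finally show ?thesis .
qed

text \<open>With these signs \<open>transfer_det\<close> at w = 0 becomes the classical AD - BC =
  1.\<close>

lemma nev_eq:
  "nevA \<mu> z = - T21 z 0" "nevB \<mu> z = - T11 z 0" "nevC \<mu> z = T22 z 0" "nevD \<mu> z = T12 z 0"
proof -
  have "(\<Sum>k. q k 0 * q k z) = (\<Sum>k. q k z * q k 0)" "(\<Sum>k. q k 0 * p k z) = (\<Sum>k. p k z * q k 0)"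
    "(\<Sum>k. p k 0 * p k z) = (\<Sum>k. p k z * p k 0)"
    by (intro arg_cong[where f = suminf] ext mult.commute)+
  then show "nevA \<mu> z = - T21 z 0" "nevB \<mu> z = - T11 z 0" "nevC \<mu> z = T22 z 0" "nevD \<mu> z = T12 z 0"
    by (simp_all add: nevA_def nevB_def nevC_def nevD_def T11_def T12_def T21_def T22_def)
qed

lemma nev_transform_Some_iff:
  assumes limit_circle "Im z \<noteq> 0"
  shows "S z = nev_transform \<mu> (Some t) z \<longleftrightarrow> X z * of_real t + Y z = 0"
proof -
  define n where "n = T21 z 0 * of_real t + T22 z 0"
  define d where "d = T11 z 0 * of_real t + T12 z 0"
  have tr: "nev_transform \<mu> (Some t) z = - n / d"
  proof -
    have "nev_transform \<mu> (Some t) z = - (- n) / (- d)"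
      by (simp add: nev_eq n_def d_def algebra_simps)
    then show ?thesis by simp
  qed
  have xy: "X z * of_real t + Y z = S z * d + n"
    by (simp add: X_def Y_def n_def d_def algebra_simps)
  have det: "T11 z 0 * n - T21 z 0 * d = 1"
    using transfer_det[OF assms(1), of z 0] by (simp add: n_def d_def algebra_simps)
  show ?thesis
  proof
    assume "S z = nev_transform \<mu> (Some t) z"
    then have s: "S z = - n / d" by (simp only: tr)
    \<comment> \<open>For d = 0 the quotient would be 0 by convention, a value S z never
      takes.\<close>
    then have "d \<noteq> 0" using stieltjes_nonzero[OF assms(2)] by auto
    then show "X z * of_real t + Y z = 0" unfolding xy s by simp
  next
    assume "X z * of_real t + Y z = 0"
    then have *: "S z * d + n = 0" by (simp only: xy)
    have "d \<noteq> 0" using det * by auto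
    then show "S z = nev_transform \<mu> (Some t) z"
      unfolding tr using * by (simp add: field_simps add_eq_0_iff)
  qed
qed

lemma nev_transform_None_iff:
  assumes limit_circle "Im z \<noteq> 0"
  shows "S z = nev_transform \<mu> None z \<longleftrightarrow> X z = 0"
proof
  assume "S z = nev_transform \<mu> None z"
  then have s: "S z = - T21 z 0 / T11 z 0" by (simp add: nev_eq)
  then have "T11 z 0 \<noteq> 0" using stieltjes_nonzero[OF assms(2)] by auto
  then show "X z = 0" unfolding X_def s by simp
next
  assume x: "X z = 0"
  have "T11 z 0 \<noteq> 0"
  proof
    assume "T11 z 0 = 0"
    then show False using x transfer_det[OF assms(1), of z 0] by (simp add: X_def)
  qed
  then show "S z = nev_transform \<mu> None z"
    using x by (simp add: nev_eq X_def field_simps add_eq_0_iff)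
qed

text \<open>By \<open>XY_wronskian\<close>, proportional rows at z and w amount to Parseval's
  equality for that pair, or z = w. The pair z, \<open>cnj z\<close> gives approximability; the
  converse compares every z with the reference point \<i>.\<close>

theorem nevanlinna_constant_iff_resolvent_approx:
  assumes lc: limit_circle
  shows "(\<exists>t. \<forall>z. Im z \<noteq> 0 \<longrightarrow> S z = nev_transform \<mu> t z) \<longleftrightarrow> resolvent_approx \<mu>"
proof
  assume "\<exists>t. \<forall>z. Im z \<noteq> 0 \<longrightarrow> S z = nev_transform \<mu> t z"
  then obtain t where t: "\<And>z. Im z \<noteq> 0 \<Longrightarrow> S z = nev_transform \<mu> t z" by blast
  have par: "X z * Y (cnj z) = Y z * X (cnj z)" if z: "Im z \<noteq> 0" for z
  proof (cases t)
    case None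
    then have "X z = 0" using t[OF z] nev_transform_None_iff[OF lc z] by simp
    then show ?thesis by (simp add: XY_cnj[OF lc])
  next
    case (Some s)
    then have "Y z = - X z * of_real s"
      using t[OF z] nev_transform_Some_iff[OF lc z, of s] by (simp add: add_eq_0_iff)
    then show ?thesis by (simp add: XY_cnj[OF lc])
  qed
  show "resolvent_approx \<mu>"
  proof (rule resolvent_approxI)
    fix z assume z: "Im z \<noteq> 0"
    have nz: "z - cnj z \<noteq> 0" using z by (simp add: complex_eq_iff)
    have "S z - S (cnj z) = (z - cnj z) * (\<Sum>k. fc k z * fc k (cnj z))"
      using XY_wronskian[OF lc, of z "cnj z", unfolded par[OF z] diff_self] by (metis eq_iff_diff_eq_0)
    then have "(z - cnj z) * (\<Sum>k. fc k z * fc k (cnj z)) = (z - cnj z) * of_real (rnorm z)"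
      using stieltjes_diff_cnj[OF z] by metis
    then have "(\<Sum>k. fc k z * cnj (fc k z)) = of_real (rnorm z)" using nz by (simp add: fc_cnj)
    then have "(\<Sum>k. complex_of_real ((cmod (fc k z))\<^sup>2)) = of_real (rnorm z)"
      by (simp only: complex_norm_square)
    then show "(\<Sum>k. (cmod (fc k z))\<^sup>2) = rnorm z"
      using suminf_of_real[OF summable_fc[OF z], where 'a = complex] by (simp only: of_real_eq_iff)
  qed
next
  assume ra: "resolvent_approx \<mu>"
  have par: "X z * Y w = Y z * X w" if "Im z \<noteq> 0" "Im w \<noteq> 0" for z w
    using XY_wronskian[OF lc, of z w] parseval[OF ra that] stieltjes_diff[OF that] by (simp add: sums_iff)
  show "\<exists>t. \<forall>z. Im z \<noteq> 0 \<longrightarrow> S z = nev_transform \<mu> t z"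
  proof (cases "X \<i> = 0")
    \<comment> \<open>This is the infinite parameter: Y \<i> is then nonzero, so proportionality
      forces X z = 0 at every non-real z.\<close>
    case True
    then have "X z = 0" if "Im z \<noteq> 0" for z
      using par[OF that, of \<i>] XY_nonzero[OF lc, of \<i>] by auto
    then have "S z = nev_transform \<mu> None z" if "Im z \<noteq> 0" for z
      using nev_transform_None_iff[OF lc that] that by simp
    then show ?thesis by blast
  next
    case False
    \<comment> \<open>The parameter read off at \<i>; it is real because the rows at \<i> and its
      conjugate are proportional as well.\<close>
    define s where "s = - (Y \<i> / X \<i>)"
    have "cnj (X \<i>) * Y \<i> = cnj (Y \<i>) * X \<i>"
      using par[of "cnj \<i>" \<i>] unfolding XY_cnj[OF lc] by simp
    then have "cnj s = s" using False by (simp add: s_def field_simps)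
    then have s: "of_real (Re s) = s" by (simp add: complex_eq_iff)
    have "X z * of_real (Re s) + Y z = 0" if "Im z \<noteq> 0" for z
      using par[OF that, of \<i>] False unfolding s by (simp add: s_def field_simps)
    then have "S z = nev_transform \<mu> (Some (Re s)) z" if "Im z \<noteq> 0" for z
      using nev_transform_Some_iff[OF lc that] that by simp
    then show ?thesis by blast
  qed
qed

end

section \<open>Weighted measures and Riesz' theorem\<close>

lemma resolvent_approx_mono:
  assumes "resolvent_approx \<mu>" "B \<ge> 0"
    and "\<And>z r. Im z \<noteq> 0 \<Longrightarrow> (LINT x|\<nu>. (cmod (1 / (of_real x - z) - poly r (of_real x)))\<^sup>2)
      \<le> B * (LINT x|\<mu>. (cmod (1 / (of_real x - z) - poly r (of_real x)))\<^sup>2)"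
  shows "resolvent_approx \<nu>"
  unfolding resolvent_approx_def
proof (intro allI impI)
  fix z :: complex and e :: real assume z: "Im z \<noteq> 0" and e: "e > 0"
  then have "e / (B + 1) > 0" using assms(2) by simp
  then obtain r where r: "(LINT x|\<mu>. (cmod (1 / (of_real x - z) - poly r (of_real x)))\<^sup>2) < e / (B + 1)"
    using assms(1) z unfolding resolvent_approx_def by blast
  have "(LINT x|\<nu>. (cmod (1 / (of_real x - z) - poly r (of_real x)))\<^sup>2) \<le> B * (e / (B + 1))"
    using r assms(2) by (intro order_trans[OF assms(3)[OF z]] mult_left_mono) auto
  also have "\<dots> < e" using e assms(2) by (simp add: field_simps)
  finally show "\<exists>r. (LINT x|\<nu>. (cmod (1 / (of_real x - z) - poly r (of_real x)))\<^sup>2) < e" by blast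
qed

section \<open>The family of weighted measures\<close>

lemma borel_measurable_weight [measurable]: "(\<lambda>x::real. (1 + x\<^sup>2) powr \<gamma>) \<in> borel_measurable borel"
  by measurable

lemma one_plus_square_pos: "(1 + x\<^sup>2 :: real) > 0"
  by (intro add_pos_nonneg) auto

lemma sets_weighted [simp]: "sets (weighted \<gamma> \<mu>) = sets \<mu>"
  by (simp add: weighted_def)

lemma weighted_weighted:
  assumes "sets \<mu> = sets borel"
  shows "weighted \<alpha> (weighted \<beta> \<mu>) = weighted (\<alpha> + \<beta>) \<mu>"
proof -
  note assms[measurable_cong]
  have "weighted \<alpha> (weighted \<beta> \<mu>) = density \<mu> (\<lambda>x. ennreal ((1 + x\<^sup>2) powr \<beta>) * ennreal ((1 + x\<^sup>2) powr \<alpha>))"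
    unfolding weighted_def by (rule density_density_eq) measurable
  also have "(\<lambda>x. ennreal ((1 + x\<^sup>2) powr \<beta>) * ennreal ((1 + x\<^sup>2) powr \<alpha>)) = (\<lambda>x::real. ennreal ((1 + x\<^sup>2) powr (\<alpha> + \<beta>)))"
    by (intro ext) (simp add: ennreal_mult[symmetric] powr_add mult.commute)
  finally show ?thesis by (simp add: weighted_def)
qed

lemma weighted_0 [simp]: "weighted 0 \<mu> = \<mu>"
proof -
  have "(1 + x\<^sup>2) powr 0 = 1" for x :: real using one_plus_square_pos[of x] by simp
  then show ?thesis unfolding weighted_def by (simp add: density_1)
qed

lemma integral_weighted:
  fixes f :: "real \<Rightarrow> real"
  assumes "sets \<mu> = sets borel" "f \<in> borel_measurable borel"
  shows "(LINT x|weighted \<gamma> \<mu>. f x) = (LINT x|\<mu>. (1 + x\<^sup>2) powr \<gamma> * f x)"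
proof -
  note assms(1)[measurable_cong] assms(2)[measurable]
  show ?thesis unfolding weighted_def by (subst integral_density) auto
qed

text \<open>One half of the comparability of 1 + x^2 and |x - z|^2. The constant comes from x = (x -
  z) + z together with |x - z| \<ge> |Im z|.\<close>

lemma one_plus_square_le:
  assumes "Im z \<noteq> 0"
  shows "1 + x\<^sup>2 \<le> (2 + (1 + 2 * (cmod z)\<^sup>2) / (Im z)\<^sup>2) * (cmod (of_real x - z))\<^sup>2"
proof -
  have "x\<^sup>2 = (cmod ((of_real x - z) + z))\<^sup>2" by simp
  also have "\<dots> \<le> 2 * (cmod (of_real x - z))\<^sup>2 + 2 * (cmod z)\<^sup>2" by (rule cmod_add_square_le)
  finally have 1: "x\<^sup>2 \<le> 2 * (cmod (of_real x - z))\<^sup>2 + 2 * (cmod z)\<^sup>2" .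
  have "(Im z)\<^sup>2 \<le> (cmod (of_real x - z))\<^sup>2"
    using abs_Im_le_cmod[of "of_real x - z"] by (simp add: abs_le_square_iff[symmetric])
  then have "(1 + 2 * (cmod z)\<^sup>2) / (Im z)\<^sup>2 * (Im z)\<^sup>2 \<le> (1 + 2 * (cmod z)\<^sup>2) / (Im z)\<^sup>2 * (cmod (of_real x - z))\<^sup>2"
    by (intro mult_left_mono) auto
  then have "1 + 2 * (cmod z)\<^sup>2 \<le> (1 + 2 * (cmod z)\<^sup>2) / (Im z)\<^sup>2 * (cmod (of_real x - z))\<^sup>2" using assms by simp
  with 1 show ?thesis by (simp add: distrib_right)
qed

lemma cmod_square_le_one_plus_square:
  "(cmod (of_real x - z))\<^sup>2 \<le> (2 + 2 * (cmod z)\<^sup>2) * (1 + x\<^sup>2)"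
proof -
  have "(cmod (of_real x - z))\<^sup>2 \<le> 2 * x\<^sup>2 + 2 * (cmod z)\<^sup>2"
    using cmod_diff_square_le[of "of_real x" z] by simp
  also have "\<dots> \<le> (2 + 2 * (cmod z)\<^sup>2) * (1 + x\<^sup>2)"
    by (simp add: algebra_simps)
  finally show ?thesis .
qed

text \<open>A dictionary: approximating 1 / (x - z) by u in the weight |x - z|^2, equivalent to 1 +
  x^2, is making 1 - (x - z) u small without weight.\<close>

lemma resolvent_remainder:
  assumes "Im z \<noteq> 0"
  shows "(cmod (1 - (of_real x - z) * u))\<^sup>2 = (cmod (of_real x - z))\<^sup>2 * (cmod (1 / (of_real x - z) - u))\<^sup>2"
proof -
  have "1 - (of_real x - z) * u = (of_real x - z) * (1 / (of_real x - z) - u)"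
    using of_real_minus_nonzero[OF assms, of x] by (simp add: right_diff_distrib)
  then show ?thesis by (simp only: norm_mult power_mult_distrib)
qed

context Mstar_measure
begin

lemma integrable_power_weight: "integrable \<mu> (\<lambda>x. (1 + x\<^sup>2) powr \<gamma> * x ^ n)"
proof -
  obtain k :: nat where k: "\<gamma> \<le> real k" using real_arch_simple by blast
  show ?thesis
  proof (rule Bochner_Integration.integrable_bound)
    show "integrable \<mu> (\<lambda>x. poly ([:1, 0, 1:] ^ k * monom 1 n) x)" by (rule integrable_poly_real)
    show "AE x in \<mu>. norm ((1 + x\<^sup>2) powr \<gamma> * x ^ n) \<le> norm (poly ([:1, 0, 1:] ^ k * monom 1 n) x)"
    proof (rule AE_I2)
      fix x
      have "(1 + x\<^sup>2) powr \<gamma> \<le> (1 + x\<^sup>2) powr (real k)"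
        using k by (intro powr_mono) auto
      also have "\<dots> = (1 + x\<^sup>2) ^ k" using one_plus_square_pos[of x] by (simp add: powr_realpow)
      also have "\<dots> = poly [:1, 0, 1:] x ^ k" by (simp add: power2_eq_square)
      finally have "(1 + x\<^sup>2) powr \<gamma> \<le> \<bar>poly [:1, 0, 1:] x ^ k\<bar>" by simp
      then have "(1 + x\<^sup>2) powr \<gamma> * \<bar>x ^ n\<bar> \<le> \<bar>poly [:1, 0, 1:] x ^ k\<bar> * \<bar>x ^ n\<bar>"
        by (rule mult_right_mono) simp
      then show "norm ((1 + x\<^sup>2) powr \<gamma> * x ^ n) \<le> norm (poly ([:1, 0, 1:] ^ k * monom 1 n) x)"
        by (simp add: abs_mult poly_monom)
    qed
  qed measurable
qed

text \<open>The weight is positive everywhere, so no ball becomes null, and it is dominated by a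
  polynomial, so the moments stay finite.\<close>

lemma weighted_Mstar: "weighted \<gamma> \<mu> \<in> Mstar"
proof -
  have "measure_support \<mu> \<subseteq> measure_support (weighted \<gamma> \<mu>)"
  proof
    fix x assume x: "x \<in> measure_support \<mu>"
    have "emeasure (weighted \<gamma> \<mu>) (ball x e) > 0" if e: "e > 0" for e
    proof -
      have "emeasure (weighted \<gamma> \<mu>) (ball x e) \<noteq> 0"
      proof
        assume "emeasure (weighted \<gamma> \<mu>) (ball x e) = 0"
        then have "ball x e \<in> null_sets (weighted \<gamma> \<mu>)" by (simp add: null_sets_def)
        then have "AE y in \<mu>. y \<in> ball x e \<longrightarrow> ennreal ((1 + y\<^sup>2) powr \<gamma>) = 0"
          unfolding weighted_def by (subst (asm) null_sets_density_iff) auto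
        then have "AE y in \<mu>. y \<notin> ball x e"
          by eventually_elim (use one_plus_square_pos in \<open>auto simp: ennreal_eq_0_iff powr_nonneg_iff less_imp_neq[symmetric]\<close>)
        then have "ball x e \<in> null_sets \<mu>" by (subst (asm) AE_iff_null_sets[symmetric]) auto
        then show False using x e by (auto simp: measure_support_def null_sets_def)
      qed
      then show ?thesis by (simp add: zero_less_iff_neq_zero)
    qed
    then show "x \<in> measure_support (weighted \<gamma> \<mu>)" by (simp add: measure_support_def)
  qed
  then have "infinite (measure_support (weighted \<gamma> \<mu>))"
    using Mstar by (auto simp: Mstar_def dest: finite_subset)
  moreover have "integrable (weighted \<gamma> \<mu>) (\<lambda>x. x ^ n)" for n
    using integrable_power_weight[of \<gamma> n] unfolding weighted_def by (subst integrable_density) auto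
  ultimately show ?thesis by (simp add: Mstar_def)
qed

lemma scaled_Mstar:
  assumes "c > 0"
  shows "density \<mu> (\<lambda>_. ennreal c) \<in> Mstar"
proof -
  have "emeasure (density \<mu> (\<lambda>_. ennreal c)) A = ennreal c * emeasure \<mu> A" if "A \<in> sets borel" for A
    using that by (subst emeasure_density) (auto simp: nn_integral_cmult_indicator)
  then have "measure_support (density \<mu> (\<lambda>_. ennreal c)) = measure_support \<mu>"
    using assms by (simp add: measure_support_def ennreal_zero_less_mult_iff)
  then show ?thesis
    using Mstar assms by (auto simp: Mstar_def intro!: integrable_scaled)
qed

lemma normalized_eq: "normalized \<mu> = density \<mu> (\<lambda>_. ennreal (1 / measure \<mu> UNIV))"
  using mass_pos by (simp add: normalized_def emeasure_eq_measure divide_ennreal[symmetric])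

text \<open>\<open>N_extremal\<close> refers to the normalized measure. Approximability and the
  evaluation bound behind \<open>limit_circle\<close> both survive rescaling by a constant.\<close>

lemma N_extremal_iff:
  assumes "\<not> determinate \<mu>"
  shows "N_extremal \<mu> \<longleftrightarrow> resolvent_approx \<mu>"
proof -
  define c where "c = 1 / measure \<mu> UNIV"
  have c: "c > 0" using mass_pos by (simp add: c_def)
  define \<nu> where "\<nu> = density \<mu> (\<lambda>_. ennreal c)"
  interpret n: Mstar_measure \<nu>
    unfolding \<nu>_def by unfold_locales (rule scaled_Mstar[OF c])
  have sc: "(LINT x|\<nu>. f x) = c * (LINT x|\<mu>. f x)" if "f \<in> borel_measurable borel" for f :: "real \<Rightarrow> real"
    unfolding \<nu>_def using c that by (subst integral_scaled) auto
  obtain z B where z: "Im z \<noteq> 0" "\<And>r. (cmod (poly r z))\<^sup>2 \<le> B * (LINT x|\<mu>. (cmod (poly r (of_real x)))\<^sup>2)"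
    using indeterminate_imp_eval_bound[OF assms] by blast
  have "(cmod (poly r z))\<^sup>2 \<le> (B / c) * (LINT x|\<nu>. (cmod (poly r (of_real x)))\<^sup>2)" for r
    using z(2)[of r] c by (subst sc) auto
  then have lc: "n.limit_circle" by (rule n.limit_circle_of_eval_bound[OF z(1)])
  have "resolvent_approx \<nu> \<longleftrightarrow> resolvent_approx \<mu>"
  proof
    assume "resolvent_approx \<nu>"
    then show "resolvent_approx \<mu>"
      by (rule resolvent_approx_mono[where B = "1 / c"]) (use c in \<open>auto simp: sc\<close>)
  next
    assume "resolvent_approx \<mu>"
    then show "resolvent_approx \<nu>"
      by (rule resolvent_approx_mono[where B = c]) (use c in \<open>auto simp: sc\<close>)
  qed
  then show ?thesis
    using n.nevanlinna_constant_iff_resolvent_approx[OF lc]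
    by (simp add: N_extremal_def normalized_eq \<nu>_def c_def)
qed

lemma weighted_measure: "Mstar_measure (weighted \<gamma> \<mu>)"
  by unfold_locales (rule weighted_Mstar)

lemma integral_weighted_mono:
  fixes f :: "real \<Rightarrow> real"
  assumes "\<alpha> \<le> \<beta>" "f \<in> borel_measurable borel" "\<And>x. f x \<ge> 0" "integrable (weighted \<beta> \<mu>) f"
  shows "(LINT x|weighted \<alpha> \<mu>. f x) \<le> (LINT x|weighted \<beta> \<mu>. f x)"
proof -
  note assms(2)[measurable]
  have i: "integrable \<mu> (\<lambda>x. (1 + x\<^sup>2) powr \<beta> * f x)"
    using assms(4) unfolding weighted_def by (subst (asm) integrable_density) auto
  have le: "(1 + x\<^sup>2) powr \<alpha> * f x \<le> (1 + x\<^sup>2) powr \<beta> * f x" for x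
    using assms(1,3) by (intro mult_right_mono powr_mono) auto
  have "integrable \<mu> (\<lambda>x. (1 + x\<^sup>2) powr \<alpha> * f x)"
    using le assms(3) by (intro Bochner_Integration.integrable_bound[OF i] AE_I2) (auto simp: abs_mult)
  then show ?thesis
    using i le by (simp add: integral_weighted assms(2) integral_mono)
qed

lemma indeterminate_weighted_mono:
  assumes "\<alpha> \<le> \<beta>" "\<not> determinate (weighted \<alpha> \<mu>)"
  shows "\<not> determinate (weighted \<beta> \<mu>)"
proof -
  interpret a: Mstar_measure "weighted \<alpha> \<mu>" by (rule weighted_measure)
  interpret b: Mstar_measure "weighted \<beta> \<mu>" by (rule weighted_measure)
  obtain z B where z: "Im z \<noteq> 0"
    "\<And>r. (cmod (poly r z))\<^sup>2 \<le> B * (LINT x|weighted \<alpha> \<mu>. (cmod (poly r (of_real x)))\<^sup>2)"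
    using a.indeterminate_imp_eval_bound[OF assms(2)] by blast
  have "(cmod (poly r z))\<^sup>2 \<le> \<bar>B\<bar> * (LINT x|weighted \<beta> \<mu>. (cmod (poly r (of_real x)))\<^sup>2)" for r
  proof -
    have "(LINT x|weighted \<alpha> \<mu>. (cmod (poly r (of_real x)))\<^sup>2) \<le> (LINT x|weighted \<beta> \<mu>. (cmod (poly r (of_real x)))\<^sup>2)"
      using assms(1) b.integrable_poly_sq by (intro integral_weighted_mono) auto
    then show ?thesis
      by (intro order_trans[OF z(2)] mult_mono) auto
  qed
  then have "b.limit_circle" by (rule b.limit_circle_of_eval_bound[OF z(1)])
  then show ?thesis by (simp add: b.indeterminate_iff_limit_circle)
qed

lemma resolvent_approx_weighted_mono:
  assumes "\<alpha> \<le> \<beta>" "resolvent_approx (weighted \<beta> \<mu>)"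
  shows "resolvent_approx (weighted \<alpha> \<mu>)"
proof -
  interpret b: Mstar_measure "weighted \<beta> \<mu>" by (rule weighted_measure)
  show ?thesis
    by (rule resolvent_approx_mono[OF assms(2), of 1])
      (use assms(1) b.integrable_resolvent_diff_sq in \<open>auto intro!: integral_weighted_mono\<close>)
qed

section \<open>Riesz' criterion for determinacy\<close>

lemma integrable_weighted_1_resolvent:
  assumes "Im z \<noteq> 0"
  shows "integrable \<mu> (\<lambda>x. (1 + x\<^sup>2) * (cmod (1 / (of_real x - z) - poly r (of_real x)))\<^sup>2)"
proof -
  interpret w: Mstar_measure "weighted 1 \<mu>" by (rule weighted_measure)
  have "integrable \<mu> (\<lambda>x. (1 + x\<^sup>2) powr 1 * (cmod (1 / (of_real x - z) - poly r (of_real x)))\<^sup>2)"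
    using w.integrable_resolvent_diff_sq[OF assms, of r] unfolding weighted_def
    by (subst (asm) integrable_density) auto
  then show ?thesis using one_plus_square_pos by (simp add: less_imp_le)
qed

lemma integral_weighted_1_resolvent:
  "(LINT x|weighted 1 \<mu>. (cmod (1 / (of_real x - z) - poly r (of_real x)))\<^sup>2)
    = (LINT x|\<mu>. (1 + x\<^sup>2) * (cmod (1 / (of_real x - z) - poly r (of_real x)))\<^sup>2)"
  using one_plus_square_pos by (subst integral_weighted) (auto simp: less_imp_le)

text \<open>If the resolvent at z keeps squared distance e from the polynomials, every s with s(z) =
  1 has squared norm at least e / C. By homogeneity evaluation at z is bounded, contradicting
  determinacy.\<close>

lemma determinate_imp_resolvent_approx:
  assumes det: "determinate \<mu>"
  shows "resolvent_approx (weighted 1 \<mu>)"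
proof (rule ccontr)
  assume "\<not> ?thesis"
  then obtain z e where z: "Im z \<noteq> 0" and e: "e > 0"
    and far: "\<And>r. (LINT x|weighted 1 \<mu>. (cmod (1 / (of_real x - z) - poly r (of_real x)))\<^sup>2) \<ge> e"
    unfolding resolvent_approx_def by (meson not_le)
  define C where "C = 2 + (1 + 2 * (cmod z)\<^sup>2) / (Im z)\<^sup>2"
  have C: "C > 0" unfolding C_def by (intro add_pos_nonneg divide_nonneg_nonneg) auto
  have one: "e \<le> C * (LINT x|\<mu>. (cmod (poly s (of_real x)))\<^sup>2)" if s: "poly s z = 1" for s
  proof -
    define r where "r = - synthetic_div s z"
    have sx: "poly s (of_real x) = 1 - (of_real x - z) * poly r (of_real x)" for x
      using poly_eq_synthetic_div[of s "of_real x" z] s by (simp add: r_def)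
    have "e \<le> (LINT x|\<mu>. (1 + x\<^sup>2) * (cmod (1 / (of_real x - z) - poly r (of_real x)))\<^sup>2)"
      using far[of r] by (simp only: integral_weighted_1_resolvent)
    also have "\<dots> \<le> (LINT x|\<mu>. C * (cmod (poly s (of_real x)))\<^sup>2)"
    proof (rule integral_mono[OF integrable_weighted_1_resolvent[OF z]])
      show "integrable \<mu> (\<lambda>x. C * (cmod (poly s (of_real x)))\<^sup>2)" using integrable_poly_sq by simp
      show "(1 + x\<^sup>2) * (cmod (1 / (of_real x - z) - poly r (of_real x)))\<^sup>2 \<le> C * (cmod (poly s (of_real x)))\<^sup>2" for x
        unfolding sx resolvent_remainder[OF z] mult.assoc[symmetric] C_def
        by (intro mult_right_mono one_plus_square_le[OF z]) auto
    qed
    finally show ?thesis by simp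
  qed
  have "(cmod (poly r z))\<^sup>2 \<le> (C / e) * (LINT x|\<mu>. (cmod (poly r (of_real x)))\<^sup>2)" for r
  proof (cases "poly r z = 0")
    case True
    then show ?thesis using C e by simp
  next
    case False
    define a where "a = (cmod (poly r z))\<^sup>2"
    have a: "a > 0" using False by (simp add: a_def)
    have "e \<le> C * (LINT x|\<mu>. (cmod (poly (smult (1 / poly r z) r) (of_real x)))\<^sup>2)"
      using False by (intro one) simp
    also have "(LINT x|\<mu>. (cmod (poly (smult (1 / poly r z) r) (of_real x)))\<^sup>2)
        = (LINT x|\<mu>. (cmod (poly r (of_real x)))\<^sup>2) / a"
      by (simp add: norm_mult norm_divide power_mult_distrib power_divide a_def)
    finally show ?thesis using a e unfolding a_def[symmetric] by (simp add: field_simps)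
  qed
  then have limit_circle by (rule limit_circle_of_eval_bound[OF z])
  then show False using limit_circle_imp_indeterminate det by blast
qed

text \<open>A good approximant r yields s = 1 - (x - z) r with s(z) = 1 and small norm, against the
  evaluation bound of an indeterminate measure.\<close>

lemma resolvent_approx_imp_determinate:
  assumes ra: "resolvent_approx (weighted 1 \<mu>)"
  shows "determinate \<mu>"
proof (rule ccontr)
  assume "\<not> determinate \<mu>"
  then obtain z B where z: "Im z \<noteq> 0"
    and bd: "\<And>r. (cmod (poly r z))\<^sup>2 \<le> B * (LINT x|\<mu>. (cmod (poly r (of_real x)))\<^sup>2)"
    using indeterminate_imp_eval_bound by blast
  define C where "C = 2 + 2 * (cmod z)\<^sup>2"
  have C: "C > 0" unfolding C_def by (intro add_pos_nonneg) auto
  \<comment> \<open>Makes (|B| + 1) C e equal to 1/2, while the evaluation bound would force it to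
    be at least 1.\<close>
  define e where "e = 1 / (2 * (\<bar>B\<bar> + 1) * C)"
  have e: "e > 0" using C by (simp add: e_def)
  obtain r where r: "(LINT x|weighted 1 \<mu>. (cmod (1 / (of_real x - z) - poly r (of_real x)))\<^sup>2) < e"
    using ra z e unfolding resolvent_approx_def by blast
  define s where "s = 1 - [:- z, 1:] * r"
  have sx: "poly s (of_real x) = 1 - (of_real x - z) * poly r (of_real x)" for x
    by (simp add: s_def algebra_simps)
  have "(LINT x|\<mu>. (cmod (poly s (of_real x)))\<^sup>2)
      \<le> (LINT x|\<mu>. C * ((1 + x\<^sup>2) * (cmod (1 / (of_real x - z) - poly r (of_real x)))\<^sup>2))"
  proof (rule integral_mono[OF integrable_poly_sq])
    show "integrable \<mu> (\<lambda>x. C * ((1 + x\<^sup>2) * (cmod (1 / (of_real x - z) - poly r (of_real x)))\<^sup>2))"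
      using integrable_weighted_1_resolvent[OF z] by (rule integrable_mult_right)
    show "(cmod (poly s (of_real x)))\<^sup>2 \<le> C * ((1 + x\<^sup>2) * (cmod (1 / (of_real x - z) - poly r (of_real x)))\<^sup>2)" for x
      unfolding sx resolvent_remainder[OF z] mult.assoc[symmetric] C_def
      by (intro mult_right_mono cmod_square_le_one_plus_square) auto
  qed
  also have "\<dots> = C * (LINT x|weighted 1 \<mu>. (cmod (1 / (of_real x - z) - poly r (of_real x)))\<^sup>2)"
    by (simp only: integral_weighted_1_resolvent integral_mult_right_zero)
  also have "\<dots> \<le> C * e" using r C by (intro mult_left_mono) auto
  finally have I: "(LINT x|\<mu>. (cmod (poly s (of_real x)))\<^sup>2) \<le> C * e" .
  have "1 = (cmod (poly s z))\<^sup>2" by (simp add: s_def)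
  also have "\<dots> \<le> B * (LINT x|\<mu>. (cmod (poly s (of_real x)))\<^sup>2)" by (rule bd)
  also have "\<dots> \<le> (\<bar>B\<bar> + 1) * (C * e)" using I by (intro mult_mono) auto
  also have "\<dots> = 1 / 2"
  proof -
    have "\<bar>B\<bar> + 1 \<noteq> 0" using abs_ge_zero[of B] by linarith
    then show ?thesis using C by (simp add: e_def)
  qed
  finally show False by simp
qed

end

section \<open>The index along the family\<close>

lemma a_index_weighted:
  assumes "\<mu> \<in> Mstar" "\<not> determinate (weighted \<gamma> \<mu>)"
  shows "a_index (weighted \<gamma> \<mu>) = Sup {\<alpha> \<in> {0..1}. \<not> determinate (weighted (\<gamma> - \<alpha>) \<mu>)}"
proof -
  interpret Mstar_measure \<mu> by unfold_locales (rule assms(1))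
  have "weighted (- \<alpha>) (weighted \<gamma> \<mu>) = weighted (\<gamma> - \<alpha>) \<mu>" for \<alpha>
    by (simp add: weighted_weighted)
  then show ?thesis
    unfolding a_index_def Aset_def Mstar_i_def using assms(2) weighted_Mstar by simp
qed

text \<open>Membership in \<open>Mstar_i0\<close> is part of each claim because the index is
  meaningful only there.\<close>

theorem proposition1p5:
  fixes \<mu> :: "real measure"
  assumes "\<mu> \<in> Mstar_i0"
  shows
    "(a_index \<mu> < 1 \<longrightarrow>
       (\<forall>\<delta>::real. 0 < \<delta> \<and> \<delta> < 1 - a_index \<mu> \<longrightarrow>
          weighted \<delta> \<mu> \<in> Mstar_i0 \<and> a_index (weighted \<delta> \<mu>) = a_index \<mu> + \<delta>)) \<and>
     (0 < a_index \<mu> \<longrightarrow>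
       (\<forall>\<delta>::real. 0 < \<delta> \<and> \<delta> < a_index \<mu> \<longrightarrow>
          weighted (- \<delta>) \<mu> \<in> Mstar_i0 \<and> a_index (weighted (- \<delta>) \<mu>) = a_index \<mu> - \<delta>))"
proof -
  have mu: "\<mu> \<in> Mstar" "\<not> determinate \<mu>" "N_extremal \<mu>"
    using assms by (auto simp: Mstar_i0_def Mstar_i_def)
  interpret Mstar_measure \<mu> by unfold_locales (rule mu(1))
  define Ind where "Ind \<gamma> \<longleftrightarrow> \<not> determinate (weighted \<gamma> \<mu>)" for \<gamma>
  define a where "a = a_index \<mu>"
  have Ind_mono: "Ind \<alpha> \<Longrightarrow> \<alpha> \<le> \<beta> \<Longrightarrow> Ind \<beta>" for \<alpha> \<beta>
    unfolding Ind_def using indeterminate_weighted_mono by blast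
  have Ind_0: "Ind 0" using mu by (simp add: Ind_def)
  have approx: "resolvent_approx \<mu>" using N_extremal_iff mu by blast
  have ww: "weighted \<alpha> (weighted \<beta> \<mu>) = weighted (\<alpha> + \<beta>) \<mu>" for \<alpha> \<beta>
    by (rule weighted_weighted) simp
  \<comment> \<open>Restoring the weight 1 + x^2 gives back \<open>\<mu>\<close>, whose resolvents
    are approximable, so Riesz' criterion applies. Hence indeterminacy never extends down to -1, and
    the cut-off at 1 in the supremum hides nothing.\<close>
  have Ind_m1: "\<not> Ind (- 1)"
  proof -
    interpret m: Mstar_measure "weighted (- 1) \<mu>" by (rule weighted_measure)
    have "resolvent_approx (weighted 1 (weighted (- 1) \<mu>))" using approx by (simp add: ww)
    then show ?thesis using m.resolvent_approx_imp_determinate by (simp add: Ind_def)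
  qed
  have index: "a_index (weighted \<gamma> \<mu>) = Sup {\<alpha> \<in> {0..1}. Ind (\<gamma> - \<alpha>)}" if "Ind \<gamma>" for \<gamma>
    unfolding Ind_def using a_index_weighted[OF mu(1)] that by (simp add: Ind_def)
  define A where "A = {\<alpha> \<in> {0..1}. Ind (- \<alpha>)}"
  have a: "a = Sup A" using index[OF Ind_0] by (simp add: a_def A_def)
  have bdd: "bdd_above A" by (rule bdd_aboveI[of _ 1]) (simp add: A_def)
  have A0: "0 \<in> A" using Ind_0 by (simp add: A_def)
  have a0: "0 \<le> a" unfolding a by (rule cSup_upper[OF A0 bdd])
  have below: "Ind (- \<alpha>)" if "\<alpha> < a" for \<alpha>
  proof -
    obtain \<beta> where \<beta>: "\<beta> \<in> A" "\<alpha> < \<beta>"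
      using \<open>\<alpha> < a\<close> less_cSup_iff[OF _ bdd, of \<alpha>] A0 unfolding a by auto
    have "Ind (- \<beta>)" using \<beta>(1) by (simp add: A_def)
    then show ?thesis by (rule Ind_mono) (use \<beta>(2) in simp)
  qed
  have above: "\<not> Ind (- \<alpha>)" if "a < \<alpha>" for \<alpha>
  proof
    assume I: "Ind (- \<alpha>)"
    show False
    proof (cases "\<alpha> \<le> 1")
      case True
      then have "\<alpha> \<in> A" using I that a0 by (simp add: A_def)
      then show False using cSup_upper[OF _ bdd] that unfolding a by force
    next
      case False
      then show False using Ind_mono[OF I, of "- 1"] Ind_m1 by simp
    qed
  qed
  have ext: "weighted \<gamma> \<mu> \<in> Mstar_i0" if "Ind \<gamma>" "resolvent_approx (weighted \<gamma> \<mu>)" for \<gamma>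
  proof -
    interpret w: Mstar_measure "weighted \<gamma> \<mu>" by (rule weighted_measure)
    show ?thesis
      using that w.N_extremal_iff weighted_Mstar by (simp add: Mstar_i0_def Mstar_i_def Ind_def)
  qed
  have part_a: "weighted \<delta> \<mu> \<in> Mstar_i0 \<and> a_index (weighted \<delta> \<mu>) = a + \<delta>"
    if \<delta>: "0 < \<delta>" "\<delta> < 1 - a" for \<delta>
  proof
    have Id: "Ind \<delta>" using Ind_mono[OF Ind_0] \<delta> by simp
    \<comment> \<open>A midpoint of the nonempty interval from a to 1 - \<delta>: above a for
      determinacy, below 1 - \<delta> so that 1 - \<beta> dominates \<delta>.\<close>
    define \<beta> where "\<beta> = (a + (1 - \<delta>)) / 2"
    have \<beta>: "a < \<beta>" "\<delta> \<le> 1 - \<beta>" using \<delta> by (simp_all add: \<beta>_def field_simps)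
    interpret b: Mstar_measure "weighted (- \<beta>) \<mu>" by (rule weighted_measure)
    have "determinate (weighted (- \<beta>) \<mu>)" using above[OF \<beta>(1)] by (simp add: Ind_def)
    then have "resolvent_approx (weighted 1 (weighted (- \<beta>) \<mu>))" by (rule b.determinate_imp_resolvent_approx)
    then have "resolvent_approx (weighted (1 - \<beta>) \<mu>)" by (simp add: ww)
    then have "resolvent_approx (weighted \<delta> \<mu>)" by (rule resolvent_approx_weighted_mono[OF \<beta>(2)])
    with Id show "weighted \<delta> \<mu> \<in> Mstar_i0" by (rule ext)
    have "Sup {\<alpha> \<in> {0..1}. Ind (\<delta> - \<alpha>)} = a + \<delta>"
    proof (rule cSup_eq)
      fix \<alpha> assume "\<alpha> \<in> {\<alpha> \<in> {0..1}. Ind (\<delta> - \<alpha>)}"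
      then have "Ind (- (\<alpha> - \<delta>))" by simp
      then have "\<not> a < \<alpha> - \<delta>" using above by blast
      then show "\<alpha> \<le> a + \<delta>" by simp
    next
      fix y assume y: "\<And>\<alpha>. \<alpha> \<in> {\<alpha> \<in> {0..1}. Ind (\<delta> - \<alpha>)} \<Longrightarrow> \<alpha> \<le> y"
      \<comment> \<open>The element \<delta> of the set corresponds to \<open>\<mu>\<close> itself.
        The bound keeps the midpoint of y and a + \<delta> used below inside [0,1].\<close>
      have "\<delta> \<le> y" using y[of \<delta>] \<delta> a0 Ind_0 by simp
      show "a + \<delta> \<le> y"
      proof (rule ccontr)
        assume "\<not> a + \<delta> \<le> y"
        then have *: "y < (y + a + \<delta>) / 2" "(y + a + \<delta>) / 2 < a + \<delta>" by (simp_all add: field_simps)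
        then have "Ind (- ((y + a + \<delta>) / 2 - \<delta>))" by (intro below) simp
        then have "Ind (\<delta> - (y + a + \<delta>) / 2)" by (simp only: minus_diff_eq)
        then have "(y + a + \<delta>) / 2 \<le> y"
          using \<open>\<delta> \<le> y\<close> * \<delta> a0 by (intro y) auto
        then show False using *(1) by simp
      qed
    qed
    then show "a_index (weighted \<delta> \<mu>) = a + \<delta>" using index[OF Id] by simp
  qed
  have part_b: "weighted (- \<delta>) \<mu> \<in> Mstar_i0 \<and> a_index (weighted (- \<delta>) \<mu>) = a - \<delta>"
    if \<delta>: "0 < \<delta>" "\<delta> < a" for \<delta>
  proof
    have Id: "Ind (- \<delta>)" by (rule below[OF \<delta>(2)])
    have "resolvent_approx (weighted (- \<delta>) \<mu>)"
      by (rule resolvent_approx_weighted_mono[of _ 0]) (use \<delta> approx in auto)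
    with Id show "weighted (- \<delta>) \<mu> \<in> Mstar_i0" by (rule ext)
    have a1: "a \<le> 1" using above[of 1] below[of 1] Ind_m1 by (metis not_le)
    have "Sup {\<alpha> \<in> {0..1}. Ind (- \<delta> - \<alpha>)} = a - \<delta>"
    proof (rule cSup_eq)
      fix \<alpha> assume "\<alpha> \<in> {\<alpha> \<in> {0..1}. Ind (- \<delta> - \<alpha>)}"
      then have "Ind (- (\<delta> + \<alpha>))" by simp
      then have "\<not> a < \<delta> + \<alpha>" using above by blast
      then show "\<alpha> \<le> a - \<delta>" by simp
    next
      fix y assume y: "\<And>\<alpha>. \<alpha> \<in> {\<alpha> \<in> {0..1}. Ind (- \<delta> - \<alpha>)} \<Longrightarrow> \<alpha> \<le> y"
      \<comment> \<open>Together with a \<le> 1 this keeps the midpoint of y and a - \<delta> inside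
        [0,1].\<close>
      have "0 \<le> y" using y[of 0] Id by simp
      show "a - \<delta> \<le> y"
      proof (rule ccontr)
        assume "\<not> a - \<delta> \<le> y"
        then have *: "y < (y + a - \<delta>) / 2" "(y + a - \<delta>) / 2 < a - \<delta>" by (simp_all add: field_simps)
        then have "Ind (- (\<delta> + (y + a - \<delta>) / 2))" by (intro below) linarith
        then have "Ind (- \<delta> - (y + a - \<delta>) / 2)" by simp
        then have "(y + a - \<delta>) / 2 \<le> y"
          using \<open>0 \<le> y\<close> * \<delta> a1 by (intro y) auto
        then show False using *(1) by simp
      qed
    qed
    then show "a_index (weighted (- \<delta>) \<mu>) = a - \<delta>" using index[OF Id] by simp
  qed
  show ?thesis using part_a part_b unfolding a_def by blast
qed

end
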